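(* Assume $\mathbf{f}^d_t=0$ for all $t\in[T-1]$. Let $t\in[T]$. Then, for any $\varepsilon_1,\varepsilon_2>0$ satisfying $\varepsilon_1+\varepsilon_2=\log U-\mathbb{E}\log L_t^*$, $$\mathbb{P}(\log L_t^*\ge\log U)\le \exp\Big\{-\frac{\varepsilon_1^2}{2\|(\Sigma^w_t)^{\frac12}(\mathcal{L}^1_t+2\mathcal{L}^{2,s}_tm^w_t)\|_2^2}\Big\}+\exp\Big\{-\frac18\Big(\frac{\varepsilon_2^2}{\|(\Sigma^w_t)^{\frac12}\mathcal{L}^{2,s}_t(\Sigma^w_t)^{\frac12}\|_F^2}\wedge\frac{\varepsilon_2}{\|(\Sigma^w_t)^{\frac12}\mathcal{L}^{2,s}_t(\Sigma^w_t)^{\frac12}\|_2}\Big)\Big\},$$ where $\mathbb{E}\log L_t^*$ is given explicitly by $$\mathbb{E}\log L_t^*=-\frac12\sum_{k=0}^{t-1}\Big\{2\mathbf{s}_{k+1}^TH_k^{-1}E_2(\Sigma_y^2)^{-1}F_k^Tm_k^*+\mathrm{Tr}\Big[\big[F_k(\Sigma_y^2)^{-1}F_k^T+2G_kH_k^{-1}E_2(\Sigma_y^2)^{-1}F_k^T\big]\big[\Sigma_k^*+m_k^*(m_k^* )^T\big]\Big]\Big\}.$$ The quantities $L_t^*$, $U$, $\mathcal{L}^1_t$, $\mathcal{L}^{2,s}_t$, $m^w_t$, $\Sigma^w_t$, $m_k^*$, $\Sigma_k^*$, $\mathbf{s}_k$, $H_k$, $G_k$, $E_2$, $F_k$ are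 as defined in the context.
   Context: Notation: $[N]:=\{0,\dots,N\}$; $a\wedge b=\min\{a,b\}$, $a\vee b=\max\{a,b\}$; $\mathbb{I}$ is the indicator; $\|\cdot\|_2$ is the Euclidean norm for vectors and the spectral norm for matrices, $\|\cdot\|_F$ the Frobenius norm; $M^s:=(M+M^T)/2$; $\|\mathbf{x}\|_M^2:=\mathbf{x}^TM\mathbf{x}$; $\mathrm{Concat}$ stacks vectors; $\mathrm{diag}$ forms a block-diagonal matrix. Empty sums are $0$, empty matrix products are the identity. Data: $n,T\in\mathbb{N}$; $\Sigma_z^2,\Sigma_y^2,R_\alpha,R_\beta,R_v,T_v\in\mathbb{R}^{n\times n}$ symmetric positive definite; $\bar{\mathbf{v}}_t\in\mathbb{R}^n$ ($t\in[T]$) given; $F^b_t,F^c_t\in\mathbb{R}^{n\times n}$, $\mathbf{f}^d_t\in\mathbb{R}^n$ ($t\in[T-1]$) given; $\lambda\ge0$ satisfies $I_n-\lambda(\Sigma_y^2)^{-\frac12}R_\beta^{-1}(\Sigma_y^2)^{-\frac12}\succeq0$ (a condition ensuring that the recursions below are well-posed with all $H_t$ invertible). Noises $Z_t\sim\mathcal{N}(0,\Sigma_z^2)$, $Y_t\sim\mathcal{N}(0,\Sigma_y^2)$, $t\in[T-1]$, are all mutually independent. $U=(1-b)/a$ with given $a,b\in(0,\frac12)$ (upper threshold of a sequential probability ratio test). Dynamics: the state $\mathbf{x}_t=\mathrm{Concat}(\mathbf{v}_t,\mathbf{p}_t)\in\mathbb{R}^{2n}$, control $\mathbf{u}_t=\mathrm{Concat}(\alpha_t,\beta_t)$,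 with $\mathbf{v}_{t+1}=\alpha_t+\mathbf{v}_t+Z_t$, $\mathbf{p}_{t+1}=(\mathbf{v}_t+\beta_t)+\mathbf{p}_t+Y_t$, i.e. $\mathbf{x}_{t+1}=A\mathbf{x}_t+B\mathbf{u}_t+\mathbf{w}_t$, $\mathbf{w}_t=\mathrm{Concat}(Z_t,Y_t)$, $A=\begin{bmatrix}I_n&0\\ I_n&I_n\end{bmatrix}$, $B=I_{2n}$, with deterministic initial state $\mathbf{x}_0\in\mathbb{R}^{2n}$. Coefficients: $R=\mathrm{diag}(R_\alpha,R_\beta)$, $$Q_t=\begin{bmatrix}R_v+\lambda(F^b_t)^T(\Sigma_y^2)^{-1}F^b_t&\lambda(F^b_t)^T(\Sigma_y^2)^{-1}F^c_t\\ \lambda(F^c_t)^T(\Sigma_y^2)^{-1}F^b_t&\lambda(F^c_t)^T(\Sigma_y^2)^{-1}F^c_t\end{bmatrix},\quad N_t=\begin{bmatrix}0&-\lambda(F^b_t)^T(\Sigma_y^2)^{-1}\\0&-\lambda(F^c_t)^T(\Sigma_y^2)^{-1}\end{bmatrix},$$ $$\mathbf{q}_t=\begin{bmatrix}-R_v\bar{\mathbf{v}}_t+\lambda(F^b_t)^T(\Sigma_y^2)^{-1}\mathbf{f}^d_t\\ \lambda(F^c_t)^T(\Sigma_y^2)^{-1}\mathbf{f}^d_t\end{bmatrix},\quad \mathbf{r}_t=\begin{bmatrix}0\\-\lambda(\Sigma_y^2)^{-1}\mathbf{f}^d_t\end{bmatrix}.$$ For $t\in[T-1]$: $M_t=Q_t+A^TP_{t+1}A$,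 $H_t=R+B^TP_{t+1}B$, $G_t=N_t+A^TP_{t+1}B$, $P_t=M_t-G_tH_t^{-1}G_t^T$, $\mathbf{s}_t=\mathbf{q}_t+A^T\mathbf{s}_{t+1}-G_tH_t^{-1}(\mathbf{r}_t+B^T\mathbf{s}_{t+1})$, with $P_T=\mathrm{diag}(T_v,0)$, $\mathbf{s}_T=\mathrm{Concat}(-T_v^T\bar{\mathbf{v}}_T,0)$. Optimal deceptive control: $\mathbf{u}_t^*=-H_t^{-1}(G_t^T\mathbf{x}_t^*+\mathbf{r}_t+B^T\mathbf{s}_{t+1})$, where $\mathbf{x}^*=\mathrm{Concat}(\mathbf{v}^*,\mathbf{p}^* )$ is the state process driven by $\mathbf{u}^*$ with $\mathbf{x}^*_0=\mathbf{x}_0$. Log-likelihood ratio statistic (testing $\mathsf{H}_1:\beta_k=F^b_k\mathbf{v}_k+F^c_k\mathbf{p}_k+\mathbf{f}^d_k$ against $\mathsf{H}_0:\beta_k=0$), evaluated along $\mathbf{x}^*$: $$\log L_t^*:=\frac12\sum_{k=0}^{t-1}\Big[\|\mathbf{p}^*_{k+1}-\mathbf{v}^*_k-\mathbf{p}^*_k\|^2_{(\Sigma_y^2)^{-1}}-\|\mathbf{p}^*_{k+1}-\mathbf{v}^*_k-\mathbf{p}^*_k-F^b_k\mathbf{v}^*_k-F^c_k\mathbf{p}^*_k-\mathbf{f}^d_k\|^2_{(\Sigma_y^2)^{-1}}\Big].$$ Further definitions: $E_2:=\begin{bmatrix}0_{n\times n}&I_n\end{bmatrix}^T$, $F_k:=\begin{bmatrix}F^b_k&F^c_k\end{bmatrix}^T\in\mathbb{R}^{2n\times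 n}$, $K_k:=A^T-G_kH_k^{-1}$, $\Sigma_w:=\mathrm{diag}(\Sigma_z^2,\Sigma_y^2)$. Mean and covariance sequences: $m_0^*=\mathbf{x}_0$, $\Sigma_0^*=0$, and for $k\ge1$ $$m_k^*=K_{k-1}^Tm_{k-1}^*-H_{k-1}^{-1}\mathbf{s}_k,$$ $$\Sigma_k^*=K_{k-1}^T(\Sigma_{k-1}^*+m_{k-1}^*(m_{k-1}^* )^T)K_{k-1}-K_{k-1}^Tm_{k-1}^*\mathbf{s}_k^TH_{k-1}^{-1}-H_{k-1}^{-1}\mathbf{s}_k(m_{k-1}^* )^TK_{k-1}+H_{k-1}^{-1}\mathbf{s}_k\mathbf{s}_k^TH_{k-1}^{-1}+\Sigma_w-m_k^*(m_k^* )^T.$$ $$\mathcal{C}_{j+1,k-1}:=K_{k-1}^T\cdots K_{j+1}^T\in\mathbb{R}^{2n\times2n},\quad \mathcal{D}_{k-1}:=-\sum_{j=0}^{k-1}\mathcal{C}_{j+1,k-1}H_j^{-1}\mathbf{s}_{j+1}\in\mathbb{R}^{2n},$$ $$\mathcal{S}_k:=F_k(\Sigma_y^2)^{-1}F_k^T+2G_kH_k^{-1}E_2(\Sigma_y^2)^{-1}F_k^T\in\mathbb{R}^{2n\times2n}.$$ $\mathcal{L}^1_t\in\mathbb{R}^{2n(t+1)}$ is the concatenation, over $k=-1,0,\dots,t-1$, of the vectors $$\mathbb{I}_{\{k\ge0\}}E_2(\Sigma_y^2)^{-1}F_k^T\mathcal{D}_{k-1}-\mathbb{I}_{\{k\le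 t-2\}}\sum_{j=k+1}^{t-1}\mathcal{C}_{k+1,j-1}^T\big[F_j(\Sigma_y^2)^{-1}E_2^TH_j^{-1}\mathbf{s}_{j+1}+\mathcal{S}_j^s\mathcal{D}_{j-1}\big].$$ $\mathcal{L}^2_t\in\mathbb{R}^{2n(t+1)\times2n(t+1)}$ has $2n\times2n$ blocks, indexed by $i,j\in\{-1,0,\dots,t-1\}$, $$(\mathcal{L}^2_t)_{ij}:=\frac12\Big(2\,\mathbb{I}_{\{0\le i\le t-1,\,-1\le j\le i-1\}}E_2(\Sigma_y^2)^{-1}F_i^T\mathcal{C}_{j+1,i-1}-\mathbb{I}_{\{i\vee j\le t-2\}}\sum_{k=i\vee j+1}^{t-1}\mathcal{C}_{i+1,k-1}^T\mathcal{S}_k^T\mathcal{C}_{j+1,k-1}\Big),$$ and $\mathcal{L}^{2,s}_t:=[\mathcal{L}^2_t+(\mathcal{L}^2_t)^T]/2$. Finally $m^w_t:=\mathrm{Concat}(m_0^*,0,\dots,0)\in\mathbb{R}^{2n(t+1)}$ and $\Sigma^w_t:=\mathrm{diag}(\Sigma_0^*,\Sigma_z^2,\Sigma_y^2,\dots,\Sigma_z^2,\Sigma_y^2)\in\mathbb{R}^{2n(t+1)\times2n(t+1)}$ (with $t$ copies of the pair $\Sigma_z^2,\Sigma_y^2$). *)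

theory Defs
  imports "HOL-Probability.Probability"
begin

section \<open>Matrices\<close>

definition sym_part :: "real^'m^'m \<Rightarrow> real^'m^'m" where
  "sym_part A = (1/2) *\<^sub>R (A + transpose A)"

definition psd :: "real^'m^'m \<Rightarrow> bool" where
  "psd A \<longleftrightarrow> transpose A = A \<and> (\<forall>x. 0 \<le> x \<bullet> (A *v x))"

definition spd :: "real^'m^'m \<Rightarrow> bool" where
  "spd A \<longleftrightarrow> transpose A = A \<and> (\<forall>x. x \<noteq> 0 \<longrightarrow> 0 < x \<bullet> (A *v x))"

text \<open>The positive semidefinite square root; meaningful for positive semidefinite arguments.\<close>

definition psd_sqrt :: "real^'m^'m \<Rightarrow> real^'m^'m" where
  "psd_sqrt A = (THE B. psd B \<and> B ** B = A)"

abbreviation spectral_norm :: "real^'c^'r \<Rightarrow> real" where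
  "spectral_norm A \<equiv> onorm ((*v) A)"

text \<open>The norm of the type of matrices is the Euclidean norm of the vector of row norms.\<close>

abbreviation frobenius_norm :: "real^'c^'r \<Rightarrow> real" where
  "frobenius_norm A \<equiv> norm A"

text \<open>\<open>sq_norm_wrt M x\<close> is \<open>x\<^sup>T M x\<close>, and \<open>outer x y\<close> is \<open>x y\<^sup>T\<close>.\<close>

definition sq_norm_wrt :: "real^'m^'m \<Rightarrow> real^'m \<Rightarrow> real" where
  "sq_norm_wrt M x = x \<bullet> (M *v x)"

definition outer :: "real^'r \<Rightarrow> real^'c \<Rightarrow> real^'c^'r" where
  "outer x y = (\<chi> i j. x $ i * y $ j)"

text \<open>
  Vectors and matrices of size \<open>2n\<close> are indexed by \<open>'n + 'n\<close>. In \<open>block_mat P Q R S\<close> the first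
  block row is \<open>P, Q\<close> and the second one is \<open>R, S\<close>.
\<close>

definition vconcat :: "real^'a \<Rightarrow> real^'b \<Rightarrow> real^('a::finite + 'b::finite)" where
  "vconcat x y = (\<chi> i. case i of Inl a \<Rightarrow> x $ a | Inr b \<Rightarrow> y $ b)"

definition upper :: "real^('a::finite + 'b::finite) \<Rightarrow> real^'a" where
  "upper x = (\<chi> a. x $ Inl a)"

definition lower :: "real^('a::finite + 'b::finite) \<Rightarrow> real^'b" where
  "lower x = (\<chi> b. x $ Inr b)"

definition hcat :: "real^'a^'r \<Rightarrow> real^'b^'r \<Rightarrow> real^('a::finite + 'b::finite)^'r" where
  "hcat P Q = (\<chi> i. vconcat (P $ i) (Q $ i))"

definition block_mat ::
  "real^'a^'r \<Rightarrow> real^'b^'r \<Rightarrow> real^'a^'s \<Rightarrow> real^'b^'s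
    \<Rightarrow> real^('a::finite + 'b::finite)^('r::finite + 's::finite)" where
  "block_mat P Q R S = (\<chi> i. case i of Inl r \<Rightarrow> hcat P Q $ r | Inr s \<Rightarrow> hcat R S $ s)"

abbreviation block_diag ::
  "real^'a^'r \<Rightarrow> real^'b^'s \<Rightarrow> real^('a::finite + 'b::finite)^('r::finite + 's::finite)" where
  "block_diag P S \<equiv> block_mat P 0 0 S"

text \<open>
  Stacked vectors and matrices with \<open>t + 1\<close> blocks are indexed by \<open>'k \<times> 'm\<close>, where
  \<open>pos :: 'k \<Rightarrow> nat\<close> is a bijection onto \<open>{..t}\<close> giving the position of a block and \<open>'m\<close> indexes the
  entries of a block.
\<close>

definition stack_vec :: "('k::finite \<Rightarrow> nat) \<Rightarrow> (nat \<Rightarrow> real^'m) \<Rightarrow> real^('k \<times> 'm)" where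
  "stack_vec pos f = (\<chi> r. f (pos (fst r)) $ snd r)"

definition stack_mat ::
  "('k::finite \<Rightarrow> nat) \<Rightarrow> (nat \<Rightarrow> nat \<Rightarrow> real^'m^'m) \<Rightarrow> real^('k \<times> 'm)^('k \<times> 'm)" where
  "stack_mat pos f = (\<chi> r c. f (pos (fst r)) (pos (fst c)) $ snd r $ snd c)"

section \<open>Gaussian vectors and exponential bounds\<close>

text \<open>Density of \<open>N(\<mu>, S)\<close> for a positive definite covariance matrix \<open>S\<close>.\<close>

definition mvnormal_density :: "real^'m \<Rightarrow> real^'m^'m \<Rightarrow> real^'m \<Rightarrow> real" where
  "mvnormal_density \<mu> S x =
     exp (- sq_norm_wrt (matrix_inv S) (x - \<mu>) / 2) / sqrt ((2 * pi) ^ CARD('m) * det S)"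

text \<open>
  \<open>exp_neg x\<close> is \<open>exp (- x)\<close> with \<open>exp (- \<infinity>) = 0\<close>. Extended reals are used because the quotients in
  the tail bound may have denominator \<open>0\<close>; in \<open>ereal\<close>, \<open>c / 0 = \<infinity>\<close> for \<open>c > 0\<close>.
\<close>

definition exp_neg :: "ereal \<Rightarrow> real" where
  "exp_neg x = (if x = \<infinity> then 0 else exp (- real_of_ereal x))"

section \<open>The control problem\<close>

text \<open>
  \<open>Sz2\<close> and \<open>Sy2\<close> are the covariance matrices \<open>\<Sigma>\<^sub>z\<^sup>2\<close> and \<open>\<Sigma>\<^sub>y\<^sup>2\<close> themselves.
  Functions of time are only meaningful on \<open>{..horizon}\<close> (\<open>vbar\<close>) and \<open>{..<horizon}\<close> (\<open>Fb\<close>, \<open>Fc\<close>,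
  \<open>fd\<close>).
\<close>

record ('n::finite) control_problem =
  horizon :: nat
  Sz2 :: "real^'n^'n"
  Sy2 :: "real^'n^'n"
  R_alpha :: "real^'n^'n"
  R_beta :: "real^'n^'n"
  R_v :: "real^'n^'n"
  T_v :: "real^'n^'n"
  vbar :: "nat \<Rightarrow> real^'n"
  Fb :: "nat \<Rightarrow> real^'n^'n"
  Fc :: "nat \<Rightarrow> real^'n^'n"
  fd :: "nat \<Rightarrow> real^'n"
  lam :: real
  x_init :: "real^('n + 'n)"

abbreviation Sy2_inv :: "'n::finite control_problem \<Rightarrow> real^'n^'n" where
  "Sy2_inv D \<equiv> matrix_inv (Sy2 D)"

definition A_mat :: "real^('n + 'n)^('n + 'n::finite)" where
  "A_mat = block_mat (mat 1) 0 (mat 1) (mat 1)"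

definition B_mat :: "real^('n + 'n)^('n + 'n::finite)" where
  "B_mat = mat 1"

definition R_mat :: "'n::finite control_problem \<Rightarrow> real^('n + 'n)^('n + 'n)" where
  "R_mat D = block_diag (R_alpha D) (R_beta D)"

definition Q_mat :: "'n::finite control_problem \<Rightarrow> nat \<Rightarrow> real^('n + 'n)^('n + 'n)" where
  "Q_mat D t = block_mat
     (R_v D + lam D *\<^sub>R (transpose (Fb D t) ** Sy2_inv D ** Fb D t))
     (lam D *\<^sub>R (transpose (Fb D t) ** Sy2_inv D ** Fc D t))
     (lam D *\<^sub>R (transpose (Fc D t) ** Sy2_inv D ** Fb D t))
     (lam D *\<^sub>R (transpose (Fc D t) ** Sy2_inv D ** Fc D t))"

definition N_mat :: "'n::finite control_problem \<Rightarrow> nat \<Rightarrow> real^('n + 'n)^('n + 'n)" where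
  "N_mat D t = block_mat
     0 (- (lam D *\<^sub>R (transpose (Fb D t) ** Sy2_inv D)))
     0 (- (lam D *\<^sub>R (transpose (Fc D t) ** Sy2_inv D)))"

definition q_vec :: "'n::finite control_problem \<Rightarrow> nat \<Rightarrow> real^('n + 'n)" where
  "q_vec D t = vconcat
     (- (R_v D *v vbar D t) + lam D *\<^sub>R ((transpose (Fb D t) ** Sy2_inv D) *v fd D t))
     (lam D *\<^sub>R ((transpose (Fc D t) ** Sy2_inv D) *v fd D t))"

definition r_vec :: "'n::finite control_problem \<Rightarrow> nat \<Rightarrow> real^('n + 'n)" where
  "r_vec D t = vconcat 0 (- (lam D *\<^sub>R (Sy2_inv D *v fd D t)))"

text \<open>
  In \<open>M_of\<close>, \<open>H_of\<close> and \<open>G_of\<close> the argument \<open>P\<close> stands for \<open>P\<^sub>t\<^sub>+\<^sub>1\<close>.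
\<close>

definition M_of ::
  "'n::finite control_problem \<Rightarrow> nat \<Rightarrow> real^('n + 'n)^('n + 'n) \<Rightarrow> real^('n + 'n)^('n + 'n)" where
  "M_of D t P = Q_mat D t + transpose A_mat ** P ** A_mat"

definition H_of ::
  "'n::finite control_problem \<Rightarrow> real^('n + 'n)^('n + 'n) \<Rightarrow> real^('n + 'n)^('n + 'n)" where
  "H_of D P = R_mat D + transpose B_mat ** P ** B_mat"

definition G_of ::
  "'n::finite control_problem \<Rightarrow> nat \<Rightarrow> real^('n + 'n)^('n + 'n) \<Rightarrow> real^('n + 'n)^('n + 'n)" where
  "G_of D t P = N_mat D t + transpose A_mat ** P ** B_mat"

function P_mat :: "'n::finite control_problem \<Rightarrow> nat \<Rightarrow> real^('n + 'n)^('n + 'n)" where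
  "P_mat D t =
     (if t < horizon D then
        M_of D t (P_mat D (Suc t))
        - G_of D t (P_mat D (Suc t)) ** matrix_inv (H_of D (P_mat D (Suc t)))
          ** transpose (G_of D t (P_mat D (Suc t)))
      else block_diag (T_v D) 0)"
  by pat_completeness auto
termination by (relation "Wellfounded.measure (\<lambda>(D, t). horizon D - t)") auto

declare P_mat.simps [simp del]

definition H_mat :: "'n::finite control_problem \<Rightarrow> nat \<Rightarrow> real^('n + 'n)^('n + 'n)" where
  "H_mat D t = H_of D (P_mat D (Suc t))"

definition G_mat :: "'n::finite control_problem \<Rightarrow> nat \<Rightarrow> real^('n + 'n)^('n + 'n)" where
  "G_mat D t = G_of D t (P_mat D (Suc t))"

abbreviation H_inv :: "'n::finite control_problem \<Rightarrow> nat \<Rightarrow> real^('n + 'n)^('n + 'n)" where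
  "H_inv D t \<equiv> matrix_inv (H_mat D t)"

function s_vec :: "'n::finite control_problem \<Rightarrow> nat \<Rightarrow> real^('n + 'n)" where
  "s_vec D t =
     (if t < horizon D then
        q_vec D t + transpose A_mat *v s_vec D (Suc t)
        - (G_mat D t ** H_inv D t) *v (r_vec D t + transpose B_mat *v s_vec D (Suc t))
      else vconcat (- (transpose (T_v D) *v vbar D (horizon D))) 0)"
  by pat_completeness auto
termination by (relation "Wellfounded.measure (\<lambda>(D, t). horizon D - t)") auto

declare s_vec.simps [simp del]

definition u_opt :: "'n::finite control_problem \<Rightarrow> nat \<Rightarrow> real^('n + 'n) \<Rightarrow> real^('n + 'n)" where
  "u_opt D t x =
     - (H_inv D t *v (transpose (G_mat D t) *v x + r_vec D t + transpose B_mat *v s_vec D (Suc t)))"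

primrec x_opt ::
  "'n::finite control_problem \<Rightarrow> (nat \<Rightarrow> 'a \<Rightarrow> real^'n) \<Rightarrow> (nat \<Rightarrow> 'a \<Rightarrow> real^'n) \<Rightarrow> nat \<Rightarrow> 'a
    \<Rightarrow> real^('n + 'n)" where
  "x_opt D Z Y 0 \<omega> = x_init D"
| "x_opt D Z Y (Suc t) \<omega> =
     A_mat *v x_opt D Z Y t \<omega> + B_mat *v u_opt D t (x_opt D Z Y t \<omega>) + vconcat (Z t \<omega>) (Y t \<omega>)"

abbreviation v_opt where "v_opt D Z Y t \<omega> \<equiv> upper (x_opt D Z Y t \<omega>)"
abbreviation p_opt where "p_opt D Z Y t \<omega> \<equiv> lower (x_opt D Z Y t \<omega>)"

definition log_L ::
  "'n::finite control_problem \<Rightarrow> (nat \<Rightarrow> 'a \<Rightarrow> real^'n) \<Rightarrow> (nat \<Rightarrow> 'a \<Rightarrow> real^'n) \<Rightarrow> nat \<Rightarrow> 'a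
    \<Rightarrow> real" where
  "log_L D Z Y t \<omega> = (1/2) * (\<Sum>k<t.
     sq_norm_wrt (Sy2_inv D)
       (p_opt D Z Y (Suc k) \<omega> - v_opt D Z Y k \<omega> - p_opt D Z Y k \<omega>)
     - sq_norm_wrt (Sy2_inv D)
       (p_opt D Z Y (Suc k) \<omega> - v_opt D Z Y k \<omega> - p_opt D Z Y k \<omega>
        - Fb D k *v v_opt D Z Y k \<omega> - Fc D k *v p_opt D Z Y k \<omega> - fd D k))"

section \<open>Quantities in the tail bound\<close>

definition E2_mat :: "real^'n^('n + 'n::finite)" where
  "E2_mat = transpose (hcat 0 (mat 1))"

definition F_mat :: "'n::finite control_problem \<Rightarrow> nat \<Rightarrow> real^'n^('n + 'n)" where
  "F_mat D k = transpose (hcat (Fb D k) (Fc D k))"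

definition K_mat :: "'n::finite control_problem \<Rightarrow> nat \<Rightarrow> real^('n + 'n)^('n + 'n)" where
  "K_mat D k = transpose A_mat - G_mat D k ** H_inv D k"

definition Sw_mat :: "'n::finite control_problem \<Rightarrow> real^('n + 'n)^('n + 'n)" where
  "Sw_mat D = block_diag (Sz2 D) (Sy2 D)"

primrec mean_seq :: "'n::finite control_problem \<Rightarrow> nat \<Rightarrow> real^('n + 'n)" where
  "mean_seq D 0 = x_init D"
| "mean_seq D (Suc k) =
     transpose (K_mat D k) *v mean_seq D k - H_inv D k *v s_vec D (Suc k)"

primrec cov_seq :: "'n::finite control_problem \<Rightarrow> nat \<Rightarrow> real^('n + 'n)^('n + 'n)" where
  "cov_seq D 0 = 0"
| "cov_seq D (Suc k) =
     transpose (K_mat D k) ** (cov_seq D k + outer (mean_seq D k) (mean_seq D k)) ** K_mat D k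
     - transpose (K_mat D k) ** outer (mean_seq D k) (s_vec D (Suc k)) ** H_inv D k
     - H_inv D k ** outer (s_vec D (Suc k)) (mean_seq D k) ** K_mat D k
     + H_inv D k ** outer (s_vec D (Suc k)) (s_vec D (Suc k)) ** H_inv D k
     + Sw_mat D
     - outer (mean_seq D (Suc k)) (mean_seq D (Suc k))"

text \<open>
  The upper index is shifted by one to stay in the natural numbers:
  \<open>C_prod D i k = K\<^sub>k\<^sub>-\<^sub>1\<^sup>T \<cdots> K\<^sub>i\<^sup>T\<close> is \<open>\<C>\<^sub>i\<^sub>,\<^sub>k\<^sub>-\<^sub>1\<close>, which is the identity for \<open>k \<le> i\<close>, and
  \<open>D_sum D k\<close> is \<open>\<D>\<^sub>k\<^sub>-\<^sub>1\<close>.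
\<close>

primrec C_prod :: "'n::finite control_problem \<Rightarrow> nat \<Rightarrow> nat \<Rightarrow> real^('n + 'n)^('n + 'n)" where
  "C_prod D i 0 = mat 1"
| "C_prod D i (Suc k) = (if i \<le> k then transpose (K_mat D k) ** C_prod D i k else mat 1)"

definition D_sum :: "'n::finite control_problem \<Rightarrow> nat \<Rightarrow> real^('n + 'n)" where
  "D_sum D k = - (\<Sum>j<k. (C_prod D (Suc j) k ** H_inv D j) *v s_vec D (Suc j))"

definition S_mat :: "'n::finite control_problem \<Rightarrow> nat \<Rightarrow> real^('n + 'n)^('n + 'n)" where
  "S_mat D k =
     F_mat D k ** Sy2_inv D ** transpose (F_mat D k)
     + 2 *\<^sub>R (G_mat D k ** H_inv D k ** E2_mat ** Sy2_inv D ** transpose (F_mat D k))"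

text \<open>
  Blocks are numbered from \<open>0\<close> to \<open>t\<close>: block \<open>i\<close> here is the block with index \<open>i - 1\<close> in the range
  \<open>-1, \<dots>, t - 1\<close>. In terms of the original index \<open>k = i - 1\<close>, the conditions \<open>k \<ge> 0\<close> and
  \<open>k \<le> t - 2\<close> become \<open>1 \<le> i\<close> and \<open>i < t\<close>, and \<open>\<C>\<^sub>k\<^sub>+\<^sub>1\<^sub>,\<^sub>j\<^sub>-\<^sub>1\<close> becomes \<open>C_prod D i j\<close>.
\<close>

definition L1_block :: "'n::finite control_problem \<Rightarrow> nat \<Rightarrow> nat \<Rightarrow> real^('n + 'n)" where
  "L1_block D t i =
     (if 1 \<le> i
      then (E2_mat ** Sy2_inv D ** transpose (F_mat D (i - 1))) *v D_sum D (i - 1) else 0)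
     - (if i < t
        then \<Sum>j\<in>{i..t - 1}. transpose (C_prod D i j) *v
               ((F_mat D j ** Sy2_inv D ** transpose E2_mat ** H_inv D j) *v s_vec D (Suc j)
                + sym_part (S_mat D j) *v D_sum D j)
        else 0)"

definition L2_block :: "'n::finite control_problem \<Rightarrow> nat \<Rightarrow> nat \<Rightarrow> nat \<Rightarrow> real^('n + 'n)^('n + 'n)" where
  "L2_block D t i j = (1/2) *\<^sub>R (
     (if 1 \<le> i \<and> j < i
      then 2 *\<^sub>R (E2_mat ** Sy2_inv D ** transpose (F_mat D (i - 1)) ** C_prod D j (i - 1)) else 0)
     - (if max i j < t
        then \<Sum>k\<in>{max i j..t - 1}.
               transpose (C_prod D i k) ** transpose (S_mat D k) ** C_prod D j k
        else 0))"

definition L1_vec ::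
  "'n::finite control_problem \<Rightarrow> ('k::finite \<Rightarrow> nat) \<Rightarrow> nat \<Rightarrow> real^('k \<times> ('n + 'n))" where
  "L1_vec D pos t = stack_vec pos (L1_block D t)"

definition L2_mat ::
  "'n::finite control_problem \<Rightarrow> ('k::finite \<Rightarrow> nat) \<Rightarrow> nat
    \<Rightarrow> real^('k \<times> ('n + 'n))^('k \<times> ('n + 'n))" where
  "L2_mat D pos t = stack_mat pos (L2_block D t)"

abbreviation L2s_mat ::
  "'n::finite control_problem \<Rightarrow> ('k::finite \<Rightarrow> nat) \<Rightarrow> nat
    \<Rightarrow> real^('k \<times> ('n + 'n))^('k \<times> ('n + 'n))" where
  "L2s_mat D pos t \<equiv> sym_part (L2_mat D pos t)"

text \<open>The number of blocks of the following two is determined by \<open>pos\<close>.\<close>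

definition mw_vec ::
  "'n::finite control_problem \<Rightarrow> ('k::finite \<Rightarrow> nat) \<Rightarrow> real^('k \<times> ('n + 'n))" where
  "mw_vec D pos = stack_vec pos (\<lambda>i. if i = 0 then mean_seq D 0 else 0)"

definition Sw_stack ::
  "'n::finite control_problem \<Rightarrow> ('k::finite \<Rightarrow> nat)
    \<Rightarrow> real^('k \<times> ('n + 'n))^('k \<times> ('n + 'n))" where
  "Sw_stack D pos =
     stack_mat pos (\<lambda>i j. if i \<noteq> j then 0 else if i = 0 then cov_seq D 0
       else block_diag (Sz2 D) (Sy2 D))"

end

theory Submission
  imports Defs
begin

text \<open>
  Stack the initial state and all noise pairs \<open>(Z\<^sub>k, Y\<^sub>k)\<close> into one vector \<open>W\<close>. The optimal control is
  affine in the state, so every state is an affine function of \<open>W\<close>, and the log-likelihood ratio is a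
  polynomial of degree two in \<open>W\<close>: a constant plus \<open>W \<bullet> \<L>\<^sup>1 + W \<bullet> \<L>\<^sup>2 W\<close> (\<open>log_L_stacked\<close>). Since
  \<open>W\<close> is Gaussian with mean \<open>m\<close> and covariance \<open>\<Sigma>\<^sup>w\<close>, it has the law of \<open>m + Q g\<close>, where \<open>g\<close> is standard
  Gaussian and \<open>Q\<close> is the square root of \<open>\<Sigma>\<^sup>w\<close> (\<open>distr_noise_stack\<close>). Substituting this, the centred
  statistic has the law of \<open>l \<bullet> g + (g \<bullet> A g - tr A)\<close> with \<open>l = Q (\<L>\<^sup>1 + 2 \<L>\<^sup>2\<^sup>s m)\<close> and \<open>A = Q \<L>\<^sup>2\<^sup>s Q\<close>.

  If this sum is at least \<open>\<epsilon>\<^sub>1 + \<epsilon>\<^sub>2\<close>, then the linear part is at least \<open>\<epsilon>\<^sub>1\<close> or the quadratic part at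
  least \<open>\<epsilon>\<^sub>2\<close>. The union bound thus reduces the claim to a Gaussian tail
  (\<open>std_gauss_linear_tail\<close>) and a tail of Hanson--Wright type with explicit constants
  (\<open>std_gauss_quadratic_tail\<close>). Both are Chernoff bounds; for the second, rotating \<open>g\<close> into an
  eigenbasis of \<open>A\<close> turns the exponential moment into a product of one-dimensional ones.

  For the mean, the statistic is a sum of increments, each a polynomial in the state \<open>x\<^sub>k\<close> and the
  noise \<open>w\<^sub>k\<close>. As \<open>x\<^sub>k\<close> only involves earlier noise, it is uncorrelated with \<open>w\<^sub>k\<close>, so only the first
  two moments of \<open>x\<^sub>k\<close> enter, and these obey the recursions defining \<open>m\<^sub>k\<close> and
  \<open>\<Sigma>\<^sub>k + m\<^sub>k m\<^sub>k\<^sup>T\<close> (\<open>log_L_mean\<close>).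

  All of this needs \<open>H\<^sub>k\<close> to be invertible with a symmetric inverse. This follows from \<open>P\<^sub>k\<close> being
  positive semidefinite (\<open>psd_P_mat\<close>): its quadratic form is the minimum over the controls of the
  stage cost plus the cost-to-go, and the bound on \<open>\<lambda>\<close> is what keeps the stage cost nonnegative.
\<close>

section \<open>Matrices\<close>

text \<open>Transposes are kept explicit so that a matrix can be moved across an inner product.\<close>

declare vector_transpose_matrix [simp del] transpose_matrix_vector [simp del]

lemma inner_matrix_vector: "x \<bullet> (A *v y) = (transpose A *v x) \<bullet> (y :: real^'n)"
  for A :: "real^'n^'m"
  by (simp add: dot_lmul_matrix flip: vector_transpose_matrix)

lemma transpose_diff: "transpose (A - B) = transpose A - transpose (B :: real^'n^'m)"
  and transpose_add: "transpose (A + B) = transpose A + transpose (B :: real^'n^'m)"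
  and transpose_zero: "transpose (0 :: real^'n^'m) = 0"
  by (simp_all add: transpose_def vec_eq_iff)

lemma matrix_vector_mult_minus_left: "(- A) *v x = - (A *v x)"
  and matrix_vector_mult_minus_right: "A *v (- x) = - (A *v x)"
  for A :: "real^'m^'n"
  by (simp_all add: matrix_vector_mult_def vec_eq_iff sum_negf)

lemma matrix_inv:
  fixes A :: "real^'n^'n"
  assumes "invertible A"
  shows matrix_inv_right: "A ** matrix_inv A = mat 1" and matrix_inv_left: "matrix_inv A ** A = mat 1"
  using someI_ex[OF assms[unfolded invertible_def]] unfolding matrix_inv_def by auto

lemma matrix_inv_unique:
  fixes A :: "real^'n^'n"
  assumes "B ** A = mat 1"
  shows "matrix_inv A = B"
proof -
  have "invertible A"
    using assms invertible_left_inverse by blast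
  then have "A ** matrix_inv A = mat 1"
    by (rule matrix_inv_right)
  then show ?thesis
    using assms by (metis matrix_mul_assoc matrix_mul_lid matrix_mul_rid)
qed

lemma transpose_matrix_inv:
  fixes A :: "real^'n^'n"
  assumes "invertible A" "transpose A = A"
  shows "transpose (matrix_inv A) = matrix_inv A"
  using matrix_inv_right[OF assms(1)] assms(2)
  by (metis matrix_inv_unique matrix_transpose_mul transpose_mat)

lemma invertible_spd:
  fixes A :: "real^'n^'n"
  assumes "spd A"
  shows "invertible A"
proof -
  have "A *v x = 0 \<longrightarrow> x = 0" for x
    using assms unfolding spd_def by (metis inner_zero_right order_less_irrefl)
  then show ?thesis
    by (simp add: invertible_left_inverse matrix_left_invertible_ker)
qed

lemma spd_imp_psd: "spd A \<Longrightarrow> psd A"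
  unfolding spd_def psd_def by (metis inner_zero_left less_eq_real_def)

lemma spd_matrix_inv:
  assumes "spd A"
  shows "spd (matrix_inv A)"
proof -
  have inv: "invertible A" and tr: "transpose A = A"
    using assms by (auto simp: invertible_spd spd_def)
  have "0 < x \<bullet> (matrix_inv A *v x)" if "x \<noteq> 0" for x
  proof -
    have x: "A *v (matrix_inv A *v x) = x"
      by (simp add: matrix_vector_mul_assoc matrix_inv_right[OF inv])
    then have "matrix_inv A *v x \<noteq> 0"
      using that by auto
    then have "0 < (matrix_inv A *v x) \<bullet> (A *v (matrix_inv A *v x))"
      using assms unfolding spd_def by blast
    then show ?thesis
      by (simp only: x inner_commute)
  qed
  then show ?thesis
    using transpose_matrix_inv[OF inv tr] by (auto simp: spd_def)
qed

section \<open>The spectral theorem and square roots\<close>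

definition diag_mat :: "('n \<Rightarrow> real) \<Rightarrow> real^'n^'n" where
  "diag_mat l = (\<chi> i j. if i = j then l i else 0)"

lemma diag_mat_mult: "diag_mat l ** diag_mat m = diag_mat (\<lambda>i. l i * m i)"
  by (simp add: diag_mat_def matrix_matrix_mult_def vec_eq_iff if_distrib[where f = "\<lambda>x. x * _"] cong: if_cong)

lemma transpose_diag_mat [simp]: "transpose (diag_mat l) = diag_mat l"
  by (auto simp: diag_mat_def transpose_def vec_eq_iff)

lemma diag_mat_vector: "diag_mat l *v x = (\<chi> i. l i * x $ i)"
  by (auto simp: diag_mat_def matrix_vector_mult_def vec_eq_iff if_distrib if_distribR cong: if_cong)

text \<open>
  A nonnegative quadratic form is minimal where it vanishes, so its gradient is zero there. The proof
  moves from \<open>v\<close> in the direction of the gradient \<open>f v\<close> itself.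
\<close>

lemma psd_form_zero_imp_kernel:
  fixes f :: "'a::real_inner \<Rightarrow> 'a"
  assumes f: "linear f" and sym: "\<And>x y. x \<bullet> f y = f x \<bullet> y"
    and S: "subspace S" "\<And>x. x \<in> S \<Longrightarrow> f x \<in> S"
    and nonneg: "\<And>x. x \<in> S \<Longrightarrow> 0 \<le> x \<bullet> f x"
    and v: "v \<in> S" "v \<bullet> f v = 0"
  shows "f v = 0"
proof -
  have q: "0 \<le> s * (2 * (f v \<bullet> f v) + s * (f v \<bullet> f (f v)))" for s
  proof -
    have "v + s *\<^sub>R f v \<in> S"
      using S v by (simp add: subspace_add subspace_scale)
    from nonneg[OF this] show ?thesis
      using v sym[of v "f v"] sym[of "f v" "f v"] 
      by (simp add: linear_add[OF f] linear_scale[OF f] inner_add_left inner_add_right algebra_simps)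
  qed
  define a c where "a = f v \<bullet> f v" and "c = f v \<bullet> f (f v)"
  have c: "0 \<le> c"
    unfolding c_def using nonneg[of "f v"] S v by auto
  have "a \<le> 0"
  proof (rule ccontr)
    assume "\<not> a \<le> 0"
    then have a: "0 < a" by simp
    (* A small negative step; adding 1 to c covers the case c = 0. *)
    have "0 \<le> (- a / (c + 1)) * (2 * a + (- a / (c + 1)) * c)"
      using q[of "- a / (c + 1)"] by (simp add: a_def c_def)
    moreover have "2 * a + (- a / (c + 1)) * c = a * (c + 2) / (c + 1)"
      using c by (simp add: field_simps)
    ultimately have "0 \<le> (- a / (c + 1)) * (a * (c + 2) / (c + 1))" by simp
    moreover have "(- a / (c + 1)) * (a * (c + 2) / (c + 1)) < 0"
      using a c by (intro mult_neg_pos) auto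
    ultimately show False by linarith
  qed
  then show ?thesis
    using inner_eq_zero_iff[of "f v"] inner_ge_zero[of "f v"] unfolding a_def by linarith
qed

text \<open>
  The quadratic form attains its maximum \<open>\<mu>\<close> over the compact unit sphere of \<open>S\<close>; there the positive
  semidefinite form of \<open>\<mu> I - f\<close> vanishes, so a maximiser is an eigenvector.
\<close>

lemma self_adjoint_eigenvector:
  fixes f :: "'a::euclidean_space \<Rightarrow> 'a"
  assumes f: "linear f" and sym: "\<And>x y. x \<bullet> f y = f x \<bullet> y"
    and S: "subspace S" "\<And>x. x \<in> S \<Longrightarrow> f x \<in> S" and nz: "S \<noteq> {0}"
  obtains v \<mu> where "v \<in> S" "norm v = 1" "f v = \<mu> *\<^sub>R v"
proof -
  let ?K = "S \<inter> sphere 0 1"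
  have "compact ?K"
    using S(1) by (simp add: closed_Int_compact closed_subspace)
  moreover obtain w where w: "w \<in> S" "w \<noteq> 0"
    using nz S(1) subspace_0 by blast
  then have "w /\<^sub>R norm w \<in> ?K"
    using S(1) by (simp add: subspace_scale)
  then have "?K \<noteq> {}" by blast
  moreover have "continuous_on ?K (\<lambda>x. x \<bullet> f x)"
    using f by (intro continuous_intros linear_continuous_on linear_conv_bounded_linear[THEN iffD1])
  ultimately obtain v where v: "v \<in> ?K" and max: "\<And>x. x \<in> ?K \<Longrightarrow> x \<bullet> f x \<le> v \<bullet> f v"
    by (meson continuous_attains_sup)
  define \<mu> where "\<mu> = v \<bullet> f v"
  have vv: "v \<bullet> v = 1"
    using v by (auto simp: norm_eq_1)
  let ?g = "\<lambda>x. \<mu> *\<^sub>R x - f x"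
  have "?g v = 0"
  proof (rule psd_form_zero_imp_kernel[where S = S and f = ?g])
    show "linear ?g"
      using f by (auto simp: linear_iff algebra_simps)
    show "x \<bullet> ?g y = ?g x \<bullet> y" for x y
      by (simp add: inner_diff_left inner_diff_right sym)
    show "?g x \<in> S" if "x \<in> S" for x
      using that S by (simp add: subspace_diff subspace_scale)
    show "v \<in> S" "v \<bullet> ?g v = 0"
      using v by (simp_all add: inner_diff_right vv \<mu>_def)
    fix x assume x: "x \<in> S"
    show "0 \<le> x \<bullet> ?g x"
    proof (cases "x = 0")
      case False
      have "x /\<^sub>R norm x \<in> ?K"
        using False x S(1) by (simp add: subspace_scale)
      from max[OF this] have "(x \<bullet> f x) / (norm x)\<^sup>2 \<le> \<mu>"
        by (simp add: linear_scale[OF f] \<mu>_def power2_eq_square divide_inverse mult_ac)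
      then have "x \<bullet> f x \<le> \<mu> * (norm x)\<^sup>2"
        using False by (simp add: field_simps)
      then show ?thesis
        by (simp add: inner_diff_right power2_norm_eq_inner)
    qed simp
  qed (use S in auto)
  then show thesis
    using that[of v \<mu>] v by auto
qed

text \<open>
  Induction on the dimension: self-adjointness makes the orthogonal complement of an eigenvector in
  \<open>S\<close> invariant as well.
\<close>

lemma self_adjoint_orthonormal_eigenbasis:
  fixes f :: "'a::euclidean_space \<Rightarrow> 'a"
  assumes f: "linear f" and sym: "\<And>x y. x \<bullet> f y = f x \<bullet> y"
  shows "subspace S \<Longrightarrow> (\<And>x. x \<in> S \<Longrightarrow> f x \<in> S) \<Longrightarrow>
    \<exists>B. B \<subseteq> S \<and> finite B \<and> card B = dim S \<and> pairwise orthogonal B \<and>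
      (\<forall>b\<in>B. norm b = 1 \<and> (\<exists>\<mu>. f b = \<mu> *\<^sub>R b))"
proof (induction "dim S" arbitrary: S)
  case 0
  then show ?case
    by (intro exI[of _ "{}"]) auto
next
  case (Suc d)
  then have "S \<noteq> {0}"
    by (metis dim_eq_0 nat.distinct(1) order_refl)
  with self_adjoint_eigenvector[OF f sym Suc.prems] obtain v \<mu>
    where v: "v \<in> S" "norm v = 1" "f v = \<mu> *\<^sub>R v" by metis
  define S' where "S' = {y \<in> S. \<forall>x \<in> span {v}. orthogonal x y}"
  have S'_alt: "S' = {y \<in> S. v \<bullet> y = 0}"
    unfolding S'_def span_singleton by (auto simp: orthogonal_def intro: exI[of _ 1])
  have "dim S' + dim (span {v}) = dim S"
    unfolding S'_def using Suc.prems(1) v(1)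
    by (intro dim_subspace_orthogonal_to_vectors) (auto simp: span_minimal)
  moreover have "dim (span {v}) = 1"
    using v by auto
  ultimately have d: "d = dim S'"
    using Suc(2) by simp
  have "subspace S'"
    using Suc.prems(1) unfolding S'_alt subspace_def by (auto simp: inner_add_right)
  moreover have "f x \<in> S'" if "x \<in> S'" for x
    using that Suc.prems(2) sym[of v x] v unfolding S'_alt by auto
  ultimately obtain B where B: "B \<subseteq> S'" "finite B" "card B = dim S'" "pairwise orthogonal B"
    "\<forall>b\<in>B. norm b = 1 \<and> (\<exists>\<mu>. f b = \<mu> *\<^sub>R b)"
    using Suc.hyps(1)[OF d] by blast
  have "v \<notin> B"
    using B(1) v(2) unfolding S'_alt by (auto simp: norm_eq_1)
  then have "card (insert v B) = dim S"
    using B d Suc(2) by simp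
  moreover have "pairwise orthogonal (insert v B)"
    using B(1,4) unfolding pairwise_insert S'_alt by (auto simp: orthogonal_def inner_commute)
  ultimately show ?case
    using B v unfolding S'_alt by (intro exI[of _ "insert v B"]) auto
qed

theorem symmetric_diagonalization:
  fixes M :: "real^'n^'n"
  assumes "transpose M = M"
  obtains Q l where "orthogonal_matrix Q" "M = Q ** diag_mat l ** transpose Q"
proof -
  have sym: "x \<bullet> (M *v y) = (M *v x) \<bullet> y" for x y
    using assms inner_matrix_vector by metis
  obtain B where B: "finite B" "card B = CARD('n)" "pairwise orthogonal B"
    "\<forall>b\<in>B. norm b = 1 \<and> (\<exists>\<mu>. M *v b = \<mu> *\<^sub>R b)"
    using self_adjoint_orthonormal_eigenbasis[of "(*v) M" UNIV] sym by auto
  obtain e where e: "bij_betw e (UNIV :: 'n set) B"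
    using B(1,2) finite_same_card_bij[of "UNIV :: 'n set" B] by auto
  have orth: "e i \<bullet> e j = (if i = j then 1 else 0)" for i j
    using e B(3,4) unfolding bij_betw_def inj_on_def pairwise_def orthogonal_def
    by (metis UNIV_I image_eqI norm_eq_1)
  have "\<forall>i. \<exists>\<mu>. M *v e i = \<mu> *\<^sub>R e i"
    using e B(4) by (auto simp: bij_betw_def)
  then obtain l where l: "\<And>i. M *v e i = l i *\<^sub>R e i"
    by metis
  define Q where "Q = (\<chi> i j. e j $ i)"
  have "transpose Q ** Q = mat 1"
    using orth by (simp add: Q_def matrix_matrix_mult_def transpose_def mat_def vec_eq_iff inner_vec_def)
  then have Q: "orthogonal_matrix Q"
    by (simp add: orthogonal_matrix)
  have "M ** Q = Q ** diag_mat l"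
    using l by (simp add: Q_def matrix_matrix_mult_def matrix_vector_mult_def diag_mat_def vec_eq_iff
        if_distrib mult.commute cong: if_cong)
  then have "M ** (Q ** transpose Q) = Q ** diag_mat l ** transpose Q"
    by (simp add: matrix_mul_assoc)
  then show thesis
    using that Q by (simp add: orthogonal_matrix_def)
qed

lemma psd_imp_symmetric: "psd A \<Longrightarrow> transpose A = A"
  by (simp add: psd_def)

lemma psd_sqrt_exists:
  assumes "psd A"
  obtains B where "psd B" "B ** B = A"
proof -
  obtain Q l where Q: "orthogonal_matrix Q" and A: "A = Q ** diag_mat l ** transpose Q"
    using symmetric_diagonalization psd_imp_symmetric[OF assms] by metis
  have QQ: "transpose Q ** Q = mat 1"
    using Q by (simp add: orthogonal_matrix)
  have quad: "x \<bullet> ((Q ** diag_mat m ** transpose Q) *v x) = (\<Sum>i\<in>UNIV. m i * ((transpose Q *v x) $ i)\<^sup>2)"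
    for m x
  proof -
    have "x \<bullet> ((Q ** diag_mat m ** transpose Q) *v x) = x \<bullet> (Q *v (diag_mat m *v (transpose Q *v x)))"
      by (simp only: matrix_vector_mul_assoc matrix_mul_assoc)
    also have "\<dots> = (transpose Q *v x) \<bullet> (diag_mat m *v (transpose Q *v x))"
      by (rule inner_matrix_vector)
    finally show ?thesis
      by (simp add: inner_vec_def diag_mat_vector power2_eq_square mult.left_commute)
  qed
  have l: "0 \<le> l i" for i
  proof -
    have "transpose Q *v (Q *v axis i 1) = axis i 1"
      by (simp add: matrix_vector_mul_assoc QQ)
    then have "(Q *v axis i 1) \<bullet> (A *v (Q *v axis i 1)) = l i"
      unfolding A quad by (simp add: axis_def if_distrib if_distribR cong: if_cong)
    then show ?thesis
      using assms unfolding psd_def by metis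
  qed
  let ?B = "Q ** diag_mat (\<lambda>i. sqrt (l i)) ** transpose Q"
  have "?B ** ?B = Q ** diag_mat (\<lambda>i. sqrt (l i)) ** (transpose Q ** Q) ** diag_mat (\<lambda>i. sqrt (l i)) ** transpose Q"
    by (simp only: matrix_mul_assoc)
  also have "\<dots> = Q ** (diag_mat (\<lambda>i. sqrt (l i)) ** diag_mat (\<lambda>i. sqrt (l i))) ** transpose Q"
    by (simp add: QQ matrix_mul_assoc)
  also have "\<dots> = A"
    using l by (simp add: diag_mat_mult A)
  finally have "?B ** ?B = A" .
  moreover have "psd ?B"
    unfolding psd_def quad using l
    by (auto simp: matrix_transpose_mul matrix_mul_assoc intro!: sum_nonneg)
  ultimately show thesis
    using that by blast
qed

text \<open>
  If \<open>B\<^sup>2 = C\<^sup>2\<close> with \<open>B\<close>, \<open>C\<close> positive semidefinite and \<open>C v = \<mu> v\<close>, then \<open>(B + \<mu> I) (B v - \<mu> v) = 0\<close>.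
  As \<open>B\<close> has no negative eigenvalue, this forces \<open>B v = \<mu> v\<close>; so \<open>B\<close> and \<open>C\<close> agree on an eigenbasis
  of \<open>C\<close>.
\<close>

lemma psd_sqrt_unique:
  fixes B C :: "real^'n^'n"
  assumes B: "psd B" and C: "psd C" and eq: "B ** B = C ** C"
  shows "B = C"
proof -
  obtain Q l where Q: "orthogonal_matrix Q" and CQ: "C = Q ** diag_mat l ** transpose Q"
    using symmetric_diagonalization psd_imp_symmetric[OF C] by metis
  have QQ: "transpose Q ** Q = mat 1" "Q ** transpose Q = mat 1"
    using Q by (auto simp: orthogonal_matrix_def)
  have "B *v (Q *v axis i 1) = C *v (Q *v axis i 1)" for i
  proof -
    define v where "v = Q *v axis i 1"
    have "transpose Q *v v = axis i 1"
      by (simp add: v_def matrix_vector_mul_assoc QQ)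
    then have "C *v v = Q *v (diag_mat l *v axis i 1)"
      unfolding CQ by (simp flip: matrix_vector_mul_assoc)
    also have "diag_mat l *v axis i 1 = l i *\<^sub>R axis i 1"
      by (auto simp: diag_mat_vector axis_def vec_eq_iff)
    finally have Cv: "C *v v = l i *\<^sub>R v"
      by (simp add: v_def matrix_vector_mult_scaleR)
    have "v \<bullet> v = axis i 1 \<bullet> (axis i 1 :: real^'n)"
      by (simp add: v_def inner_matrix_vector matrix_vector_mul_assoc QQ)
    then have vv: "v \<bullet> v = 1"
      by (simp add: inner_axis)
    have "0 \<le> v \<bullet> (C *v v)"
      using C by (simp add: psd_def)
    then have l: "0 \<le> l i"
      by (simp add: Cv vv)
    define w where "w = B *v v - l i *\<^sub>R v"
    have BB: "B *v (B *v v) = (l i * l i) *\<^sub>R v"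
      by (simp add: matrix_vector_mul_assoc eq)
         (simp add: Cv matrix_vector_mult_scaleR flip: matrix_vector_mul_assoc)
    have Bw: "B *v w = - l i *\<^sub>R w"
      by (simp add: w_def BB matrix_vector_mult_diff_distrib matrix_vector_mult_scaleR scaleR_diff_right)
    have "0 \<le> w \<bullet> (B *v w)"
      using B by (simp add: psd_def)
    then have "l i * (w \<bullet> w) \<le> 0"
      by (simp add: Bw)
    then have "w = 0 \<or> l i = 0"
      using l by (metis inner_ge_zero inner_eq_zero_iff mult_nonneg_nonneg mult_eq_0_iff antisym)
    moreover have "w = 0" if "l i = 0"
    proof -
      have "(B *v v) \<bullet> (B *v v) = v \<bullet> (B *v (B *v v))"
        using B by (simp add: inner_matrix_vector[of v] psd_imp_symmetric)
      then show ?thesis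
        using that by (simp add: BB w_def)
    qed
    ultimately show ?thesis
      by (auto simp: w_def Cv simp flip: v_def)
  qed
  then have "B ** Q = C ** Q"
    unfolding matrix_vector_mul_assoc by (simp add: matrix_vector_mult_basis column_def vec_eq_iff)
  then have "B ** (Q ** transpose Q) = C ** (Q ** transpose Q)"
    by (simp add: matrix_mul_assoc)
  then show ?thesis
    by (simp add: QQ)
qed

lemma psd_sqrt_eqI: "psd B \<Longrightarrow> B ** B = A \<Longrightarrow> psd_sqrt A = B"
  unfolding psd_sqrt_def by (rule the_equality) (auto intro: psd_sqrt_unique)

lemma psd_sqrt:
  assumes "psd A"
  shows psd_psd_sqrt: "psd (psd_sqrt A)" and psd_sqrt_square: "psd_sqrt A ** psd_sqrt A = A"
  using psd_sqrt_exists[OF assms] psd_sqrt_eqI by metis+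

section \<open>The standard Gaussian measure\<close>

definition std_gauss :: "(real^'m) measure" where
  "std_gauss = density lborel (\<lambda>x. ennreal (\<Prod>r\<in>UNIV. std_normal_density (x $ r)))"

lemma space_std_gauss [simp]: "space std_gauss = UNIV"
  and sets_std_gauss [measurable_cong, simp]: "sets std_gauss = sets borel"
  by (simp_all add: std_gauss_def)

text \<open>
  All exponential moments of the standard Gaussian are computed with this product formula, after
  writing the integrand as a product over coordinates.
\<close>

lemma nn_integral_std_gauss_prod:
  fixes f :: "'m::finite \<Rightarrow> real \<Rightarrow> ennreal"
  assumes [measurable]: "\<And>r. f r \<in> borel_measurable borel"
  shows "(\<integral>\<^sup>+x. (\<Prod>r\<in>UNIV. f r (x $ r)) \<partial>std_gauss) =
    (\<Prod>r\<in>UNIV. \<integral>\<^sup>+x. ennreal (std_normal_density x) * f r x \<partial>lborel)"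
proof -
  have bij: "bij_betw (\<lambda>r. axis r 1 :: real^'m) UNIV Basis"
    by (auto simp: bij_betw_def inj_on_def axis_eq_axis Basis_vec_def)
  define idx where "idx = inv_into UNIV (\<lambda>r. axis r 1 :: real^'m)"
  have idx: "idx (axis r 1) = r" for r
    unfolding idx_def by (rule inv_f_f) (auto simp: inj_def axis_eq_axis)
  define g where "g r x = ennreal (std_normal_density x) * f r x" for r x
  have [measurable]: "g r \<in> borel_measurable borel" for r
    unfolding g_def by measurable
  have "(\<integral>\<^sup>+x. (\<Prod>r\<in>UNIV. f r (x $ r)) \<partial>std_gauss) = (\<integral>\<^sup>+x. (\<Prod>r\<in>UNIV. g r (x $ r)) \<partial>lborel)"
    unfolding std_gauss_def g_def
    by (subst nn_integral_density) (auto simp: prod.distrib prod_nonneg simp flip: prod_ennreal)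
  also have "\<dots> = (\<integral>\<^sup>+x. (\<Prod>b\<in>Basis. g (idx b) (x \<bullet> b)) \<partial>lborel)"
    by (simp add: idx inner_axis flip: prod.reindex_bij_betw[OF bij])
  also have "\<dots> = (\<Prod>b\<in>Basis. \<integral>\<^sup>+x. g (idx b) x \<partial>lborel)"
    by (rule nn_integral_lborel_prod) auto
  also have "\<dots> = (\<Prod>r\<in>UNIV. \<integral>\<^sup>+x. g r x \<partial>lborel)"
    by (simp add: idx flip: prod.reindex_bij_betw[OF bij])
  finally show ?thesis
    by (simp add: g_def)
qed

abbreviation std_normal :: "real measure" where
  "std_normal \<equiv> density lborel (\<lambda>x. ennreal (std_normal_density x))"

lemma prob_space_std_normal: "prob_space std_normal"
  by (rule prob_space_normal_density) simp

lemma nn_integral_std_normal_density: "(\<integral>\<^sup>+x. ennreal (std_normal_density x) \<partial>lborel) = 1"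
  using prob_space.emeasure_space_1[OF prob_space_std_normal] by (simp add: emeasure_density)

lemma prob_space_std_gauss: "prob_space (std_gauss :: (real^'m) measure)"
proof
  have "emeasure (std_gauss :: (real^'m) measure) UNIV =
      (\<integral>\<^sup>+x. (\<Prod>r\<in>(UNIV::'m set). 1) \<partial>(std_gauss :: (real^'m) measure))"
    by simp
  also have "\<dots> = 1"
    by (subst nn_integral_std_gauss_prod) (auto simp: nn_integral_std_normal_density)
  finally show "emeasure (std_gauss :: (real^'m) measure) (space std_gauss) = 1"
    by simp
qed

interpretation std_gauss: prob_space "std_gauss :: (real^'m) measure"
  by (rule prob_space_std_gauss)

lemma emeasure_std_gauss_box:
  assumes [measurable]: "\<And>r. A r \<in> sets borel"
  shows "emeasure std_gauss {x :: real^'m. \<forall>r. x $ r \<in> A r} = (\<Prod>r\<in>UNIV. emeasure std_normal (A r))"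
proof -
  have [measurable]: "{x :: real^'m. \<forall>r. x $ r \<in> A r} \<in> sets borel"
    by measurable
  have "emeasure std_gauss {x :: real^'m. \<forall>r. x $ r \<in> A r} =
      (\<integral>\<^sup>+x. (\<Prod>r\<in>UNIV. indicator (A r) (x $ r)) \<partial>std_gauss)"
  proof -
    have "(\<Prod>r\<in>UNIV. indicator (A r) (x $ r)) = (indicator {x :: real^'m. \<forall>r. x $ r \<in> A r} x :: ennreal)"
      for x :: "real^'m"
      by (auto simp: prod_zero_iff intro!: prod.neutral split: split_indicator)
    then show ?thesis by simp
  qed
  also have "\<dots> = (\<Prod>r\<in>UNIV. emeasure std_normal (A r))"
    by (subst nn_integral_std_gauss_prod) (auto simp: emeasure_density)
  finally show ?thesis .
qed

lemma distr_std_gauss_coords: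
  fixes e :: "'i::finite \<Rightarrow> 'm::finite"
  assumes e: "inj e"
  shows "distr std_gauss (Pi\<^sub>M UNIV (\<lambda>_. borel)) (\<lambda>x :: real^'m. \<lambda>i\<in>UNIV. x $ e i) = Pi\<^sub>M UNIV (\<lambda>_. std_normal)"
    (is "?D = _")
proof -
  interpret N: product_prob_space "\<lambda>_ :: 'i. std_normal" UNIV
    by (simp add: product_prob_space_def product_prob_space_axioms_def product_sigma_finite_def
        prob_space_std_normal prob_space_imp_sigma_finite)
  show ?thesis
  proof (rule N.PiM_eqI)
    show "sets ?D = sets (Pi\<^sub>M UNIV (\<lambda>_. std_normal))"
      by (auto intro!: sets_PiM_cong)
    fix A :: "'i \<Rightarrow> real set" assume "\<And>i. i \<in> UNIV \<Longrightarrow> A i \<in> sets std_normal"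
    then have [measurable]: "A i \<in> sets borel" for i by auto
    (* Coordinates outside the range of e are unconstrained and contribute a factor 1. *)
    define A' where "A' r = (if r \<in> range e then A (inv e r) else UNIV)" for r
    have A': "A' (e i) = A i" for i
      using e by (simp add: A'_def)
    have "emeasure ?D (Pi\<^sub>E UNIV A) = emeasure std_gauss {x :: real^'m. \<forall>i. x $ e i \<in> A i}"
      by (subst emeasure_distr) (auto intro!: arg_cong[where f = "emeasure _"] sets_PiM_I_finite)
    also have "{x :: real^'m. \<forall>i. x $ e i \<in> A i} = {x. \<forall>r. x $ r \<in> A' r}"
      using A' unfolding A'_def by fastforce
    also have "emeasure std_gauss {x. \<forall>r. x $ r \<in> A' r} = (\<Prod>r\<in>UNIV. emeasure std_normal (A' r))"
      by (rule emeasure_std_gauss_box) (simp add: A'_def)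
    also have "\<dots> = (\<Prod>r\<in>range e. emeasure std_normal (A' r))"
      using prob_space.emeasure_space_1[OF prob_space_std_normal]
      by (intro prod.mono_neutral_right) (auto simp: A'_def)
    also have "\<dots> = (\<Prod>i\<in>UNIV. emeasure std_normal (A i))"
      using e by (simp add: prod.reindex A')
    finally show "emeasure ?D (Pi\<^sub>E UNIV A) = (\<Prod>i\<in>UNIV. emeasure std_normal (A i))" .
  qed simp
qed

lemma distr_std_gauss_nth: "distr std_gauss borel (\<lambda>x :: real^'m. x $ r) = std_normal"
proof (rule measure_eqI)
  fix A assume "A \<in> sets (distr std_gauss borel (\<lambda>x :: real^'m. x $ r))"
  then have A [measurable]: "A \<in> sets borel" by simp
  have "emeasure (distr std_gauss borel (\<lambda>x :: real^'m. x $ r)) A =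
      emeasure std_gauss {x :: real^'m. \<forall>s. x $ s \<in> (if s = r then A else UNIV)}"
    by (subst emeasure_distr) (auto intro!: arg_cong[where f = "emeasure _"])
  also have "\<dots> = (\<Prod>s\<in>UNIV. emeasure std_normal (if s = r then A else UNIV))"
    by (rule emeasure_std_gauss_box) auto
  also have "\<dots> = (\<Prod>s\<in>UNIV. if s = r then emeasure std_normal A else 1)"
    using prob_space.emeasure_space_1[OF prob_space_std_normal] by (intro prod.cong) auto
  finally show "emeasure (distr std_gauss borel (\<lambda>x :: real^'m. x $ r)) A = emeasure std_normal A"
    by simp
qed simp

lemma indep_vars_std_gauss_nth:
  "prob_space.indep_vars std_gauss (\<lambda>_. borel) (\<lambda>r (x :: real^'m). x $ r) UNIV"
  using distr_std_gauss_coords[of "\<lambda>r :: 'm. r"]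
  by (subst std_gauss.indep_vars_iff_distr_eq_PiM) (auto simp: distr_std_gauss_nth)

lemma borel_measurable_vec:
  fixes f :: "'a \<Rightarrow> real^'i"
  assumes "\<And>i. (\<lambda>x. f x $ i) \<in> borel_measurable M"
  shows "f \<in> borel_measurable M"
  using assms by (subst borel_measurable_euclidean_space) (auto simp: Basis_vec_def inner_axis)

lemma distr_std_gauss_select:
  fixes e :: "'i::finite \<Rightarrow> 'm::finite"
  assumes e: "inj e"
  shows "distr std_gauss borel (\<lambda>x :: real^'m. \<chi> i. x $ e i) = std_gauss"
proof -
  have meas: "vec_lambda \<in> measurable (Pi\<^sub>M UNIV (\<lambda>_. borel)) (borel :: (real^'i) measure)"
    by (rule borel_measurable_vec) simp
  have coords: "(\<lambda>x :: real^'l. \<lambda>i\<in>UNIV. x $ h i) \<in> measurable std_gauss (Pi\<^sub>M UNIV (\<lambda>_ :: 'i. borel))"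
    for h :: "'i \<Rightarrow> 'l::finite"
    by (intro measurable_restrict) simp
  have "distr std_gauss borel (\<lambda>x :: real^'m. \<chi> i. x $ e i) =
      distr (distr std_gauss (Pi\<^sub>M UNIV (\<lambda>_. borel)) (\<lambda>x :: real^'m. \<lambda>i\<in>UNIV. x $ e i)) borel vec_lambda"
    by (subst distr_distr[OF meas coords]) (simp add: comp_def restrict_def)
  also have "\<dots> = distr (distr std_gauss (Pi\<^sub>M UNIV (\<lambda>_. borel)) (\<lambda>x :: real^'i. \<lambda>i\<in>UNIV. x $ i)) borel vec_lambda"
    by (simp only: distr_std_gauss_coords[OF e] distr_std_gauss_coords[of "\<lambda>i :: 'i. i", OF inj_on_id2])
  also have "\<dots> = distr std_gauss borel (\<lambda>x. x)"
    by (subst distr_distr[OF meas coords]) (simp add: comp_def restrict_def)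
  also have "\<dots> = std_gauss"
    by (rule distr_id2) simp
  finally show ?thesis .
qed

subsection \<open>Moments\<close>

lemma
  shows integrable_std_gauss_nth: "integrable std_gauss (\<lambda>x :: real^'m. x $ r)"
    and integral_std_gauss_nth: "integral\<^sup>L std_gauss (\<lambda>x :: real^'m. x $ r) = 0"
    and integrable_std_gauss_nth_square: "integrable std_gauss (\<lambda>x :: real^'m. x $ r * x $ r)"
    and integral_std_gauss_nth_square: "integral\<^sup>L std_gauss (\<lambda>x :: real^'m. x $ r * x $ r) = 1"
proof -
  have 1: "has_bochner_integral std_normal (\<lambda>x. x) 0"
    using std_normal_moment_odd[of 0] by (intro has_bochner_integral_density) auto
  have 2: "has_bochner_integral std_normal (\<lambda>x. x * x) 1"
    using std_normal_moment_even[of 1]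
    by (intro has_bochner_integral_density) (auto simp: power2_eq_square)
  have transfer: "integrable std_gauss (\<lambda>x :: real^'m. f (x $ r)) \<and> integral\<^sup>L std_gauss (\<lambda>x :: real^'m. f (x $ r)) = c"
    if f: "has_bochner_integral std_normal f c" for f :: "real \<Rightarrow> real" and c
  proof -
    have meas: "f \<in> borel_measurable borel"
      using borel_measurable_has_bochner_integral[OF f] by simp
    have eq: "std_normal = distr std_gauss borel (\<lambda>x :: real^'m. x $ r)"
      by (rule distr_std_gauss_nth[symmetric])
    have nth: "(\<lambda>x :: real^'m. x $ r) \<in> measurable std_gauss borel"
      by measurable
    show ?thesis
      using f unfolding eq has_bochner_integral_iff
      by (simp only: integrable_distr_eq[OF nth meas] integral_distr[OF nth meas] conj_ac)
  qed
  from transfer[OF 1] show "integrable std_gauss (\<lambda>x :: real^'m. x $ r)" "integral\<^sup>L std_gauss (\<lambda>x :: real^'m. x $ r) = 0"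
    by blast+
  from transfer[OF 2] show "integrable std_gauss (\<lambda>x :: real^'m. x $ r * x $ r)" "integral\<^sup>L std_gauss (\<lambda>x :: real^'m. x $ r * x $ r) = 1"
    by blast+
qed

lemma
  shows integrable_std_gauss_nth_mult: "integrable std_gauss (\<lambda>x :: real^'m. x $ r * x $ s)"
    and integral_std_gauss_nth_mult: "integral\<^sup>L std_gauss (\<lambda>x :: real^'m. x $ r * x $ s) = (if r = s then 1 else 0)"
proof -
  have *: "integrable std_gauss (\<lambda>x :: real^'m. x $ r * x $ s) \<and>
    integral\<^sup>L std_gauss (\<lambda>x :: real^'m. x $ r * x $ s) = 0" if "r \<noteq> s"
  proof -
    have iv: "std_gauss.indep_vars (\<lambda>_. borel) (\<lambda>r (x :: real^'m). x $ r) {r, s}"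
      by (rule std_gauss.indep_vars_subset[OF indep_vars_std_gauss_nth]) simp
    show ?thesis
      using std_gauss.indep_vars_integrable[OF _ iv] std_gauss.indep_vars_lebesgue_integral[OF _ iv] that
      by (simp add: integrable_std_gauss_nth integral_std_gauss_nth)
  qed
  show "integrable std_gauss (\<lambda>x :: real^'m. x $ r * x $ s)"
    using * integrable_std_gauss_nth_square by (cases "r = s") auto
  show "integral\<^sup>L std_gauss (\<lambda>x :: real^'m. x $ r * x $ s) = (if r = s then 1 else 0)"
    using * integral_std_gauss_nth_square by (cases "r = s") auto
qed

lemma
  fixes a b :: "real^'m"
  shows integrable_std_gauss_inner: "integrable std_gauss (\<lambda>x. a \<bullet> x)"
    and integral_std_gauss_inner: "integral\<^sup>L std_gauss (\<lambda>x. a \<bullet> x) = 0"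
    and integrable_std_gauss_inner_mult: "integrable std_gauss (\<lambda>x. (a \<bullet> x) * (b \<bullet> x))"
    and integral_std_gauss_inner_mult: "integral\<^sup>L std_gauss (\<lambda>x. (a \<bullet> x) * (b \<bullet> x)) = a \<bullet> b"
proof -
  show "integrable std_gauss (\<lambda>x. a \<bullet> x)" "integral\<^sup>L std_gauss (\<lambda>x. a \<bullet> x) = 0"
    by (simp_all add: inner_vec_def integrable_std_gauss_nth integral_std_gauss_nth)
  have eq: "(a \<bullet> x) * (b \<bullet> x) = (\<Sum>r\<in>UNIV. \<Sum>s\<in>UNIV. a $ r * b $ s * (x $ r * x $ s))" for x
    by (simp add: inner_vec_def sum_product mult_ac)
  show "integrable std_gauss (\<lambda>x. (a \<bullet> x) * (b \<bullet> x))"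
    unfolding eq by (intro Bochner_Integration.integrable_sum integrable_mult_right integrable_std_gauss_nth_mult)
  have "integral\<^sup>L std_gauss (\<lambda>x. (a \<bullet> x) * (b \<bullet> x)) =
      (\<Sum>r\<in>UNIV. \<Sum>s\<in>UNIV. a $ r * b $ s * (if r = s then 1 else 0))"
    unfolding eq
    by (simp add: Bochner_Integration.integral_sum integrable_std_gauss_nth_mult integral_std_gauss_nth_mult
        del: mult_cancel_left mult_cancel_right)
  also have "\<dots> = a \<bullet> b"
    by (simp add: inner_vec_def if_distrib cong: if_cong)
  finally show "integral\<^sup>L std_gauss (\<lambda>x. (a \<bullet> x) * (b \<bullet> x)) = a \<bullet> b" .
qed

subsection \<open>Linear images\<close>

lemma std_gauss_radial:
  "std_gauss = density lborel (\<lambda>x :: real^'m. ennreal (exp (- (norm x)\<^sup>2 / 2) / sqrt ((2 * pi) ^ CARD('m))))"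
proof -
  have "(\<Prod>r\<in>UNIV. std_normal_density (x $ r)) = exp (- (norm x)\<^sup>2 / 2) / sqrt ((2 * pi) ^ CARD('m))"
    for x :: "real^'m"
  proof -
    have "(\<Prod>r\<in>UNIV. std_normal_density (x $ r)) = (\<Prod>r\<in>UNIV. exp (- (x $ r)\<^sup>2 / 2) / sqrt (2 * pi))"
      by (simp add: std_normal_density_def)
    also have "\<dots> = (\<Prod>r\<in>UNIV. exp (- (x $ r)\<^sup>2 / 2)) / sqrt ((2 * pi) ^ CARD('m))"
      by (simp only: prod_dividef prod_constant real_sqrt_power)
    also have "(\<Prod>r\<in>UNIV. exp (- (x $ r)\<^sup>2 / 2)) = exp (- (norm x)\<^sup>2 / 2)"
      unfolding power2_norm_eq_inner inner_vec_def
      by (simp add: sum_negf power2_eq_square flip: exp_sum sum_divide_distrib)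
    finally show ?thesis .
  qed
  then show ?thesis
    by (simp add: std_gauss_def)
qed

lemma borel_measurable_matrix_vector [measurable]:
  "(*v) A \<in> borel_measurable borel" for A :: "real^'m^'n"
  by (intro borel_measurable_continuous_onI continuous_intros)

lemma nn_integral_lborel_translate:
  fixes c :: "'a::euclidean_space"
  assumes [measurable]: "f \<in> borel_measurable borel"
  shows "(\<integral>\<^sup>+x. f (c + x) \<partial>lborel) = (\<integral>\<^sup>+x. f x \<partial>lborel)"
  by (subst (2) lborel_distr_plus[symmetric, of c]) (simp add: nn_integral_distr)

text \<open>
  Uniqueness of a translation invariant measure, specialised to the image of Lebesgue measure under
  \<open>Q\<close>. Integrating \<open>1\<^sub>A (Q x) 1\<^sub>B (y - Q x)\<close> over \<open>x\<close> and \<open>y\<close> in the two possible orders shows that the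
  two measures are proportional, and they agree on the unit ball \<open>B\<close> because \<open>Q\<close> preserves the norm.
\<close>

lemma distr_lborel_orthogonal:
  fixes Q :: "real^'m^'m"
  assumes "orthogonal_matrix Q"
  shows "distr lborel borel ((*v) Q) = lborel"
proof (rule measure_eqI)
  fix A assume "A \<in> sets (distr lborel borel ((*v) Q))"
  then have A [measurable]: "A \<in> sets borel" by simp
  let ?B = "cball 0 1 :: (real^'m) set"
  define f g where "f = (indicator A :: _ \<Rightarrow> ennreal)" and "g = (indicator ?B :: _ \<Rightarrow> ennreal)"
  define T where "T = (*v) Q"
  have [measurable]: "f \<in> borel_measurable borel" "g \<in> borel_measurable borel"
    unfolding f_def g_def by (auto intro!: borel_measurable_indicator)
  have [measurable]: "T \<in> borel_measurable borel"
    unfolding T_def by measurable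
  have QQ: "T (transpose Q *v x) = x" for x
    using assms by (simp add: T_def orthogonal_matrix_def matrix_vector_mul_assoc)
  have add: "T (x + y) = T x + T y" for x y
    by (simp add: T_def matrix_vector_right_distrib)
  have "norm (T x) = norm x" for x
    using assms by (simp add: T_def norm_eq_sqrt_inner inner_matrix_vector matrix_vector_mul_assoc orthogonal_matrix_def)
  then have g: "g (- T x) = g x" for x
    by (simp add: g_def indicator_def)
  have int_f: "(\<integral>\<^sup>+x. f x \<partial>lborel) = emeasure lborel A"
    and int_g: "(\<integral>\<^sup>+x. g x \<partial>lborel) = emeasure lborel ?B"
    by (simp_all add: f_def g_def)
  have meas1: "(\<lambda>p. f (T (fst p)) * g (- T (fst p) + snd p)) \<in> borel_measurable (lborel \<Otimes>\<^sub>M lborel)"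
    by measurable
  have meas2: "(\<lambda>p. f (T (fst p) + snd p) * g (- T (fst p))) \<in> borel_measurable (lborel \<Otimes>\<^sub>M lborel)"
    by measurable
  have "emeasure (distr lborel borel T) A * emeasure lborel ?B = (\<integral>\<^sup>+x. f (T x) * emeasure lborel ?B \<partial>lborel)"
    by (simp add: f_def nn_integral_distr nn_integral_multc flip: nn_integral_indicator)
  also have "\<dots> = (\<integral>\<^sup>+x. f (T x) * (\<integral>\<^sup>+y. g (- T x + y) \<partial>lborel) \<partial>lborel)"
    by (subst nn_integral_lborel_translate) (simp_all add: int_g)
  also have "\<dots> = (\<integral>\<^sup>+x. \<integral>\<^sup>+y. f (T x) * g (- T x + y) \<partial>lborel \<partial>lborel)"
    by (simp add: nn_integral_cmult)
  also have "\<dots> = (\<integral>\<^sup>+y. \<integral>\<^sup>+x. f (T x) * g (- T x + y) \<partial>lborel \<partial>lborel)"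
    using meas1 by (intro lborel_pair.Fubini') (simp add: split_beta')
  also have "\<dots> = (\<integral>\<^sup>+y. \<integral>\<^sup>+x. f (T x + y) * g (- T x) \<partial>lborel \<partial>lborel)"
  proof (rule nn_integral_cong)
    fix y
    have "(\<integral>\<^sup>+x. f (T x) * g (- T x + y) \<partial>lborel) =
        (\<integral>\<^sup>+x. f (T (transpose Q *v y + x)) * g (- T (transpose Q *v y + x) + y) \<partial>lborel)"
      by (rule nn_integral_lborel_translate[symmetric]) measurable
    then show "(\<integral>\<^sup>+x. f (T x) * g (- T x + y) \<partial>lborel) = (\<integral>\<^sup>+x. f (T x + y) * g (- T x) \<partial>lborel)"
      by (simp add: add QQ add.commute)
  qed
  also have "\<dots> = (\<integral>\<^sup>+x. \<integral>\<^sup>+y. f (T x + y) * g (- T x) \<partial>lborel \<partial>lborel)"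
    using meas2 by (intro lborel_pair.Fubini'[symmetric]) (simp add: split_beta')
  also have "\<dots> = (\<integral>\<^sup>+x. emeasure lborel A * g x \<partial>lborel)"
    by (simp add: nn_integral_multc nn_integral_lborel_translate int_f g)
  also have "\<dots> = emeasure lborel A * emeasure lborel ?B"
    by (simp add: nn_integral_cmult int_g)
  finally have "emeasure lborel ?B * emeasure (distr lborel borel T) A = emeasure lborel ?B * emeasure lborel A"
    by (simp only: mult.commute)
  moreover have "emeasure lborel ?B \<noteq> 0" "emeasure lborel ?B \<noteq> \<infinity>"
    by (auto simp: emeasure_cball unit_ball_vol_pos less_imp_neq[symmetric])
  ultimately show "emeasure (distr lborel borel ((*v) Q)) A = emeasure lborel A"
    by (auto simp: ennreal_mult_cancel_left T_def)
qed simp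

lemma distr_lborel_diag_mat:
  fixes l :: "'m::finite \<Rightarrow> real"
  assumes l: "\<And>i. l i \<noteq> 0"
  shows "distr lborel borel ((*v) (diag_mat l)) = density lborel (\<lambda>_. ennreal (1 / \<bar>\<Prod>i\<in>UNIV. l i\<bar>))"
proof -
  have bij: "bij_betw (\<lambda>r. axis r 1 :: real^'m) UNIV Basis"
    by (auto simp: bij_betw_def inj_on_def axis_eq_axis Basis_vec_def)
  define c where "c b = l (inv_into UNIV (\<lambda>r. axis r 1 :: real^'m) b)" for b
  have c: "c (axis r 1) = l r" for r
    unfolding c_def by (subst inv_f_f) (auto simp: inj_def axis_eq_axis)
  have T: "diag_mat l *v x = 0 + (\<Sum>j\<in>Basis. (c j * (x \<bullet> j)) *\<^sub>R j)" for x
    unfolding sum.reindex_bij_betw[OF bij, symmetric]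
    unfolding c inner_axis
    by (simp add: diag_mat_vector vec_eq_iff axis_def if_distrib cong: if_cong)
  have "lborel = density (distr lborel borel ((*v) (diag_mat l))) (\<lambda>_. ennreal (\<Prod>j\<in>Basis. \<bar>c j\<bar>))"
    using lborel_affine_euclidean[of c 0] l by (simp add: c_def T[abs_def])
  also have "(\<Prod>j\<in>Basis. \<bar>c j\<bar>) = \<bar>\<Prod>i\<in>UNIV. l i\<bar>"
    by (simp add: c abs_prod flip: prod.reindex_bij_betw[OF bij])
  finally have "density lborel (\<lambda>_. ennreal (1 / \<bar>\<Prod>i\<in>UNIV. l i\<bar>)) =
      density (density (distr lborel borel ((*v) (diag_mat l))) (\<lambda>_. ennreal \<bar>\<Prod>i\<in>UNIV. l i\<bar>)) (\<lambda>_. ennreal (1 / \<bar>\<Prod>i\<in>UNIV. l i\<bar>))"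
    by simp
  also have "\<dots> = density (distr lborel borel ((*v) (diag_mat l))) (\<lambda>_. 1)"
    using l by (subst density_density_eq) (auto simp flip: ennreal_mult)
  finally show ?thesis
    by (simp add: density_1)
qed

text \<open>
  Diagonalise \<open>S\<close>: the rotations preserve Lebesgue measure, and the diagonal part scales it by the
  product of the eigenvalues.
\<close>

lemma distr_lborel_symmetric:
  fixes S :: "real^'m^'m"
  assumes "invertible S" "transpose S = S"
  shows "distr lborel borel ((*v) S) = density lborel (\<lambda>_. ennreal (1 / \<bar>det S\<bar>))"
proof -
  obtain Q l where Q: "orthogonal_matrix Q" and S: "S = Q ** diag_mat l ** transpose Q"
    using symmetric_diagonalization[OF assms(2)] by metis
  have "det S = det Q * det (diag_mat l) * det (transpose Q)"
    by (simp add: S det_mul)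
  also have "\<dots> = det (diag_mat l)"
    using Q by (auto dest!: det_orthogonal_matrix)
  also have "\<dots> = (\<Prod>i\<in>UNIV. l i)"
    by (subst det_diagonal) (auto simp: diag_mat_def)
  finally have d: "det S = (\<Prod>i\<in>UNIV. l i)" .
  have l: "l i \<noteq> 0" for i
    using assms(1) d by (simp add: invertible_det_nz)
  have "distr lborel borel ((*v) S) =
      distr (distr (distr lborel borel ((*v) (transpose Q))) borel ((*v) (diag_mat l))) borel ((*v) Q)"
    by (simp add: distr_distr comp_def S matrix_vector_mul_assoc matrix_mul_assoc)
  also have "\<dots> = distr (density lborel (\<lambda>_. ennreal (1 / \<bar>det S\<bar>))) borel ((*v) Q)"
    using Q by (simp add: distr_lborel_orthogonal distr_lborel_diag_mat l d)
  also have "\<dots> = density (distr lborel borel ((*v) Q)) (\<lambda>_. ennreal (1 / \<bar>det S\<bar>))"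
    by (rule density_distr[symmetric]) auto
  finally show ?thesis
    using Q by (simp add: distr_lborel_orthogonal)
qed

lemma distr_density_lborel_matrix:
  fixes Q :: "real^'m^'m"
  assumes "invertible Q" and eq: "distr lborel borel ((*v) Q) = density lborel (\<lambda>_. ennreal (1 / \<bar>det Q\<bar>))"
    and [measurable]: "f \<in> borel_measurable borel"
  shows "distr (density lborel f) borel ((*v) Q) =
    density lborel (\<lambda>y. ennreal (1 / \<bar>det Q\<bar>) * f (matrix_inv Q *v y))"
proof -
  have "distr (density lborel f) borel ((*v) Q) =
      distr (density lborel (\<lambda>x. f (matrix_inv Q *v (Q *v x)))) borel ((*v) Q)"
    by (simp add: matrix_vector_mul_assoc matrix_inv[OF assms(1)])
  also have "\<dots> = density (distr lborel borel ((*v) Q)) (\<lambda>y. f (matrix_inv Q *v y))"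
    by (rule density_distr[symmetric]) auto
  finally show ?thesis
    unfolding eq by (subst (asm) density_density_eq) auto
qed

text \<open>The density of the standard Gaussian measure depends on the norm only.\<close>

lemma distr_std_gauss_orthogonal:
  fixes Q :: "real^'m^'m"
  assumes "orthogonal_matrix Q"
  shows "distr std_gauss borel ((*v) Q) = std_gauss"
proof -
  have inv: "invertible Q"
    using assms by (auto simp: orthogonal_matrix_def invertible_def)
  have d: "\<bar>det Q\<bar> = 1"
    using det_orthogonal_matrix[OF assms] by auto
  have "matrix_inv Q = transpose Q"
    using assms by (intro matrix_inv_unique) (simp add: orthogonal_matrix)
  moreover have "norm (transpose Q *v y) = norm y" for y
    using assms by (simp add: norm_eq_sqrt_inner inner_matrix_vector matrix_vector_mul_assoc orthogonal_matrix_def)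
  ultimately show ?thesis
    unfolding std_gauss_radial
    by (subst distr_density_lborel_matrix[OF inv])
       (simp_all add: d distr_lborel_orthogonal[OF assms] density_1)
qed

text \<open>
  With \<open>Q\<close> the root of \<open>S\<close>, the exponent of the image density is \<open>\<parallel>Q\<^sup>-\<^sup>1 y\<parallel>\<^sup>2 = y \<bullet> S\<^sup>-\<^sup>1 y\<close> and the
  Jacobian is the square root of \<open>det S = (det Q)\<^sup>2\<close>.
\<close>

theorem distr_std_gauss_psd_sqrt:
  fixes S :: "real^'m^'m"
  assumes "spd S"
  shows "distr std_gauss borel ((*v) (psd_sqrt S)) = density lborel (mvnormal_density 0 S)"
proof -
  let ?Q = "psd_sqrt S"
  have QQ: "?Q ** ?Q = S" and psd: "psd ?Q"
    using assms by (simp_all add: psd_sqrt spd_imp_psd)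
  have "det S \<noteq> 0"
    using assms invertible_spd invertible_det_nz by blast
  moreover have det: "det S = det ?Q * det ?Q"
    by (metis QQ det_mul)
  ultimately have d: "det ?Q \<noteq> 0"
    by auto
  then have inv: "invertible ?Q"
    by (simp add: invertible_det_nz)
  have tr: "transpose (matrix_inv ?Q) = matrix_inv ?Q"
    using inv psd by (simp add: transpose_matrix_inv psd_imp_symmetric)
  have "matrix_inv ?Q ** matrix_inv ?Q ** S = mat 1"
    by (metis QQ matrix_mul_assoc inv matrix_inv_left matrix_mul_lid)
  then have "matrix_inv S = matrix_inv ?Q ** matrix_inv ?Q"
    by (rule matrix_inv_unique)
  then have norm: "(norm (matrix_inv ?Q *v y))\<^sup>2 = sq_norm_wrt (matrix_inv S) y" for y
    by (simp add: power2_norm_eq_inner sq_norm_wrt_def inner_matrix_vector[of _ "matrix_inv ?Q"] tr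
        matrix_vector_mul_assoc inner_commute[of y])
  have "sqrt ((2 * pi) ^ CARD('m) * det S) = \<bar>det ?Q\<bar> * sqrt ((2 * pi) ^ CARD('m))"
    by (subst real_sqrt_mult, subst det) (simp only: real_sqrt_abs2 mult.commute)
  then have "ennreal (mvnormal_density 0 S y) =
      ennreal (1 / \<bar>det ?Q\<bar>) * ennreal (exp (- (norm (matrix_inv ?Q *v y))\<^sup>2 / 2) / sqrt ((2 * pi) ^ CARD('m)))" for y
    by (simp only: mvnormal_density_def norm diff_zero) (simp flip: ennreal_mult')
  then show ?thesis
    unfolding std_gauss_radial
    using distr_lborel_symmetric[OF inv psd_imp_symmetric[OF psd]]
    by (subst distr_density_lborel_matrix[OF inv]) simp_all
qed

subsection \<open>Exponential moments\<close>

lemma nn_integral_normal_density: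
  assumes "0 < \<sigma>"
  shows "(\<integral>\<^sup>+x. ennreal (normal_density \<mu> \<sigma> x) \<partial>lborel) = 1"
  using prob_space.emeasure_space_1[OF prob_space_normal_density[OF assms, of \<mu>]] by (simp add: emeasure_density)

lemma std_normal_exp_linear:
  "(\<integral>\<^sup>+x. ennreal (std_normal_density x) * ennreal (exp (s * x)) \<partial>lborel) = ennreal (exp (s\<^sup>2 / 2))"
proof -
  have "std_normal_density x * exp (s * x) = exp (s\<^sup>2 / 2) * normal_density s 1 x" for x
    by (simp add: normal_density_def flip: exp_add)
       (simp add: power2_eq_square algebra_simps diff_divide_distrib add_divide_distrib)
  then have "(\<integral>\<^sup>+x. ennreal (std_normal_density x) * ennreal (exp (s * x)) \<partial>lborel) =
      (\<integral>\<^sup>+x. ennreal (exp (s\<^sup>2 / 2)) * ennreal (normal_density s 1 x) \<partial>lborel)"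
    by (simp flip: ennreal_mult')
  then show ?thesis
    by (simp add: nn_integral_cmult nn_integral_normal_density)
qed

lemma std_normal_exp_square:
  assumes "a < 1 / 2"
  shows "(\<integral>\<^sup>+x. ennreal (std_normal_density x) * ennreal (exp (a * x\<^sup>2)) \<partial>lborel) = ennreal (1 / sqrt (1 - 2 * a))"
proof -
  define \<sigma> where "\<sigma> = 1 / sqrt (1 - 2 * a)"
  have \<sigma>: "0 < \<sigma>" "\<sigma>\<^sup>2 = 1 / (1 - 2 * a)"
    using assms by (simp_all add: \<sigma>_def power_divide)
  have "std_normal_density x * exp (a * x\<^sup>2) = \<sigma> * normal_density 0 \<sigma> x" for x
  proof -
    have "- x\<^sup>2 / 2 + a * x\<^sup>2 = - x\<^sup>2 / (2 * \<sigma>\<^sup>2)"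
      using assms by (simp add: \<sigma>(2) field_simps)
    moreover have "sqrt (2 * pi * \<sigma>\<^sup>2) = sqrt (2 * pi) * \<sigma>"
      using \<sigma>(1) by (simp add: real_sqrt_mult)
    ultimately show ?thesis
      using \<sigma>(1) by (simp add: normal_density_def flip: exp_add)
  qed
  then have "(\<integral>\<^sup>+x. ennreal (std_normal_density x) * ennreal (exp (a * x\<^sup>2)) \<partial>lborel) =
      (\<integral>\<^sup>+x. ennreal \<sigma> * ennreal (normal_density 0 \<sigma> x) \<partial>lborel)"
    using \<sigma>(1) by (simp flip: ennreal_mult')
  then show ?thesis
    using \<sigma>(1) by (simp add: nn_integral_cmult nn_integral_normal_density flip: \<sigma>_def)
qed

text \<open>
  The difference \<open>u + u\<^sup>2 + ln (1 - u)\<close> has derivative \<open>u (1 - 2 u) / (1 - u)\<close> and is therefore minimal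
  at \<open>0\<close>. The coefficient \<open>1\<close> of \<open>u\<^sup>2\<close> is what leads to the constant \<open>1 / 8\<close> in the quadratic tail.
\<close>

lemma ln_one_minus_lower_bound:
  fixes u :: real
  assumes "\<bar>u\<bar> \<le> 1 / 2"
  shows "- u - u\<^sup>2 \<le> ln (1 - u)"
proof -
  define f where "f u = u + u\<^sup>2 + ln (1 - u)" for u :: real
  have D: "(f has_real_derivative x * (1 - 2 * x) / (1 - x)) (at x)" if "x < 1" for x
    unfolding f_def by (rule derivative_eq_intros refl | use that in \<open>simp add: field_simps power2_eq_square\<close>)+
  have "f 0 \<le> f u"
  proof (cases "0 \<le> u")
    case True
    show ?thesis
    proof (rule DERIV_nonneg_imp_nondecreasing[OF True])
      fix x assume "0 \<le> x" "x \<le> u"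
      then show "\<exists>y. (f has_real_derivative y) (at x) \<and> 0 \<le> y"
        using assms D[of x] by (intro exI[of _ "x * (1 - 2 * x) / (1 - x)"]) (auto intro!: divide_nonneg_pos)
    qed
  next
    case False
    then have "u \<le> 0" by simp
    then show ?thesis
    proof (rule DERIV_nonpos_imp_nonincreasing)
      fix x assume "u \<le> x" "x \<le> 0"
      then show "\<exists>y. (f has_real_derivative y) (at x) \<and> y \<le> 0"
        using assms D[of x]
        by (intro exI[of _ "x * (1 - 2 * x) / (1 - x)"]) (auto intro!: divide_nonpos_pos mult_nonpos_nonneg)
    qed
  qed
  then show ?thesis
    by (simp add: f_def)
qed

text \<open>
  The left-hand side is \<open>exp (- a) / sqrt (1 - 2 a)\<close>, and the bound on the logarithm is used at
  \<open>u = 2 a\<close>.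
\<close>

lemma std_normal_exp_centred_square_le:
  assumes "\<bar>a\<bar> \<le> 1 / 4"
  shows "(\<integral>\<^sup>+x. ennreal (std_normal_density x) * ennreal (exp (a * (x\<^sup>2 - 1))) \<partial>lborel) \<le> ennreal (exp (2 * a\<^sup>2))"
proof -
  have a: "a < 1 / 2"
    using assms by auto
  have "(\<integral>\<^sup>+x. ennreal (std_normal_density x) * ennreal (exp (a * (x\<^sup>2 - 1))) \<partial>lborel) =
      (\<integral>\<^sup>+x. ennreal (exp (- a)) * (ennreal (std_normal_density x) * ennreal (exp (a * x\<^sup>2))) \<partial>lborel)"
    by (intro nn_integral_cong)
       (simp add: right_diff_distrib exp_diff exp_minus field_simps flip: ennreal_mult')
  also have "\<dots> = ennreal (exp (- a) * (1 / sqrt (1 - 2 * a)))"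
    by (subst nn_integral_cmult, simp, subst std_normal_exp_square[OF a]) (simp only: ennreal_mult' exp_ge_zero)
  also have "1 / sqrt (1 - 2 * a) = exp (- ln (1 - 2 * a) / 2)"
  proof -
    have "exp (- ln (1 - 2 * a) / 2) = 1 / exp (ln (sqrt (1 - 2 * a)))"
      using a by (simp add: ln_sqrt exp_minus inverse_eq_divide)
    then show ?thesis
      using a by simp
  qed
  also have "exp (- a) * exp (- ln (1 - 2 * a) / 2) \<le> exp (2 * a\<^sup>2)"
  proof -
    have "- (2 * a) - (2 * a)\<^sup>2 \<le> ln (1 - 2 * a)"
      using assms by (intro ln_one_minus_lower_bound) (simp add: abs_mult)
    then show ?thesis
      by (simp add: power2_eq_square flip: exp_add)
  qed
  finally show ?thesis
    by (simp add: ennreal_leI)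
qed

lemma std_gauss_exp_linear:
  fixes c :: "real^'m"
  shows "(\<integral>\<^sup>+x. ennreal (exp (c \<bullet> x)) \<partial>std_gauss) = ennreal (exp ((norm c)\<^sup>2 / 2))"
proof -
  have "(\<integral>\<^sup>+x. ennreal (exp (c \<bullet> x)) \<partial>std_gauss) = (\<integral>\<^sup>+x. (\<Prod>r\<in>UNIV. ennreal (exp (c $ r * x $ r))) \<partial>std_gauss)"
    by (simp add: inner_vec_def exp_sum prod_ennreal)
  also have "\<dots> = (\<Prod>r\<in>UNIV. ennreal (exp ((c $ r)\<^sup>2 / 2)))"
    by (subst nn_integral_std_gauss_prod) (auto simp: std_normal_exp_linear)
  also have "\<dots> = ennreal (exp ((norm c)\<^sup>2 / 2))"
    unfolding power2_norm_eq_inner inner_vec_def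
    by (simp add: prod_ennreal power2_eq_square flip: exp_sum sum_divide_distrib)
  finally show ?thesis .
qed

lemma trace_orthogonal_conjugate:
  fixes A Q :: "real^'m^'m"
  assumes "orthogonal_matrix Q"
  shows "trace (Q ** A ** transpose Q) = trace A"
  using assms by (subst trace_mul_sym) (simp add: matrix_mul_assoc orthogonal_matrix_def)

lemma norm_matrix_power2: "(norm A)\<^sup>2 = trace (transpose A ** A)" for A :: "real^'m^'n"
proof -
  have "(norm A)\<^sup>2 = (\<Sum>i\<in>UNIV. \<Sum>j\<in>UNIV. A $ i $ j * A $ i $ j)"
    by (simp add: power2_norm_eq_inner inner_vec_def)
  also have "\<dots> = trace (transpose A ** A)"
    by (subst sum.swap) (simp add: trace_def matrix_matrix_mult_def transpose_def)
  finally show ?thesis .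
qed

text \<open>
  In an orthonormal eigenbasis the centred quadratic form is \<open>\<Sum> \<lambda>\<^sub>r (x\<^sub>r\<^sup>2 - 1)\<close>, with independent
  summands.
\<close>

lemma std_gauss_exp_quadratic_le:
  fixes M :: "real^'m^'m"
  assumes sym: "transpose M = M" and \<theta>: "\<bar>\<theta>\<bar> * spectral_norm M \<le> 1 / 4"
  shows "(\<integral>\<^sup>+x. ennreal (exp (\<theta> * (x \<bullet> (M *v x) - trace M))) \<partial>std_gauss) \<le> ennreal (exp (2 * \<theta>\<^sup>2 * (norm M)\<^sup>2))"
proof -
  obtain Q l where Q: "orthogonal_matrix Q" and M: "M = Q ** diag_mat l ** transpose Q"
    using symmetric_diagonalization[OF sym] by metis
  have QQ: "transpose Q ** Q = mat 1"
    using Q by (simp add: orthogonal_matrix)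
  have norm_Q: "norm (Q *v x) = norm x" for x
    using QQ by (simp add: norm_eq_sqrt_inner inner_matrix_vector matrix_vector_mul_assoc)
  have MQ: "M *v (Q *v x) = Q *v (diag_mat l *v x)" for x
  proof -
    have "M *v (Q *v x) = (Q ** diag_mat l ** (transpose Q ** Q)) *v x"
      by (simp only: M matrix_vector_mul_assoc matrix_mul_assoc)
    then show ?thesis
      by (simp add: QQ matrix_vector_mul_assoc)
  qed
  have trace: "trace M = (\<Sum>r\<in>UNIV. l r)"
    unfolding M trace_orthogonal_conjugate[OF Q] by (simp add: trace_def diag_mat_def)
  have "transpose M ** M = Q ** (diag_mat l ** (transpose Q ** Q) ** diag_mat l) ** transpose Q"
    unfolding sym by (simp only: M matrix_mul_assoc)
  then have "trace (transpose M ** M) = trace (diag_mat l ** diag_mat l)"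
    by (simp only: trace_orthogonal_conjugate[OF Q] QQ matrix_mul_rid)
  then have norm: "(norm M)\<^sup>2 = (\<Sum>r\<in>UNIV. (l r)\<^sup>2)"
    by (simp add: norm_matrix_power2 diag_mat_mult) (simp add: trace_def diag_mat_def power2_eq_square)
  have l: "\<bar>\<theta> * l r\<bar> \<le> 1 / 4" for r
  proof -
    have "diag_mat l *v axis r 1 = l r *\<^sub>R axis r 1"
      by (auto simp: diag_mat_vector axis_def vec_eq_iff)
    then have "\<bar>l r\<bar> = norm (M *v (Q *v axis r 1))"
      by (simp add: MQ norm_Q)
    also have "\<dots> \<le> spectral_norm M * norm (Q *v axis r 1)"
      by (intro onorm matrix_vector_mul_bounded_linear)
    also have "\<dots> = spectral_norm M"
      by (simp add: norm_Q)
    finally have "\<bar>\<theta>\<bar> * \<bar>l r\<bar> \<le> \<bar>\<theta>\<bar> * spectral_norm M"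
      by (intro mult_left_mono) auto
    then show ?thesis
      using \<theta> by (simp add: abs_mult)
  qed
  have quad: "\<theta> * ((Q *v x) \<bullet> (M *v (Q *v x)) - trace M) = (\<Sum>r\<in>UNIV. \<theta> * l r * ((x $ r)\<^sup>2 - 1))" for x
  proof -
    have "(Q *v x) \<bullet> (M *v (Q *v x)) = (transpose Q *v (Q *v x)) \<bullet> (diag_mat l *v x)"
      unfolding MQ by (rule inner_matrix_vector)
    then have "(Q *v x) \<bullet> (M *v (Q *v x)) = x \<bullet> (diag_mat l *v x)"
      by (simp only: matrix_vector_mul_assoc QQ matrix_vector_mul_lid)
    then show ?thesis
      by (simp add: trace inner_vec_def diag_mat_vector power2_eq_square sum_distrib_left algebra_simps
          flip: sum_subtractf)
  qed
  have [measurable]: "(*v) M \<in> borel_measurable borel" "(*v) Q \<in> borel_measurable borel"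
    by (rule borel_measurable_matrix_vector)+
  have "(\<integral>\<^sup>+x. ennreal (exp (\<theta> * (x \<bullet> (M *v x) - trace M))) \<partial>std_gauss) =
      (\<integral>\<^sup>+x. ennreal (exp (\<theta> * (x \<bullet> (M *v x) - trace M))) \<partial>(distr std_gauss borel ((*v) Q)))"
    by (simp add: distr_std_gauss_orthogonal[OF Q])
  also have "\<dots> = (\<integral>\<^sup>+x. ennreal (exp (\<Sum>r\<in>UNIV. \<theta> * l r * ((x $ r)\<^sup>2 - 1))) \<partial>std_gauss)"
    by (subst nn_integral_distr) (auto simp: quad)
  also have "\<dots> = (\<integral>\<^sup>+x. (\<Prod>r\<in>UNIV. ennreal (exp (\<theta> * l r * ((x $ r)\<^sup>2 - 1)))) \<partial>std_gauss)"
    by (simp add: exp_sum prod_ennreal)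
  also have "\<dots> = (\<Prod>r\<in>UNIV. \<integral>\<^sup>+x. ennreal (std_normal_density x) * ennreal (exp (\<theta> * l r * (x\<^sup>2 - 1))) \<partial>lborel)"
    by (rule nn_integral_std_gauss_prod) measurable
  also have "\<dots> \<le> (\<Prod>r\<in>UNIV. ennreal (exp (2 * (\<theta> * l r)\<^sup>2)))"
    by (intro prod_mono_ennreal std_normal_exp_centred_square_le l)
  also have "\<dots> = ennreal (exp (2 * \<theta>\<^sup>2 * (norm M)\<^sup>2))"
    by (simp add: prod_ennreal norm power_mult_distrib sum_distrib_left mult.assoc flip: exp_sum)
  finally show ?thesis .
qed

subsection \<open>Tail bounds\<close>

text \<open>
  Chernoff's bound. With the nonnegative integral, the bound on the exponential moment also carries
  its finiteness.
\<close>

lemma (in prob_space) prob_ge_exp_bound: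
  assumes [measurable]: "f \<in> borel_measurable M" and \<theta>: "0 < \<theta>"
    and bound: "(\<integral>\<^sup>+x. ennreal (exp (\<theta> * f x)) \<partial>M) \<le> ennreal (exp K)"
  shows "prob {x \<in> space M. \<epsilon> \<le> f x} \<le> exp (K - \<theta> * \<epsilon>)"
proof -
  have "emeasure M {x \<in> space M. \<epsilon> \<le> f x} \<le> (\<integral>\<^sup>+x. ennreal (exp (\<theta> * f x - \<theta> * \<epsilon>)) \<partial>M)"
  proof (subst nn_integral_indicator[symmetric])
    show "integral\<^sup>N M (indicator {x \<in> space M. \<epsilon> \<le> f x}) \<le> (\<integral>\<^sup>+x. ennreal (exp (\<theta> * f x - \<theta> * \<epsilon>)) \<partial>M)"
      using \<theta> by (intro nn_integral_mono) (auto simp: indicator_def intro!: ennreal_leI)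
  qed measurable
  also have "\<dots> = (\<integral>\<^sup>+x. ennreal (exp (- \<theta> * \<epsilon>)) * ennreal (exp (\<theta> * f x)) \<partial>M)"
    by (simp add: exp_diff exp_minus divide_inverse mult.commute flip: ennreal_mult')
  also have "\<dots> = ennreal (exp (- \<theta> * \<epsilon>)) * (\<integral>\<^sup>+x. ennreal (exp (\<theta> * f x)) \<partial>M)"
    by (rule nn_integral_cmult) measurable
  also have "\<dots> \<le> ennreal (exp (- \<theta> * \<epsilon>)) * ennreal (exp K)"
    using bound by (intro mult_left_mono) auto
  also have "\<dots> = ennreal (exp (K - \<theta> * \<epsilon>))"
    by (simp add: exp_diff exp_minus divide_inverse mult.commute flip: ennreal_mult')
  finally show ?thesis
    by (simp add: emeasure_eq_measure)
qed

lemma std_gauss_linear_tail: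
  fixes c :: "real^'m"
  assumes \<epsilon>: "0 < \<epsilon>"
  shows "measure std_gauss {x. \<epsilon> \<le> c \<bullet> x} \<le> exp_neg (ereal (\<epsilon>\<^sup>2) / ereal (2 * (norm c)\<^sup>2))"
proof (cases "c = 0")
  case True
  then show ?thesis
    using \<epsilon> by (simp add: exp_neg_def)
next
  case False
  (* The minimiser of the exponent in Chernoff's bound. *)
  define \<theta> where "\<theta> = \<epsilon> / (norm c)\<^sup>2"
  have "0 < \<theta>"
    using \<epsilon> False by (simp add: \<theta>_def)
  moreover have "(\<integral>\<^sup>+x. ennreal (exp (\<theta> * (c \<bullet> x))) \<partial>std_gauss) \<le> ennreal (exp (\<theta>\<^sup>2 * (norm c)\<^sup>2 / 2))"
    using std_gauss_exp_linear[of "\<theta> *\<^sub>R c"] by (simp add: power_mult_distrib)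
  ultimately have "measure std_gauss {x \<in> space std_gauss. \<epsilon> \<le> c \<bullet> x} \<le> exp (\<theta>\<^sup>2 * (norm c)\<^sup>2 / 2 - \<theta> * \<epsilon>)"
    by (intro std_gauss.prob_ge_exp_bound) auto
  also have "\<theta>\<^sup>2 * (norm c)\<^sup>2 / 2 - \<theta> * \<epsilon> = - (\<epsilon>\<^sup>2 / (2 * (norm c)\<^sup>2))"
    using False by (simp add: \<theta>_def power2_eq_square field_simps)
  finally show ?thesis
    using False by (simp add: exp_neg_def)
qed

text \<open>
  With \<open>F = \<parallel>M\<parallel>\<^sub>F\<close> and \<open>s = \<parallel>M\<parallel>\<close>, Chernoff's bound \<open>exp (2 \<theta>\<^sup>2 F\<^sup>2 - \<theta> \<epsilon>)\<close> is minimised by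
  \<open>\<theta> = \<epsilon> / (4 F\<^sup>2)\<close>; where that exceeds the range \<open>\<theta> s \<le> 1 / 4\<close>, the boundary value
  \<open>\<theta> = 1 / (4 s)\<close> gives the second regime.
\<close>

lemma std_gauss_quadratic_tail:
  fixes M :: "real^'m^'m"
  assumes sym: "transpose M = M" and \<epsilon>: "0 < \<epsilon>"
  shows "measure std_gauss {x. \<epsilon> \<le> x \<bullet> (M *v x) - trace M}
    \<le> exp_neg (ereal (1 / 8) * min (ereal (\<epsilon>\<^sup>2) / ereal ((frobenius_norm M)\<^sup>2)) (ereal \<epsilon> / ereal (spectral_norm M)))"
proof (cases "M = 0")
  case True
  have "spectral_norm (0 :: real^'m^'m) = 0"
    using onorm_zero by (simp add: matrix_vector_mult_0[abs_def])
  then show ?thesis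
    using \<epsilon> True by (simp add: exp_neg_def trace_def)
next
  case False
  define F2 s where "F2 = (norm M)\<^sup>2" and "s = spectral_norm M"
  have F2: "0 < F2"
    using False by (simp add: F2_def)
  have "s \<noteq> 0"
    using False matrix_eq[of M 0] unfolding s_def
    by (subst onorm_eq_0) (auto simp: matrix_vector_mul_bounded_linear)
  then have s: "0 < s"
    using onorm_pos_le[OF matrix_vector_mul_bounded_linear[of M]] unfolding s_def by linarith
  have bound: "measure std_gauss {x. \<epsilon> \<le> x \<bullet> (M *v x) - trace M} \<le> exp (2 * \<theta>\<^sup>2 * F2 - \<theta> * \<epsilon>)"
    if \<theta>: "0 < \<theta>" "\<theta> * s \<le> 1 / 4" for \<theta>
  proof -
    have [measurable]: "(*v) M \<in> borel_measurable borel"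
      by (rule borel_measurable_matrix_vector)
    have "measure std_gauss {x \<in> space std_gauss. \<epsilon> \<le> x \<bullet> (M *v x) - trace M} \<le> exp (2 * \<theta>\<^sup>2 * F2 - \<theta> * \<epsilon>)"
      unfolding F2_def using \<theta>
      by (intro std_gauss.prob_ge_exp_bound std_gauss_exp_quadratic_le sym) (auto simp: s_def)
    then show ?thesis by simp
  qed
  have "measure std_gauss {x. \<epsilon> \<le> x \<bullet> (M *v x) - trace M} \<le> exp (- (1 / 8 * min (\<epsilon>\<^sup>2 / F2) (\<epsilon> / s)))"
  proof (cases "\<epsilon> * s \<le> F2")
    case True
    have "measure std_gauss {x. \<epsilon> \<le> x \<bullet> (M *v x) - trace M} \<le>
        exp (2 * (\<epsilon> / (4 * F2))\<^sup>2 * F2 - \<epsilon> / (4 * F2) * \<epsilon>)"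
      using \<epsilon> F2 True by (intro bound) (auto simp: field_simps)
    also have "2 * (\<epsilon> / (4 * F2))\<^sup>2 * F2 - \<epsilon> / (4 * F2) * \<epsilon> = - (1 / 8 * (\<epsilon>\<^sup>2 / F2))"
      using F2 by (simp add: power2_eq_square field_simps)
    also have "exp \<dots> \<le> exp (- (1 / 8 * min (\<epsilon>\<^sup>2 / F2) (\<epsilon> / s)))"
      by simp
    finally show ?thesis .
  next
    case False
    have "measure std_gauss {x. \<epsilon> \<le> x \<bullet> (M *v x) - trace M} \<le> exp (2 * (1 / (4 * s))\<^sup>2 * F2 - 1 / (4 * s) * \<epsilon>)"
      using s by (intro bound) auto
    also have "2 * (1 / (4 * s))\<^sup>2 * F2 \<le> 2 * (1 / (4 * s))\<^sup>2 * (\<epsilon> * s)"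
      using False by (intro mult_left_mono) auto
    also have "2 * (1 / (4 * s))\<^sup>2 * (\<epsilon> * s) - 1 / (4 * s) * \<epsilon> = - (1 / 8 * (\<epsilon> / s))"
      using s by (simp add: power2_eq_square field_simps)
    also have "exp \<dots> \<le> exp (- (1 / 8 * min (\<epsilon>\<^sup>2 / F2) (\<epsilon> / s)))"
      by simp
    finally show ?thesis
      by simp
  qed
  moreover have "ereal (1 / 8) * min (ereal (\<epsilon>\<^sup>2) / ereal F2) (ereal \<epsilon> / ereal s) =
      ereal (1 / 8 * min (\<epsilon>\<^sup>2 / F2) (\<epsilon> / s))"
    using F2 s by (simp add: min_def)
  ultimately show ?thesis
    by (simp add: exp_neg_def F2_def s_def)
qed

section \<open>Block vectors and block matrices\<close>

lemma sum_UNIV_Plus: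
  fixes f :: "'a::finite + 'b::finite \<Rightarrow> 'c::comm_monoid_add"
  shows "(\<Sum>i\<in>UNIV. f i) = (\<Sum>a\<in>UNIV. f (Inl a)) + (\<Sum>b\<in>UNIV. f (Inr b))"
  by (simp add: sum.Plus flip: UNIV_Plus_UNIV)

lemma sum_UNIV_Times:
  fixes f :: "'a::finite \<times> 'b::finite \<Rightarrow> 'c::comm_monoid_add"
  shows "(\<Sum>r\<in>UNIV. f r) = (\<Sum>a\<in>UNIV. \<Sum>b\<in>UNIV. f (a, b))"
  by (simp add: sum.cartesian_product flip: UNIV_Times_UNIV)

lemma vconcat_nth [simp]: "vconcat x y $ Inl a = x $ a" "vconcat x y $ Inr b = y $ b"
  by (simp_all add: vconcat_def)

lemma upper_vconcat [simp]: "upper (vconcat x y) = x"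
  and lower_vconcat [simp]: "lower (vconcat x y) = y"
  by (simp_all add: upper_def lower_def)

lemma vconcat_eqI: "upper x = upper y \<Longrightarrow> lower x = lower y \<Longrightarrow> x = y"
  unfolding vec_eq_iff upper_def lower_def
  by simp (metis sum.exhaust)

lemma upper_lower_linear [simp]:
  "upper (x + y) = upper x + upper y" "lower (x + y) = lower x + lower y"
  "upper (x - y) = upper x - upper y" "lower (x - y) = lower x - lower y"
  "upper (- x) = - upper x" "lower (- x) = - lower x"
  "upper (c *\<^sub>R x) = c *\<^sub>R upper x" "lower (c *\<^sub>R x) = c *\<^sub>R lower x"
  "upper 0 = 0" "lower 0 = 0"
  by (simp_all add: upper_def lower_def vec_eq_iff)

lemma inner_upper_lower: "x \<bullet> y = upper x \<bullet> upper y + lower x \<bullet> lower y"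
  by (simp add: inner_vec_def sum_UNIV_Plus upper_def lower_def)

lemma block_mat_nth [simp]:
  "block_mat P Q R S $ Inl r $ Inl a = P $ r $ a" "block_mat P Q R S $ Inl r $ Inr b = Q $ r $ b"
  "block_mat P Q R S $ Inr s $ Inl a = R $ s $ a" "block_mat P Q R S $ Inr s $ Inr b = S $ s $ b"
  by (simp_all add: block_mat_def hcat_def)

lemma block_mat_vector:
  "block_mat P Q R S *v x = vconcat (P *v upper x + Q *v lower x) (R *v upper x + S *v lower x)"
  by (rule vconcat_eqI) (simp_all add: vec_eq_iff upper_def lower_def matrix_vector_mult_def sum_UNIV_Plus)

lemma transpose_block_mat:
  "transpose (block_mat P Q R S) = block_mat (transpose P) (transpose R) (transpose Q) (transpose S)"
proof -
  have "transpose (block_mat P Q R S) $ i $ j =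
      block_mat (transpose P) (transpose R) (transpose Q) (transpose S) $ i $ j" for i j
    by (cases i; cases j) (simp_all add: transpose_def)
  then show ?thesis
    by (simp add: vec_eq_iff)
qed

lemma block_diag_mult: "block_diag A B ** block_diag C E = block_diag (A ** C) (B ** E)"
proof -
  have "(block_diag A B ** block_diag C E) $ i $ j = block_diag (A ** C) (B ** E) $ i $ j" for i j
    by (cases i; cases j) (simp_all add: matrix_matrix_mult_def sum_UNIV_Plus)
  then show ?thesis
    by (simp add: vec_eq_iff)
qed

lemma psd_block_diag:
  assumes "psd A" "psd B"
  shows "psd (block_diag A B)"
  using assms by (simp add: psd_def transpose_block_mat block_mat_vector inner_upper_lower transpose_zero)

lemma spd_block_diag:
  assumes "spd A" "spd B"
  shows "spd (block_diag A B)"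
proof -
  have "0 < upper x \<bullet> (A *v upper x) + lower x \<bullet> (B *v lower x)" if "x \<noteq> 0" for x
  proof (cases "upper x = 0")
    case True
    then have "lower x \<noteq> 0"
      using that vconcat_eqI[of x 0] by auto
    then show ?thesis
      using True assms by (simp add: spd_def)
  next
    case False
    then show ?thesis
      using assms spd_imp_psd[of B] unfolding spd_def psd_def by (metis add_pos_nonneg)
  qed
  then show ?thesis
    using assms by (simp add: spd_def transpose_block_mat block_mat_vector inner_upper_lower transpose_zero)
qed

definition block :: "real^('k \<times> 'm) \<Rightarrow> 'k::finite \<Rightarrow> real^'m" where
  "block x k = (\<chi> a. x $ (k, a))"

lemma block_stack_vec [simp]: "block (stack_vec pos f) k = f (pos k)"
  by (simp add: block_def stack_vec_def)

lemma block_linear [simp]: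
  "block (x + y) k = block x k + block y k" "block (c *\<^sub>R x) k = c *\<^sub>R block x k"
  by (simp_all add: block_def vec_eq_iff)

lemma block_eqI: "(\<And>k. block x k = block y k) \<Longrightarrow> x = y"
  by (auto simp: block_def vec_eq_iff)

lemma inner_block: "x \<bullet> y = (\<Sum>k\<in>UNIV. block x k \<bullet> block y k)"
  by (simp add: inner_vec_def sum_UNIV_Times block_def)

lemma block_stack_mat_vector:
  "block (stack_mat pos f *v x) k = (\<Sum>l\<in>UNIV. f (pos k) (pos l) *v block x l)"
  by (simp add: block_def stack_mat_def matrix_vector_mult_def vec_eq_iff sum_UNIV_Times)

lemma block_diagonal_stack_vector:
  assumes "inj pos"
  shows "block (stack_mat pos (\<lambda>i j. if i \<noteq> j then 0 else f i) *v x) k = f (pos k) *v block x k"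
proof -
  have "(if pos k \<noteq> pos l then 0 else f (pos k)) *v block x l =
      (if l = k then f (pos k) *v block x k else 0)" for l
    using assms by (auto simp: inj_def)
  then show ?thesis
    by (simp add: block_stack_mat_vector)
qed

lemma psd_block_diagonal_stack:
  assumes "inj pos" and "\<And>i. psd (f i)"
  shows "psd (stack_mat pos (\<lambda>i j. if i \<noteq> j then 0 else f i))"
proof -
  have sym: "f i $ a $ b = f i $ b $ a" for i a b
    using psd_imp_symmetric[OF assms(2)] by (metis transpose_def vec_lambda_beta)
  have "transpose (stack_mat pos (\<lambda>i j. if i \<noteq> j then 0 else f i)) = stack_mat pos (\<lambda>i j. if i \<noteq> j then 0 else f i)"
    using sym by (auto simp: transpose_def stack_mat_def vec_eq_iff)
  then show ?thesis
    using assms by (simp add: psd_def inner_block block_diagonal_stack_vector sum_nonneg)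
qed

lemma block_diagonal_stack_mult:
  assumes "inj pos"
  shows "stack_mat pos (\<lambda>i j. if i \<noteq> j then 0 else f i) ** stack_mat pos (\<lambda>i j. if i \<noteq> j then 0 else g i) =
    stack_mat pos (\<lambda>i j. if i \<noteq> j then 0 else f i ** g i)"
proof -
  have "(stack_mat pos (\<lambda>i j. if i \<noteq> j then 0 else f i) ** stack_mat pos (\<lambda>i j. if i \<noteq> j then 0 else g i)) *v x =
    stack_mat pos (\<lambda>i j. if i \<noteq> j then 0 else f i ** g i) *v x" for x
    using assms
    by (intro block_eqI) (simp add: block_diagonal_stack_vector matrix_vector_mul_assoc[symmetric])
  then show ?thesis
    by (simp add: matrix_eq)
qed

lemma Sw_stack_eq:
  "Sw_stack D pos = stack_mat pos (\<lambda>i j. if i \<noteq> j then 0 else if i = 0 then 0 else block_diag (Sz2 D) (Sy2 D))"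
  unfolding Sw_stack_def cov_seq.simps(1) ..

text \<open>By uniqueness of the positive semidefinite root it can be taken block by block.\<close>

lemma
  assumes "psd (Sz2 D)" "psd (Sy2 D)" "inj pos"
  shows psd_Sw_stack: "psd (Sw_stack D pos)"
    and psd_sqrt_Sw_stack: "psd_sqrt (Sw_stack D pos) =
      stack_mat pos (\<lambda>i j. if i \<noteq> j then 0 else if i = 0 then 0 else block_diag (psd_sqrt (Sz2 D)) (psd_sqrt (Sy2 D)))"
      (is "_ = ?Q")
proof -
  have 0: "psd (0 :: real^'m^'m)"
    by (simp add: psd_def transpose_zero)
  show "psd (Sw_stack D pos)"
    unfolding Sw_stack_eq using assms 0 by (intro psd_block_diagonal_stack) (auto intro: psd_block_diag)
  have "psd ?Q"
    using assms 0 by (intro psd_block_diagonal_stack) (auto intro: psd_block_diag psd_psd_sqrt)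
  moreover have "?Q ** ?Q = Sw_stack D pos"
    unfolding Sw_stack_eq block_diagonal_stack_mult[OF assms(3)]
    by (intro arg_cong[where f = "stack_mat pos"] ext)
       (simp add: block_diag_mult psd_sqrt_square[OF assms(1)] psd_sqrt_square[OF assms(2)])
  ultimately show "psd_sqrt (Sw_stack D pos) = ?Q"
    by (rule psd_sqrt_eqI)
qed

section \<open>The joint law of the noise\<close>

text \<open>The initial state is block \<open>0\<close>, so the noise that enters the state at time \<open>k + 1\<close> is block \<open>k + 1\<close>.\<close>

definition noise_block ::
  "real^('n + 'n) \<Rightarrow> (nat \<Rightarrow> 'a \<Rightarrow> real^'n) \<Rightarrow> (nat \<Rightarrow> 'a \<Rightarrow> real^'n) \<Rightarrow> 'a \<Rightarrow> nat \<Rightarrow> real^('n::finite + 'n)" where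
  "noise_block x0 Z Y \<omega> i = (case i of 0 \<Rightarrow> x0 | Suc k \<Rightarrow> vconcat (Z k \<omega>) (Y k \<omega>))"

lemma noise_block_simps [simp]:
  "noise_block x0 Z Y \<omega> 0 = x0" "noise_block x0 Z Y \<omega> (Suc k) = vconcat (Z k \<omega>) (Y k \<omega>)"
  by (simp_all add: noise_block_def)

definition noise_stack ::
  "('k::finite \<Rightarrow> nat) \<Rightarrow> real^('n + 'n) \<Rightarrow> (nat \<Rightarrow> 'a \<Rightarrow> real^'n) \<Rightarrow> (nat \<Rightarrow> 'a \<Rightarrow> real^'n) \<Rightarrow> 'a
    \<Rightarrow> real^('k \<times> ('n::finite + 'n))" where
  "noise_stack pos x0 Z Y \<omega> = stack_vec pos (noise_block x0 Z Y \<omega>)"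

text \<open>
  Both sides are images under one map \<open>\<Phi>\<close>, which assembles a stacked vector from \<open>2 t\<close> vectors: on the
  left the noises, on the right the vectors \<open>S\<^sub>j\<^sup>1\<^sup>/\<^sup>2 g\<^sub>j\<close> built from disjoint groups \<open>g\<^sub>j\<close> of coordinates
  of \<open>g\<close>. The two families are independent with the same marginals, so they have the same joint law.
  The initial state is deterministic, and correspondingly the covariance of block \<open>0\<close> is zero.
\<close>

theorem distr_noise_stack:
  fixes D :: "'n::finite control_problem" and M :: "'a measure" and pos :: "'k::finite \<Rightarrow> nat"
  assumes spd: "spd (Sz2 D)" "spd (Sy2 D)"
    and "prob_space M"
    and Z: "\<And>k. k < t \<Longrightarrow> distributed M lborel (Z k) (mvnormal_density 0 (Sz2 D))"
    and Y: "\<And>k. k < t \<Longrightarrow> distributed M lborel (Y k) (mvnormal_density 0 (Sy2 D))"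
    and indep: "prob_space.indep_vars M (\<lambda>_. borel) (case_sum Z Y) ({..<t} <+> {..<t})"
    and pos: "bij_betw pos UNIV {..t}"
  shows "noise_stack pos (x_init D) Z Y \<in> measurable M borel"
    and "distr M borel (noise_stack pos (x_init D) Z Y) =
      distr std_gauss borel (\<lambda>g. mw_vec D pos + psd_sqrt (Sw_stack D pos) *v g)"
proof -
  interpret prob_space M by fact
  define J where "J = ({..<t} :: nat set) <+> ({..<t} :: nat set)"
  define \<kappa> where "\<kappa> = inv_into UNIV pos"
  have inj: "inj pos" and ran: "range pos = {..t}"
    using pos by (auto simp: bij_betw_def)
  have pos_\<kappa>: "pos (\<kappa> i) = i" if "i \<le> t" for i
    unfolding \<kappa>_def using ran that by (intro f_inv_into_f) auto
  have \<kappa>_pos: "\<kappa> (pos k) = k" for k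
    unfolding \<kappa>_def using inj by simp
  define \<Phi> where "\<Phi> f = stack_vec pos (\<lambda>i. case i of 0 \<Rightarrow> x_init D | Suc k \<Rightarrow> vconcat (f (Inl k)) (f (Inr k)))"
    for f :: "nat + nat \<Rightarrow> real^'n"
  have \<Phi>_cong: "\<Phi> f = \<Phi> g" if "\<And>j. j \<in> J \<Longrightarrow> f j = g j" for f g
  proof (rule block_eqI)
    fix k
    have "pos k \<le> t" using ran by auto
    then show "block (\<Phi> f) k = block (\<Phi> g) k"
      by (auto simp: \<Phi>_def J_def split: nat.split intro!: arg_cong2[where f = vconcat] that)
  qed
  have meas_\<Phi> [measurable]: "\<Phi> \<in> measurable (Pi\<^sub>M J (\<lambda>_. borel)) borel"
  proof (rule borel_measurable_vec)
    fix r :: "'k \<times> ('n + 'n)"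
    obtain k a where r: "r = (k, a)" by fastforce
    have *: "(\<lambda>f. f j $ b) \<in> borel_measurable (Pi\<^sub>M J (\<lambda>_. borel :: (real^'n) measure))" if "j \<in> J" for j b
      by (rule measurable_compose[OF measurable_component_singleton[OF that]]) simp
    have "pos k \<le> t" using ran by auto
    then show "(\<lambda>f. \<Phi> f $ r) \<in> borel_measurable (Pi\<^sub>M J (\<lambda>_. borel))"
      by (cases "pos k"; cases a) (auto simp: r \<Phi>_def stack_vec_def J_def intro!: *[unfolded J_def])
  qed
  define S where "S = case_sum (\<lambda>_::nat. Sz2 D) (\<lambda>_::nat. Sy2 D)"
  have spd_S: "spd (S j)" for j
    using spd by (cases j) (auto simp: S_def)
  define emb where "emb = case_sum (\<lambda>k (a::'n). (\<kappa> (Suc k), Inl a :: 'n + 'n)) (\<lambda>k a. (\<kappa> (Suc k), Inr a))"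
  have inj_emb: "inj (emb j)" for j
    by (cases j) (auto simp: emb_def inj_def)
  define X where "X j g = psd_sqrt (S j) *v (\<chi> a. g $ emb j a)" for j and g :: "real^('k \<times> ('n + 'n))"
  have "disjoint_family_on (\<lambda>j. range (emb j)) J"
    unfolding disjoint_family_on_def
  proof (intro ballI impI)
    fix i j assume ij: "i \<in> J" "j \<in> J" "i \<noteq> j"
    have eq: "k = l" if "\<kappa> (Suc k) = \<kappa> (Suc l)" "k < t" "l < t" for k l
    proof -
      have "Suc k = pos (\<kappa> (Suc k))" "Suc l = pos (\<kappa> (Suc l))"
        using that(2,3) by (simp_all add: pos_\<kappa>)
      then show ?thesis
        using that(1) by simp
    qed
    show "range (emb i) \<inter> range (emb j) = {}"
      using ij by (cases i; cases j) (auto simp: J_def emb_def dest: eq)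
  qed
  then have "std_gauss.indep_vars (\<lambda>j. Pi\<^sub>M (range (emb j)) (\<lambda>_. borel))
      (\<lambda>j g. \<lambda>r\<in>range (emb j). (g :: real^('k \<times> ('n + 'n))) $ r) J"
    by (intro std_gauss.indep_vars_restrict[OF indep_vars_std_gauss_nth]) auto
  then have "std_gauss.indep_vars (\<lambda>_. borel)
      (\<lambda>j g. psd_sqrt (S j) *v (\<chi> a. (\<lambda>r\<in>range (emb j). (g :: real^('k \<times> ('n + 'n))) $ r) (emb j a))) J"
  proof (rule std_gauss.indep_vars_compose2)
    fix j assume "j \<in> J"
    have "(\<lambda>f. \<chi> a. f (emb j a)) \<in> measurable (Pi\<^sub>M (range (emb j)) (\<lambda>_. borel)) (borel :: (real^'n) measure)"
      by (rule borel_measurable_vec) (auto intro!: measurable_component_singleton)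
    then show "(\<lambda>f. psd_sqrt (S j) *v (\<chi> a. f (emb j a))) \<in> measurable (Pi\<^sub>M (range (emb j)) (\<lambda>_. borel)) borel"
      by (rule measurable_compose[OF _ borel_measurable_matrix_vector])
  qed
  then have indep_X: "std_gauss.indep_vars (\<lambda>_. borel) X J"
    by (simp add: X_def[abs_def])
  have select: "(\<lambda>g :: real^('k \<times> ('n + 'n)). \<chi> a. g $ emb j a) \<in> measurable std_gauss borel" for j
    by (rule borel_measurable_vec) simp
  have law_X: "distr std_gauss borel (X j) = density lborel (mvnormal_density 0 (S j))" for j
  proof -
    have "distr std_gauss borel (X j) =
        distr (distr std_gauss borel (\<lambda>g. \<chi> a. g $ emb j a)) borel ((*v) (psd_sqrt (S j)))"
      by (subst distr_distr[OF borel_measurable_matrix_vector select]) (simp add: comp_def X_def[abs_def])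
    then show ?thesis
      by (simp only: distr_std_gauss_select[OF inj_emb] distr_std_gauss_psd_sqrt[OF spd_S])
  qed
  have dist: "distributed M lborel (case_sum Z Y j) (mvnormal_density 0 (S j))" if "j \<in> J" for j
    using that Z Y by (auto simp: J_def S_def)
  have meas: "case_sum Z Y j \<in> measurable M borel" if "j \<in> J" for j
    using distributed_measurable[OF dist[OF that]] by simp
  have law: "distr M borel (case_sum Z Y j) = density lborel (mvnormal_density 0 (S j))" if "j \<in> J" for j
  proof -
    have "distr M borel (case_sum Z Y j) = distr M lborel (case_sum Z Y j)"
      by (rule distr_cong) auto
    then show ?thesis
      using distributed_distr_eq_density[OF dist[OF that]] by simp
  qed
  have meas_X: "X j \<in> measurable std_gauss borel" for j
    unfolding X_def by (rule measurable_compose[OF select borel_measurable_matrix_vector])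
  (* An empty family has to be treated apart: the product-law criterion for independence excludes it. *)
  have joint: "distr M (Pi\<^sub>M J (\<lambda>_. borel)) (\<lambda>\<omega>. \<lambda>j\<in>J. case_sum Z Y j \<omega>) =
      distr std_gauss (Pi\<^sub>M J (\<lambda>_. borel)) (\<lambda>g. \<lambda>j\<in>J. X j g)"
  proof (cases "J = {}")
    case True
    then show ?thesis
      by (simp add: restrict_def space_PiM distr_const std_gauss.distr_const)
  next
    case False
    have "distr M (Pi\<^sub>M J (\<lambda>_. borel)) (\<lambda>\<omega>. \<lambda>j\<in>J. case_sum Z Y j \<omega>) = Pi\<^sub>M J (\<lambda>j. distr M borel (case_sum Z Y j))"
      using indep_vars_iff_distr_eq_PiM'[OF False, of "case_sum Z Y" "\<lambda>_. borel"] meas indep by (simp add: J_def)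
    also have "\<dots> = Pi\<^sub>M J (\<lambda>j. distr std_gauss borel (X j))"
      by (rule PiM_cong) (simp_all add: law law_X)
    also have "\<dots> = distr std_gauss (Pi\<^sub>M J (\<lambda>_. borel)) (\<lambda>g. \<lambda>j\<in>J. X j g)"
      using std_gauss.indep_vars_iff_distr_eq_PiM'[OF False, of X "\<lambda>_. borel"] meas_X indep_X by simp
    finally show ?thesis .
  qed
  have meas_joint: "(\<lambda>\<omega>. \<lambda>j\<in>J. case_sum Z Y j \<omega>) \<in> measurable M (Pi\<^sub>M J (\<lambda>_. borel))"
    using meas by (intro measurable_restrict)
  have W: "noise_stack pos (x_init D) Z Y \<omega> = \<Phi> (\<lambda>j\<in>J. case_sum Z Y j \<omega>)" for \<omega>
  proof -
    have "noise_stack pos (x_init D) Z Y \<omega> = \<Phi> (\<lambda>j. case_sum Z Y j \<omega>)"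
      by (rule block_eqI) (simp add: noise_stack_def noise_block_def \<Phi>_def split: nat.split)
    also have "\<dots> = \<Phi> (\<lambda>j\<in>J. case_sum Z Y j \<omega>)"
      by (rule \<Phi>_cong) simp
    finally show ?thesis .
  qed
  have "mw_vec D pos + psd_sqrt (Sw_stack D pos) *v g = \<Phi> (\<lambda>j. X j g)" for g
  proof (rule block_eqI)
    fix k
    have "block g k = vconcat (\<chi> a. g $ (k, Inl a)) (\<chi> a. g $ (k, Inr a))"
      by (rule vconcat_eqI) (simp_all add: block_def upper_def lower_def)
    moreover have "k = \<kappa> (Suc i)" if "pos k = Suc i" for i
      using \<kappa>_pos[of k] that by simp
    ultimately show "block (mw_vec D pos + psd_sqrt (Sw_stack D pos) *v g) k = block (\<Phi> (\<lambda>j. X j g)) k"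
      unfolding psd_sqrt_Sw_stack[OF spd_imp_psd[OF spd(1)] spd_imp_psd[OF spd(2)] inj]
      by (cases "pos k")
         (simp_all add: block_diagonal_stack_vector[OF inj] mw_vec_def \<Phi>_def X_def S_def emb_def block_mat_vector)
  qed
  also have "\<Phi> (\<lambda>j. X j g) = \<Phi> (\<lambda>j\<in>J. X j g)" for g
    by (rule \<Phi>_cong) simp
  finally have G: "mw_vec D pos + psd_sqrt (Sw_stack D pos) *v g = \<Phi> (\<lambda>j\<in>J. X j g)" for g .
  show "noise_stack pos (x_init D) Z Y \<in> measurable M borel"
    unfolding W[abs_def] by (rule measurable_compose[OF meas_joint meas_\<Phi>])
  have "distr M borel (noise_stack pos (x_init D) Z Y) =
      distr (distr M (Pi\<^sub>M J (\<lambda>_. borel)) (\<lambda>\<omega>. \<lambda>j\<in>J. case_sum Z Y j \<omega>)) borel \<Phi>"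
    by (subst distr_distr[OF meas_\<Phi> meas_joint]) (simp add: W[abs_def] comp_def)
  also have "\<dots> = distr std_gauss borel (\<lambda>g. mw_vec D pos + psd_sqrt (Sw_stack D pos) *v g)"
    unfolding joint using meas_X
    by (subst distr_distr[OF meas_\<Phi>]) (auto simp: G comp_def intro!: measurable_restrict)
  finally show "distr M borel (noise_stack pos (x_init D) Z Y) =
      distr std_gauss borel (\<lambda>g. mw_vec D pos + psd_sqrt (Sw_stack D pos) *v g)" .
qed

section \<open>Well-posedness of the Riccati recursion\<close>

lemma F_mat_transpose_vector: "transpose (F_mat D k) *v x = Fb D k *v upper x + Fc D k *v lower x"
  by (simp add: F_mat_def hcat_def matrix_vector_mult_def vec_eq_iff sum_UNIV_Plus upper_def lower_def)

lemma E2_mat_vector: "E2_mat *v y = vconcat 0 y"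
proof -
  have "(E2_mat *v y) $ i = vconcat 0 y $ i" for i
    by (cases i) (simp_all add: E2_mat_def hcat_def matrix_vector_mult_def transpose_def mat_def
      if_distrib if_distribR cong: if_cong)
  then show ?thesis
    by (simp add: vec_eq_iff)
qed

text \<open>
  The hypothesis is the inequality \<open>l R\<^sup>-\<^sup>1 \<le> S\<close> of quadratic forms, conjugated by the root of \<open>S\<close>; the
  conclusion is the equivalent inequality \<open>l S\<^sup>-\<^sup>1 \<le> R\<close> between the inverses.
\<close>

lemma scaled_inverse_form_le:
  fixes R S :: "real^'n^'n"
  assumes R: "spd R" and S: "spd S" and "0 \<le> l"
    and psd: "psd (mat 1 - l *\<^sub>R (matrix_inv (psd_sqrt S) ** matrix_inv R ** matrix_inv (psd_sqrt S)))"
  shows "l * (y \<bullet> (matrix_inv S *v y)) \<le> y \<bullet> (R *v y)"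
proof -
  define Q where "Q = psd_sqrt S"
  have Q: "psd Q" "Q ** Q = S"
    using S by (simp_all add: Q_def psd_sqrt spd_imp_psd)
  have sym: "transpose Q = Q" "transpose R = R" "transpose S = S"
    using Q R S by (auto simp: psd_def spd_def)
  have "det S \<noteq> 0"
    using S invertible_spd invertible_det_nz by blast
  then have inv_Q: "invertible Q"
    using Q(2) det_mul[of Q Q] by (auto simp: invertible_det_nz)
  have inv: "invertible R" "invertible S"
    using R S by (simp_all add: invertible_spd)
  have sym_inv: "transpose (matrix_inv Q) = matrix_inv Q" "transpose (matrix_inv R) = matrix_inv R"
    "transpose (matrix_inv S) = matrix_inv S"
    using inv_Q inv sym by (simp_all add: transpose_matrix_inv)
  (* Undo the conjugation; the inequality is evaluated below at the inverse of S applied to y. *)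
  have le: "l * (x \<bullet> (matrix_inv R *v x)) \<le> x \<bullet> (S *v x)" for x
  proof -
    define z where "z = Q *v x"
    have QR: "matrix_inv Q *v z = x"
      by (simp add: z_def matrix_vector_mul_assoc matrix_inv_left[OF inv_Q])
    have "0 \<le> z \<bullet> ((mat 1 - l *\<^sub>R (matrix_inv Q ** matrix_inv R ** matrix_inv Q)) *v z)"
      using psd unfolding psd_def Q_def by blast
    also have "\<dots> = z \<bullet> z - l * (z \<bullet> (matrix_inv Q *v (matrix_inv R *v (matrix_inv Q *v z))))"
      by (simp add: matrix_vector_mult_diff_rdistrib inner_diff_right scaleR_matrix_vector_assoc[symmetric]
          matrix_vector_mul_assoc matrix_mul_assoc)
    also have "z \<bullet> (matrix_inv Q *v (matrix_inv R *v (matrix_inv Q *v z))) = x \<bullet> (matrix_inv R *v x)"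
      unfolding inner_matrix_vector[of z "matrix_inv Q"] sym_inv QR ..
    also have "z \<bullet> z = x \<bullet> (S *v x)"
      unfolding z_def Q(2)[symmetric] matrix_vector_mul_assoc[symmetric] inner_matrix_vector[of x Q] sym ..
    finally show ?thesis by simp
  qed
  define x where "x = matrix_inv S *v y"
  define a where "a = x \<bullet> y"
  define b where "b = x \<bullet> (matrix_inv R *v x)"
  define c where "c = y \<bullet> (R *v y)"
  have Sx: "S *v x = y"
    by (simp add: x_def matrix_vector_mul_assoc matrix_inv_right[OF inv(2)])
  have lb: "l * b \<le> a"
    using le[of x] by (simp add: a_def b_def Sx)
  (* Nonnegativity of R along the line through the inverse of R applied to x with direction y; the
     choice s = 1 / l combines with the inequality above. *)
  have quad: "0 \<le> b - 2 * s * a + s\<^sup>2 * c" for s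
  proof -
    let ?w = "matrix_inv R *v x - s *\<^sub>R y"
    have Rw: "R *v ?w = x - s *\<^sub>R (R *v y)"
      by (simp add: matrix_vector_mult_diff_distrib matrix_vector_mult_scaleR matrix_vector_mul_assoc
          matrix_inv_right[OF inv(1)])
    have "0 \<le> ?w \<bullet> (R *v ?w)"
      using spd_imp_psd[OF R] by (simp add: psd_def)
    also have "\<dots> = b - s * (y \<bullet> x) - s * ((matrix_inv R *v x) \<bullet> (R *v y)) + s\<^sup>2 * c"
      unfolding Rw by (simp add: b_def c_def algebra_simps inner_commute power2_eq_square)
    also have "(matrix_inv R *v x) \<bullet> (R *v y) = y \<bullet> x"
      unfolding inner_matrix_vector[of "matrix_inv R *v x" R] sym matrix_vector_mul_assoc
        matrix_inv_right[OF inv(1)] matrix_vector_mul_lid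
      by (rule inner_commute)
    finally show ?thesis
      by (simp add: a_def inner_commute)
  qed
  have "l * a \<le> c"
  proof -
    have "0 \<le> l * (l * b - 2 * a) + c"
    proof -
      have "l * (l * b - 2 * a) + c = l\<^sup>2 * b - 2 * l * a + c"
        by (simp add: algebra_simps power2_eq_square)
      moreover have "0 \<le> l\<^sup>2 * b - 2 * l * a + c"
      proof (cases "l = 0")
        case True
        then show ?thesis
          using spd_imp_psd[OF R] by (simp add: c_def psd_def)
      next
        case False
        have "0 \<le> l\<^sup>2 * (b - 2 * (1 / l) * a + (1 / l)\<^sup>2 * c)"
          by (intro mult_nonneg_nonneg quad) simp
        also have "\<dots> = l\<^sup>2 * b - 2 * l * a + c"
          using False by (simp add: field_simps power2_eq_square)
        finally show ?thesis .
      qed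
      ultimately show ?thesis by simp
    qed
    also have "l * (l * b - 2 * a) \<le> l * (- a)"
      using lb \<open>0 \<le> l\<close> by (intro mult_left_mono) auto
    finally show ?thesis by simp
  qed
  then show ?thesis
    by (simp add: a_def c_def x_def inner_commute)
qed

locale deceptive_control =
  fixes D :: "'n::finite control_problem"
  assumes spd: "spd (Sz2 D)" "spd (Sy2 D)" "spd (R_alpha D)" "spd (R_beta D)" "spd (R_v D)" "spd (T_v D)"
    and lam_nonneg: "0 \<le> lam D"
    and lam_bound: "psd (mat 1 - lam D *\<^sub>R
      (matrix_inv (psd_sqrt (Sy2 D)) ** matrix_inv (R_beta D) ** matrix_inv (psd_sqrt (Sy2 D))))"
begin

lemma transpose_Sy2_inv: "transpose (Sy2_inv D) = Sy2_inv D"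
  using spd_matrix_inv[OF spd(2)] by (simp add: spd_def)

text \<open>
  The stage cost is \<open>\<parallel>v\<parallel>\<^sup>2 + \<parallel>\<alpha>\<parallel>\<^sup>2 + \<lambda> \<parallel>F\<^sup>T x - \<beta>\<parallel>\<^sup>2 + (\<parallel>\<beta>\<parallel>\<^sup>2 - \<lambda> \<parallel>\<beta>\<parallel>\<^sup>2)\<close> in the respective
  weighted norms, and the bound on \<open>\<lambda>\<close> makes the last bracket nonnegative.
\<close>

lemma stage_cost_nonneg:
  "0 \<le> x \<bullet> (Q_mat D k *v x) + 2 * (x \<bullet> (N_mat D k *v u)) + u \<bullet> (R_mat D *v u)"
proof -
  let ?S = "Sy2_inv D" and ?b = "lower u" and ?f = "Fb D k *v upper x + Fc D k *v lower x"
  have sym: "y \<bullet> (?S *v z) = z \<bullet> (?S *v y)" for y z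
    using inner_matrix_vector[of y ?S z] by (simp add: transpose_Sy2_inv inner_commute)
  have Q: "x \<bullet> (Q_mat D k *v x) = upper x \<bullet> (R_v D *v upper x) + lam D * (?f \<bullet> (?S *v ?f))"
    by (simp add: Q_mat_def block_mat_vector inner_upper_lower matrix_vector_mult_add_rdistrib
        scaleR_matrix_vector_assoc[symmetric] matrix_vector_mul_assoc[symmetric] inner_add_right inner_add_left
        inner_matrix_vector[of _ "transpose _"] matrix_vector_right_distrib algebra_simps)
  have N: "x \<bullet> (N_mat D k *v u) = - lam D * (?f \<bullet> (?S *v ?b))"
    by (simp add: N_mat_def block_mat_vector inner_upper_lower matrix_vector_mult_minus_left
        scaleR_matrix_vector_assoc[symmetric] matrix_vector_mul_assoc[symmetric] inner_add_right inner_add_left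
        inner_matrix_vector[of _ "transpose _"] algebra_simps)
  have R: "u \<bullet> (R_mat D *v u) = upper u \<bullet> (R_alpha D *v upper u) + ?b \<bullet> (R_beta D *v ?b)"
    by (simp add: R_mat_def block_mat_vector inner_upper_lower)
  have "(?f - ?b) \<bullet> (?S *v (?f - ?b)) = ?f \<bullet> (?S *v ?f) - 2 * (?f \<bullet> (?S *v ?b)) + ?b \<bullet> (?S *v ?b)"
    using sym[of ?b ?f] by (simp add: matrix_vector_mult_diff_distrib inner_diff_left inner_diff_right)
  then have "x \<bullet> (Q_mat D k *v x) + 2 * (x \<bullet> (N_mat D k *v u)) + u \<bullet> (R_mat D *v u) =
      upper x \<bullet> (R_v D *v upper x) + upper u \<bullet> (R_alpha D *v upper u)
      + lam D * ((?f - ?b) \<bullet> (?S *v (?f - ?b)))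
      + (?b \<bullet> (R_beta D *v ?b) - lam D * (?b \<bullet> (?S *v ?b)))"
    unfolding Q N R by (simp add: algebra_simps)
  moreover have "lam D * (?b \<bullet> (?S *v ?b)) \<le> ?b \<bullet> (R_beta D *v ?b)"
    by (rule scaled_inverse_form_le[OF spd(4,2) lam_nonneg lam_bound])
  moreover have "0 \<le> upper x \<bullet> (R_v D *v upper x)" "0 \<le> upper u \<bullet> (R_alpha D *v upper u)"
    "0 \<le> (?f - ?b) \<bullet> (?S *v (?f - ?b))"
    using spd spd_matrix_inv[OF spd(2)] by (auto dest!: spd_imp_psd simp: psd_def)
  ultimately show ?thesis
    using lam_nonneg by simp
qed

lemma spd_R_mat: "spd (R_mat D)"
  unfolding R_mat_def by (intro spd_block_diag spd)

lemma spd_H_of: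
  assumes "psd P"
  shows "spd (H_of D P)"
proof -
  have "H_of D P = R_mat D + P"
    by (simp add: H_of_def B_mat_def)
  then show ?thesis
    using spd_R_mat assms unfolding spd_def psd_def
    by (simp add: transpose_add matrix_vector_mult_add_rdistrib inner_add_right add_pos_nonneg)
qed

text \<open>
  \<open>x\<^sup>T P\<^sub>t x\<close> is the stage cost plus the cost-to-go at the minimising control
  \<open>u = - H\<^sup>-\<^sup>1 G\<^sup>T x\<close>, hence nonnegative.
\<close>

lemma psd_riccati_step:
  assumes P: "psd P"
  shows "psd (M_of D k P - G_of D k P ** matrix_inv (H_of D P) ** transpose (G_of D k P))"
proof -
  define H G A where "H = H_of D P" and "G = G_of D k P" and "A = (A_mat :: real^('n + 'n)^('n + 'n))"
  have H: "spd H"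
    unfolding H_def by (rule spd_H_of[OF P])
  have inv: "invertible H" and sym_H: "transpose H = H"
    using H by (auto simp: invertible_spd spd_def)
  have sym_Hi: "transpose (matrix_inv H) = matrix_inv H"
    using inv sym_H by (rule transpose_matrix_inv)
  have sym_P: "transpose P = P"
    using P by (simp add: psd_def)
  have sym_Q: "transpose (Q_mat D k) = Q_mat D k"
  proof -
    have "transpose (R_v D) = R_v D"
      using spd by (simp add: spd_def)
    then show ?thesis
      by (simp add: Q_mat_def transpose_block_mat transpose_add transpose_scalar matrix_transpose_mul
          matrix_mul_assoc transpose_Sy2_inv)
  qed
  have "transpose (M_of D k P - G ** matrix_inv H ** transpose G) = M_of D k P - G ** matrix_inv H ** transpose G"
    by (simp add: M_of_def transpose_diff transpose_add matrix_transpose_mul sym_P sym_Q sym_Hi matrix_mul_assoc)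
  moreover have "0 \<le> x \<bullet> ((M_of D k P - G ** matrix_inv H ** transpose G) *v x)" for x
  proof -
    define g where "g = transpose G *v x"
    define u where "u = - (matrix_inv H *v g)"
    have Hu: "H *v u = - g"
      by (simp add: u_def matrix_vector_mult_minus_right matrix_vector_mul_assoc matrix_inv_right[OF inv])
    have H_u: "u \<bullet> (H *v u) = u \<bullet> (R_mat D *v u) + u \<bullet> (P *v u)"
      by (simp add: H_def H_of_def B_mat_def matrix_vector_mult_add_rdistrib inner_add_right)
    have G_u: "g \<bullet> u = x \<bullet> (N_mat D k *v u) + (A *v x) \<bullet> (P *v u)"
    proof -
      have "g \<bullet> u = x \<bullet> (G *v u)"
        unfolding g_def by (rule inner_matrix_vector[symmetric])
      then show ?thesis
        by (simp add: G_def G_of_def B_mat_def A_def matrix_vector_mult_add_rdistrib inner_add_right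
            matrix_vector_mul_assoc[symmetric] inner_matrix_vector[of x "transpose _"])
    qed
    have Pu: "u \<bullet> (P *v (A *v x)) = (A *v x) \<bullet> (P *v u)"
      using inner_matrix_vector[of u P] by (simp add: sym_P inner_commute)
    have form: "x \<bullet> ((M_of D k P - G ** matrix_inv H ** transpose G) *v x) =
        x \<bullet> (Q_mat D k *v x) + (A *v x) \<bullet> (P *v (A *v x)) - g \<bullet> (matrix_inv H *v g)"
      by (simp add: M_of_def A_def g_def matrix_vector_mult_diff_rdistrib matrix_vector_mult_add_rdistrib
          inner_add_right inner_diff_right matrix_vector_mul_assoc[symmetric]
          inner_matrix_vector[of x "transpose _"] inner_matrix_vector[of x G])
    have "- (g \<bullet> (matrix_inv H *v g)) = 2 * (g \<bullet> u) + u \<bullet> (H *v u)"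
      unfolding Hu by (simp add: u_def inner_commute)
    with form have "x \<bullet> ((M_of D k P - G ** matrix_inv H ** transpose G) *v x) =
        (x \<bullet> (Q_mat D k *v x) + 2 * (x \<bullet> (N_mat D k *v u)) + u \<bullet> (R_mat D *v u))
        + (A *v x + u) \<bullet> (P *v (A *v x + u))"
      unfolding H_u G_u by (simp add: algebra_simps matrix_vector_right_distrib inner_add_left inner_add_right Pu)
    moreover have "0 \<le> (A *v x + u) \<bullet> (P *v (A *v x + u))"
      using P by (simp add: psd_def)
    ultimately show ?thesis
      using stage_cost_nonneg[of x k u] by linarith
  qed
  ultimately show ?thesis
    by (simp add: psd_def H_def G_def)
qed

lemma psd_P_mat: "psd (P_mat D k)"
proof (induction "horizon D - k" arbitrary: k)
  case 0
  have "psd (block_diag (T_v D) (0 :: real^'n^'n))"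
    using spd_imp_psd[OF spd(6)] by (intro psd_block_diag) (auto simp: psd_def transpose_zero)
  then show ?case
    using 0 by (subst P_mat.simps) simp
next
  case (Suc d)
  then have "psd (P_mat D (Suc k))"
    by simp
  moreover have "k < horizon D"
    using Suc(2) by simp
  ultimately show ?case
    by (subst P_mat.simps) (simp add: psd_riccati_step)
qed

lemma spd_H_mat: "spd (H_mat D k)"
  unfolding H_mat_def by (intro spd_H_of psd_P_mat)

lemma transpose_H_inv: "transpose (H_inv D k) = H_inv D k"
  using spd_matrix_inv[OF spd_H_mat] by (simp add: spd_def)

end

section \<open>The statistic as a quadratic polynomial of the noise\<close>

lemma matrix_vector_mult_sum: "A *v (\<Sum>i\<in>I. f i) = (\<Sum>i\<in>I. A *v f i)" for A :: "real^'m^'n"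
  by (rule linear_sum) (rule matrix_vector_mul_linear)

lemma A_mat_vector: "A_mat *v x = vconcat (upper x) (upper x + lower x)"
  by (simp add: A_mat_def block_mat_vector)

lemma sum_ge_lessThan:
  "(if i < t then \<Sum>k\<in>{i..t - 1}. f k else 0) = (\<Sum>k<t. if i \<le> k then f k else (0 :: 'c::comm_monoid_add))"
  for i t :: nat
proof (cases "i < t")
  case True
  then have "{i..t - 1} = {k \<in> {..<t}. i \<le> k}"
    by auto
  then show ?thesis
    using True by (simp add: sum.inter_filter[symmetric])
qed (simp add: sum.neutral)

text \<open>
  Written with indicator conditions, the summation ranges no longer depend on the blocks, so that sums
  over blocks and over time can be interchanged.
\<close>

lemma L1_block_alt:
  "L1_block D t i =
    (if 1 \<le> i then (E2_mat ** Sy2_inv D ** transpose (F_mat D (i - 1))) *v D_sum D (i - 1) else 0)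
    - (\<Sum>k<t. if i \<le> k then transpose (C_prod D i k) *v
        ((F_mat D k ** Sy2_inv D ** transpose E2_mat ** H_inv D k) *v s_vec D (Suc k)
          + sym_part (S_mat D k) *v D_sum D k) else 0)"
  unfolding L1_block_def sum_ge_lessThan ..

lemma L2_block_alt:
  "L2_block D t i j = (1/2) *\<^sub>R (
    (if 1 \<le> i \<and> j < i then 2 *\<^sub>R (E2_mat ** Sy2_inv D ** transpose (F_mat D (i - 1)) ** C_prod D j (i - 1)) else 0)
    - (\<Sum>k<t. if max i j \<le> k then transpose (C_prod D i k) ** transpose (S_mat D k) ** C_prod D j k else 0))"
  unfolding L2_block_def sum_ge_lessThan ..

lemma C_prod_self [simp]: "C_prod D k k = mat 1"
  by (cases k) auto

lemma D_sum_Suc: "D_sum D (Suc k) = transpose (K_mat D k) *v D_sum D k - H_inv D k *v s_vec D (Suc k)"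
proof -
  have "(\<Sum>j<k. (C_prod D (Suc j) (Suc k) ** H_inv D j) *v s_vec D (Suc j)) =
      transpose (K_mat D k) *v (\<Sum>j<k. (C_prod D (Suc j) k ** H_inv D j) *v s_vec D (Suc j))"
    unfolding matrix_vector_mult_sum by (intro sum.cong) (auto simp: matrix_vector_mul_assoc matrix_mul_assoc)
  then show ?thesis
    by (simp add: D_sum_def matrix_vector_mult_minus_right del: C_prod.simps)
qed

locale quadratic_statistic = deceptive_control D for D :: "'n::finite control_problem" +
  fixes t :: nat
  assumes fd_zero: "\<And>k. k < t \<Longrightarrow> fd D k = 0"
begin

lemma u_opt_eq:
  assumes "k < t"
  shows "u_opt D k x = - (H_inv D k *v (transpose (G_mat D k) *v x)) - H_inv D k *v s_vec D (Suc k)"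
proof -
  have "r_vec D k = 0"
    using fd_zero[OF assms] by (intro vconcat_eqI) (simp_all add: r_vec_def)
  then show ?thesis
    by (simp add: u_opt_def B_mat_def matrix_vector_right_distrib)
qed

lemma x_opt_Suc:
  assumes "k < t"
  shows "x_opt D Z Y (Suc k) \<omega> =
    transpose (K_mat D k) *v x_opt D Z Y k \<omega> - H_inv D k *v s_vec D (Suc k) + vconcat (Z k \<omega>) (Y k \<omega>)"
proof -
  have "transpose (K_mat D k) = A_mat - H_inv D k ** transpose (G_mat D k)"
    by (simp add: K_mat_def transpose_diff matrix_transpose_mul transpose_H_inv)
  then show ?thesis
    by (simp add: u_opt_eq[OF assms] B_mat_def matrix_vector_mult_diff_rdistrib matrix_vector_mul_assoc)
qed

text \<open>
  Variation of constants: \<open>C_prod D i k\<close> transports noise block \<open>i\<close> to time \<open>k\<close>, and \<open>D_sum D k\<close> is the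
  accumulated effect of the constant terms of the control.
\<close>

lemma x_opt_noise:
  "k \<le> t \<Longrightarrow> x_opt D Z Y k \<omega> = (\<Sum>i\<le>k. C_prod D i k *v noise_block (x_init D) Z Y \<omega> i) + D_sum D k"
proof (induction k)
  case 0
  then show ?case by (simp add: D_sum_def)
next
  case (Suc k)
  have "(\<Sum>i\<le>Suc k. C_prod D i (Suc k) *v noise_block (x_init D) Z Y \<omega> i) =
    (\<Sum>i\<le>k. transpose (K_mat D k) *v (C_prod D i k *v noise_block (x_init D) Z Y \<omega> i)) + vconcat (Z k \<omega>) (Y k \<omega>)"
    by (simp add: matrix_vector_mul_assoc)
  moreover have "k < t" "k \<le> t"
    using Suc.prems by auto
  ultimately show ?case
    unfolding x_opt_Suc[OF \<open>k < t\<close>] Suc.IH[OF \<open>k \<le> t\<close>] D_sum_Suc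
    by (simp add: matrix_vector_right_distrib matrix_vector_mult_sum algebra_simps del: C_prod.simps sum.atMost_Suc)
qed

text \<open>
  \<open>gain k *v x\<close> is \<open>\<Sigma>\<^sup>-\<^sup>1 F\<^sub>k\<^sup>T x\<close>, placed in the lower half, where \<open>\<Sigma>\<close> is the covariance of \<open>Y\<^sub>k\<close>; its
  inner product with a noise or control vector only sees the component acting on the position.
\<close>

definition gain :: "nat \<Rightarrow> real^('n + 'n)^('n + 'n)" where
  "gain k = E2_mat ** Sy2_inv D ** transpose (F_mat D k)"

text \<open>
  With \<open>e = \<beta>\<^sub>k + Y\<^sub>k\<close> and \<open>f = F\<^sub>k\<^sup>T x\<^sub>k\<close>, the difference of squares in the statistic is
  \<open>e \<bullet> \<Sigma>\<^sup>-\<^sup>1 f - f \<bullet> \<Sigma>\<^sup>-\<^sup>1 f / 2\<close>. Inserting the optimal \<open>\<beta>\<^sub>k\<close>, an affine function of \<open>x\<^sub>k\<close>, merges the terms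
  quadratic in the state into the matrix \<open>\<S>\<^sub>k\<close>.
\<close>

definition increment :: "nat \<Rightarrow> real^('n + 'n) \<Rightarrow> real^('n + 'n) \<Rightarrow> real" where
  "increment k x w = w \<bullet> (gain k *v x) - s_vec D (Suc k) \<bullet> ((H_inv D k ** gain k) *v x) - (1/2) * (x \<bullet> (S_mat D k *v x))"

lemma log_L_increments:
  "log_L D Z Y t \<omega> = (\<Sum>k<t. increment k (x_opt D Z Y k \<omega>) (vconcat (Z k \<omega>) (Y k \<omega>)))"
proof -
  have "(1/2) * (sq_norm_wrt (Sy2_inv D) (p_opt D Z Y (Suc k) \<omega> - v_opt D Z Y k \<omega> - p_opt D Z Y k \<omega>)
      - sq_norm_wrt (Sy2_inv D) (p_opt D Z Y (Suc k) \<omega> - v_opt D Z Y k \<omega> - p_opt D Z Y k \<omega>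
        - Fb D k *v v_opt D Z Y k \<omega> - Fc D k *v p_opt D Z Y k \<omega> - fd D k)) =
      increment k (x_opt D Z Y k \<omega>) (vconcat (Z k \<omega>) (Y k \<omega>))" if k: "k < t" for k
  proof -
    let ?S = "Sy2_inv D"
    define x where "x = x_opt D Z Y k \<omega>"
    define u where "u = u_opt D k x"
    define w where "w = vconcat (Z k \<omega>) (Y k \<omega>)"
    define e where "e = lower u + lower w"
    define f where "f = transpose (F_mat D k) *v x"
    have sym: "y \<bullet> (?S *v z) = z \<bullet> (?S *v y)" for y z
      using inner_matrix_vector[of y ?S z] by (simp add: transpose_Sy2_inv inner_commute)
    have eq_e: "p_opt D Z Y (Suc k) \<omega> - v_opt D Z Y k \<omega> - p_opt D Z Y k \<omega> = e"
      by (simp add: A_mat_vector B_mat_def e_def u_def w_def x_def)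
    have eq_f: "e - Fb D k *v v_opt D Z Y k \<omega> - Fc D k *v p_opt D Z Y k \<omega> - fd D k = e - f"
      by (simp add: f_def F_mat_transpose_vector fd_zero[OF k] x_def)
    have polar: "(1/2) * (e \<bullet> (?S *v e) - (e - f) \<bullet> (?S *v (e - f))) = e \<bullet> (?S *v f) - (1/2) * (f \<bullet> (?S *v f))"
      using sym[of f e] by (simp add: matrix_vector_mult_diff_distrib inner_diff_left inner_diff_right)
    have ef: "e \<bullet> (?S *v f) = u \<bullet> (gain k *v x) + w \<bullet> (gain k *v x)"
    proof -
      have "gain k *v x = vconcat 0 (?S *v f)"
        unfolding gain_def f_def matrix_vector_mul_assoc[symmetric] E2_mat_vector ..
      then show ?thesis
        by (simp add: e_def inner_upper_lower inner_add_left)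
    qed
    have ug: "u \<bullet> (gain k *v x) =
        - (x \<bullet> ((G_mat D k ** H_inv D k ** gain k) *v x)) - s_vec D (Suc k) \<bullet> ((H_inv D k ** gain k) *v x)"
      unfolding u_def u_opt_eq[OF k] matrix_vector_mul_assoc[symmetric]
        inner_matrix_vector[of x] inner_matrix_vector[of "s_vec D (Suc k)"]
        inner_matrix_vector[of "transpose (G_mat D k) *v x"] transpose_H_inv
      by (simp only: inner_diff_left inner_minus_left)
    have xS: "x \<bullet> (S_mat D k *v x) = f \<bullet> (?S *v f) + 2 * (x \<bullet> ((G_mat D k ** H_inv D k ** gain k) *v x))"
    proof -
      have "x \<bullet> ((F_mat D k ** ?S ** transpose (F_mat D k)) *v x) = f \<bullet> (?S *v f)"
        unfolding f_def matrix_vector_mul_assoc[symmetric] by (rule inner_matrix_vector)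
      then show ?thesis
        by (simp add: S_mat_def gain_def matrix_mul_assoc matrix_vector_mult_add_rdistrib inner_add_right
            scaleR_matrix_vector_assoc[symmetric])
    qed
    show ?thesis
      unfolding eq_e eq_f sq_norm_wrt_def polar
      unfolding ef ug increment_def x_def[symmetric] w_def[symmetric] xS
      by (simp add: algebra_simps)
  qed
  then show ?thesis
    by (simp add: log_L_def sum_distrib_left)
qed

lemma sum_atMost_restrict:
  "k \<le> t' \<Longrightarrow> (\<Sum>i\<le>t'. if i \<le> k then f i else 0) = (\<Sum>i\<le>k. f i :: real)" for t' k :: nat
proof -
  assume "k \<le> t'"
  then have "{i \<in> {..t'}. i \<le> k} = {..k}" by auto
  then show ?thesis
    by (simp add: sum.inter_filter[symmetric])
qed

text \<open>
  Collecting, for each pair of noise blocks, the coefficients contributed by the increments after both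
  of them gives the blocks of \<open>\<L>\<^sup>1\<close> and \<open>\<L>\<^sup>2\<close>.
\<close>

lemma log_L_blocks:
  obtains c where "\<And>(Z :: nat \<Rightarrow> 'a \<Rightarrow> real^'n) Y \<omega>. log_L D Z Y t \<omega> = c
    + (\<Sum>i\<le>t. noise_block (x_init D) Z Y \<omega> i \<bullet> L1_block D t i)
    + (\<Sum>i\<le>t. \<Sum>j\<le>t. noise_block (x_init D) Z Y \<omega> i \<bullet> (L2_block D t i j *v noise_block (x_init D) Z Y \<omega> j))"
proof
  fix Z Y :: "nat \<Rightarrow> 'a \<Rightarrow> real^'n" and \<omega>
  define W where "W = noise_block (x_init D) Z Y \<omega>"
  define d where "d = D_sum D"
  define \<xi> where "\<xi> k = (\<Sum>i\<le>k. C_prod D i k *v W i)" for k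
  define l where "l k = (F_mat D k ** Sy2_inv D ** transpose E2_mat ** H_inv D k) *v s_vec D (Suc k)
      + sym_part (S_mat D k) *v d k" for k
  define c where "c k = - (s_vec D (Suc k) \<bullet> ((H_inv D k ** gain k) *v d k)) - (1/2) * (d k \<bullet> (S_mat D k *v d k))" for k
  have inc: "increment k (x_opt D Z Y k \<omega>) (vconcat (Z k \<omega>) (Y k \<omega>)) =
      c k + (W (Suc k) \<bullet> (gain k *v d k) - l k \<bullet> \<xi> k)
      + (W (Suc k) \<bullet> (gain k *v \<xi> k) - (1/2) * (\<xi> k \<bullet> (S_mat D k *v \<xi> k)))" if k: "k < t" for k
  proof -
    have x: "x_opt D Z Y k \<omega> = \<xi> k + d k"
      using x_opt_noise[of k Z Y \<omega>] k by (simp add: \<xi>_def d_def W_def)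
    have "transpose (H_inv D k ** gain k) = F_mat D k ** Sy2_inv D ** transpose E2_mat ** H_inv D k"
      by (simp add: gain_def matrix_transpose_mul matrix_mul_assoc transpose_Sy2_inv transpose_H_inv)
    then have 1: "s_vec D (Suc k) \<bullet> ((H_inv D k ** gain k) *v \<xi> k) =
        ((F_mat D k ** Sy2_inv D ** transpose E2_mat ** H_inv D k) *v s_vec D (Suc k)) \<bullet> \<xi> k"
      by (simp only: inner_matrix_vector[of "s_vec D (Suc k)"])
    have 2: "(1/2) * (\<xi> k \<bullet> (S_mat D k *v d k)) + (1/2) * (d k \<bullet> (S_mat D k *v \<xi> k)) = (sym_part (S_mat D k) *v d k) \<bullet> \<xi> k"
      unfolding inner_matrix_vector[of "d k"]
      by (simp add: sym_part_def scaleR_matrix_vector_assoc[symmetric] matrix_vector_mult_add_rdistrib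
          inner_add_left inner_commute[of "\<xi> k"])
    show ?thesis
      unfolding x increment_def l_def inner_add_left 2[symmetric] 1[symmetric]
      by (simp add: c_def W_def matrix_vector_right_distrib inner_add_left inner_add_right algebra_simps)
  qed
  have lin: "(\<Sum>i\<le>t. W i \<bullet> L1_block D t i) = (\<Sum>k<t. W (Suc k) \<bullet> (gain k *v d k) - l k \<bullet> \<xi> k)"
  proof -
    have "W i \<bullet> L1_block D t i = (if 1 \<le> i then W i \<bullet> (gain (i - 1) *v d (i - 1)) else 0)
        - (\<Sum>k<t. if i \<le> k then l k \<bullet> (C_prod D i k *v W i) else 0)" for i
    proof -
      have "W i \<bullet> (if i \<le> k then transpose (C_prod D i k) *v l k else 0) =
          (if i \<le> k then l k \<bullet> (C_prod D i k *v W i) else 0)" for k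
        using inner_matrix_vector[of "l k" "C_prod D i k" "W i"] by (simp only: inner_commute) simp
      moreover have "L1_block D t i = (if 1 \<le> i then gain (i - 1) *v d (i - 1) else 0)
          - (\<Sum>k<t. if i \<le> k then transpose (C_prod D i k) *v l k else 0)"
        unfolding L1_block_alt gain_def l_def d_def ..
      ultimately show ?thesis
        by (simp only: inner_diff_right inner_sum_right) simp
    qed
    then have "(\<Sum>i\<le>t. W i \<bullet> L1_block D t i) = (\<Sum>i\<le>t. if 1 \<le> i then W i \<bullet> (gain (i - 1) *v d (i - 1)) else 0)
        - (\<Sum>k<t. \<Sum>i\<le>t. if i \<le> k then l k \<bullet> (C_prod D i k *v W i) else 0)"
      by (simp only: sum_subtractf sum.swap[of _ "{..<t}"])
    also have "(\<Sum>i\<le>t. if 1 \<le> i then W i \<bullet> (gain (i - 1) *v d (i - 1)) else 0) = (\<Sum>k<t. W (Suc k) \<bullet> (gain k *v d k))"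
      by (simp add: sum.atMost_shift)
    also have "(\<Sum>k<t. \<Sum>i\<le>t. if i \<le> k then l k \<bullet> (C_prod D i k *v W i) else 0) = (\<Sum>k<t. l k \<bullet> \<xi> k)"
      by (intro sum.cong refl) (simp add: sum_atMost_restrict \<xi>_def inner_sum_right)
    finally show ?thesis
      by (simp add: sum_subtractf)
  qed
  have quad: "(\<Sum>i\<le>t. \<Sum>j\<le>t. W i \<bullet> (L2_block D t i j *v W j)) =
      (\<Sum>k<t. W (Suc k) \<bullet> (gain k *v \<xi> k) - (1/2) * (\<xi> k \<bullet> (S_mat D k *v \<xi> k)))"
  proof -
    define q where "q i j k = (C_prod D i k *v W i) \<bullet> (transpose (S_mat D k) *v (C_prod D j k *v W j))" for i j k
    have "W i \<bullet> (L2_block D t i j *v W j) =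
        (if 1 \<le> i then if j \<le> i - 1 then W i \<bullet> (gain (i - 1) *v (C_prod D j (i - 1) *v W j)) else 0 else 0)
        - (1/2) * (\<Sum>k<t. if i \<le> k then if j \<le> k then q i j k else 0 else 0)" for i j
    proof -
      have 1: "W i \<bullet> ((if max i j \<le> k then transpose (C_prod D i k) ** transpose (S_mat D k) ** C_prod D j k else 0) *v W j) =
          (if i \<le> k then if j \<le> k then q i j k else 0 else 0)" for k
        by (simp add: q_def matrix_vector_mul_assoc[symmetric] inner_matrix_vector[of "W i" "transpose (C_prod D i k)"])
      have sum_mv: "sum f I *v y = (\<Sum>k\<in>I. f k *v y)" for f :: "nat \<Rightarrow> real^('n + 'n)^('n + 'n)" and I y
        by (induction I rule: infinite_finite_induct) (simp_all add: matrix_vector_mult_add_rdistrib)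
      have 2: "j < i \<longleftrightarrow> j \<le> i - 1" if "1 \<le> i"
        using that by auto
      show ?thesis
        unfolding L2_block_alt gain_def[symmetric] scaleR_matrix_vector_assoc[symmetric] inner_scaleR_right
          matrix_vector_mult_diff_rdistrib inner_diff_right sum_mv inner_sum_right 1
        using 2 by (auto simp: scaleR_matrix_vector_assoc[symmetric] matrix_vector_mul_assoc)
    qed
    then have "(\<Sum>i\<le>t. \<Sum>j\<le>t. W i \<bullet> (L2_block D t i j *v W j)) =
        (\<Sum>i\<le>t. \<Sum>j\<le>t. if 1 \<le> i then if j \<le> i - 1 then W i \<bullet> (gain (i - 1) *v (C_prod D j (i - 1) *v W j)) else 0 else 0)
        - (1/2) * (\<Sum>i\<le>t. \<Sum>j\<le>t. \<Sum>k<t. if i \<le> k then if j \<le> k then q i j k else 0 else 0)"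
      by (simp only: sum_subtractf sum_distrib_left)
    also have "(\<Sum>i\<le>t. \<Sum>j\<le>t. if 1 \<le> i then if j \<le> i - 1 then W i \<bullet> (gain (i - 1) *v (C_prod D j (i - 1) *v W j)) else 0 else 0)
        = (\<Sum>k<t. W (Suc k) \<bullet> (gain k *v \<xi> k))"
      by (subst sum.atMost_shift) (simp add: sum_atMost_restrict \<xi>_def inner_sum_right matrix_vector_mult_sum)
    also have "(\<Sum>i\<le>t. \<Sum>j\<le>t. \<Sum>k<t. if i \<le> k then if j \<le> k then q i j k else 0 else 0) =
        (\<Sum>k<t. \<Sum>i\<le>t. \<Sum>j\<le>t. if i \<le> k then if j \<le> k then q i j k else 0 else 0)"
      by (subst sum.swap[of _ _ "{..<t}"], subst sum.swap[of _ "{..<t}"]) (rule refl)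
    also have "\<dots> = (\<Sum>k<t. \<xi> k \<bullet> (S_mat D k *v \<xi> k))"
    proof (intro sum.cong refl)
      fix k assume "k \<in> {..<t}"
      then have k: "k \<le> t" by simp
      have "(\<Sum>i\<le>t. \<Sum>j\<le>t. if i \<le> k then if j \<le> k then q i j k else 0 else 0) =
          (\<Sum>i\<le>t. if i \<le> k then \<Sum>j\<le>t. if j \<le> k then q i j k else 0 else 0)"
        by (intro sum.cong) auto
      also have "\<dots> = (\<Sum>i\<le>k. \<Sum>j\<le>k. q i j k)"
        by (simp add: sum_atMost_restrict[OF k])
      also have "\<dots> = \<xi> k \<bullet> (transpose (S_mat D k) *v \<xi> k)"
        unfolding \<xi>_def matrix_vector_mult_sum inner_sum_right inner_sum_left q_def by (rule sum.swap)
      also have "\<dots> = \<xi> k \<bullet> (S_mat D k *v \<xi> k)"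
        unfolding inner_matrix_vector[of _ "S_mat D k"] by (rule inner_commute)
      finally show "(\<Sum>i\<le>t. \<Sum>j\<le>t. if i \<le> k then if j \<le> k then q i j k else 0 else 0) =
          \<xi> k \<bullet> (S_mat D k *v \<xi> k)" .
    qed
    finally show ?thesis
      by (simp add: sum_subtractf sum_distrib_left)
  qed
  show "log_L D Z Y t \<omega> = (\<Sum>k<t. - (s_vec D (Suc k) \<bullet> ((H_inv D k ** gain k) *v D_sum D k))
        - (1/2) * (D_sum D k \<bullet> (S_mat D k *v D_sum D k)))
    + (\<Sum>i\<le>t. noise_block (x_init D) Z Y \<omega> i \<bullet> L1_block D t i)
    + (\<Sum>i\<le>t. \<Sum>j\<le>t. noise_block (x_init D) Z Y \<omega> i \<bullet> (L2_block D t i j *v noise_block (x_init D) Z Y \<omega> j))"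
    unfolding log_L_increments W_def[symmetric] lin quad
    using inc by (simp add: c_def d_def sum.distrib)
qed

lemma log_L_stacked:
  fixes pos :: "'k::finite \<Rightarrow> nat"
  assumes pos: "bij_betw pos UNIV {..t}"
  obtains c where "\<And>(Z :: nat \<Rightarrow> 'a \<Rightarrow> real^'n) Y \<omega>. log_L D Z Y t \<omega> = c + noise_stack pos (x_init D) Z Y \<omega> \<bullet> L1_vec D pos t
    + noise_stack pos (x_init D) Z Y \<omega> \<bullet> (L2_mat D pos t *v noise_stack pos (x_init D) Z Y \<omega>)"
proof -
  show thesis
  proof (rule log_L_blocks)
    fix c
    assume c: "\<And>(Z :: nat \<Rightarrow> 'a \<Rightarrow> real^'n) Y \<omega>. log_L D Z Y t \<omega> = c
      + (\<Sum>i\<le>t. noise_block (x_init D) Z Y \<omega> i \<bullet> L1_block D t i)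
      + (\<Sum>i\<le>t. \<Sum>j\<le>t. noise_block (x_init D) Z Y \<omega> i \<bullet> (L2_block D t i j *v noise_block (x_init D) Z Y \<omega> j))"
    show thesis
    proof (rule that)
      fix Z Y :: "nat \<Rightarrow> 'a \<Rightarrow> real^'n" and \<omega>
      show "log_L D Z Y t \<omega> = c + noise_stack pos (x_init D) Z Y \<omega> \<bullet> L1_vec D pos t
        + noise_stack pos (x_init D) Z Y \<omega> \<bullet> (L2_mat D pos t *v noise_stack pos (x_init D) Z Y \<omega>)"
        unfolding c sum.reindex_bij_betw[OF pos, symmetric]
        by (simp add: noise_stack_def L1_vec_def L2_mat_def inner_block block_stack_mat_vector inner_sum_right)
    qed
  qed
qed

end

section \<open>Moments of the optimal state process\<close>

lemma outer_vector: "outer x y *v z = (y \<bullet> z) *\<^sub>R x"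
  by (simp add: outer_def matrix_vector_mult_def vec_eq_iff inner_vec_def sum_distrib_left mult_ac)

text \<open>
  Expanding \<open>x \<bullet> B y\<close> in coordinates expresses its mean by the mixed second moments of \<open>x\<close> and \<open>y\<close>,
  collected in the matrix \<open>P\<close>.
\<close>

lemma has_bochner_integral_bilinear:
  fixes x y :: "'a \<Rightarrow> real^'m" and B P :: "real^'m^'m"
  assumes "\<And>a b. has_bochner_integral M (\<lambda>\<omega>. (a \<bullet> x \<omega>) * (b \<bullet> y \<omega>)) (a \<bullet> (P *v b))"
  shows "has_bochner_integral M (\<lambda>\<omega>. x \<omega> \<bullet> (B *v y \<omega>)) (trace (transpose B ** P))"
proof -
  have eq: "x \<omega> \<bullet> (B *v y \<omega>) = (\<Sum>i\<in>UNIV. ((B *v axis i 1) \<bullet> x \<omega>) * (axis i 1 \<bullet> y \<omega>))" for \<omega>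
  proof -
    have "(B *v axis i 1) \<bullet> x \<omega> = (transpose B *v x \<omega>) $ i" for i
      using inner_matrix_vector[of "x \<omega>" B "axis i 1"] by (simp only: inner_commute) (simp add: inner_axis')
    then show ?thesis
      by (simp add: inner_matrix_vector[of "x \<omega>"] inner_vec_def[of "transpose B *v x \<omega>"] inner_axis')
  qed
  have tr: "(\<Sum>i\<in>UNIV. (B *v axis i 1) \<bullet> (P *v axis i 1)) = trace (transpose B ** P)"
  proof -
    have "(B *v axis i 1) \<bullet> (P *v axis i 1) = axis i 1 \<bullet> ((transpose B ** P) *v axis i 1)" for i :: 'm
      unfolding matrix_vector_mul_assoc[symmetric] inner_matrix_vector[of "axis i 1" "transpose B"] transpose_transpose ..
    then show ?thesis
      by (simp add: trace_def matrix_vector_mult_basis column_def inner_axis')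
  qed
  show ?thesis
    unfolding eq tr[symmetric] by (intro has_bochner_integral_sum assms)
qed

lemma has_bochner_integral_rewrite:
  "has_bochner_integral M f x \<Longrightarrow> (\<And>\<omega>. f \<omega> = g \<omega>) \<Longrightarrow> x = y \<Longrightarrow> has_bochner_integral M g y"
  by (metis ext)

lemma sym_part_form: "y \<bullet> (sym_part B *v y) = y \<bullet> (B *v y)"
  using inner_matrix_vector[of y B y]
  by (simp add: sym_part_def scaleR_matrix_vector_assoc[symmetric] matrix_vector_mult_add_rdistrib
      inner_add_right inner_commute)

locale noisy_control = quadratic_statistic D t + prob_space M
  for D :: "'n::finite control_problem" and t :: nat and M :: "'a measure" +
  fixes Z Y :: "nat \<Rightarrow> 'a \<Rightarrow> real^'n" and pos :: "'k::finite \<Rightarrow> nat"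
  assumes Z: "\<And>k. k < t \<Longrightarrow> distributed M lborel (Z k) (mvnormal_density 0 (Sz2 D))"
    and Y: "\<And>k. k < t \<Longrightarrow> distributed M lborel (Y k) (mvnormal_density 0 (Sy2 D))"
    and indep_noise: "indep_vars (\<lambda>_. borel) (case_sum Z Y) ({..<t} <+> {..<t})"
    and pos: "bij_betw pos UNIV {..t}"
begin

abbreviation (input) w where "w k \<omega> \<equiv> vconcat (Z k \<omega>) (Y k \<omega>)"

abbreviation (input) W where "W \<equiv> noise_stack pos (x_init D) Z Y"

lemmas W_law = distr_noise_stack[OF spd(1,2) prob_space_axioms Z Y indep_noise pos]

lemma inj_pos: "inj pos"
  using pos by (simp add: bij_betw_def)

lemmas psd_Sw_stack' = psd_Sw_stack[OF spd_imp_psd[OF spd(1)] spd_imp_psd[OF spd(2)] inj_pos]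

lemma transpose_sqrt_Sw_stack: "transpose (psd_sqrt (Sw_stack D pos)) = psd_sqrt (Sw_stack D pos)"
  using psd_psd_sqrt[OF psd_Sw_stack'] by (rule psd_imp_symmetric)

lemma has_bochner_integral_W_iff:
  fixes f :: "_ \<Rightarrow> real"
  assumes [measurable]: "f \<in> borel_measurable borel"
  shows "has_bochner_integral M (\<lambda>\<omega>. f (W \<omega>)) c \<longleftrightarrow>
    has_bochner_integral std_gauss (\<lambda>g. f (mw_vec D pos + psd_sqrt (Sw_stack D pos) *v g)) c"
proof -
  have affine: "(\<lambda>g. mw_vec D pos + psd_sqrt (Sw_stack D pos) *v g) \<in> measurable std_gauss borel"
    using borel_measurable_matrix_vector by measurable
  show ?thesis
    unfolding has_bochner_integral_iff
    using integrable_distr_eq[OF W_law(1) assms] integral_distr[OF W_law(1) assms]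
      integrable_distr_eq[OF affine assms] integral_distr[OF affine assms] W_law(2)
    by simp
qed

text \<open>
  A functional \<open>a \<bullet> w\<^sub>k\<close> of one noise vector is \<open>e \<bullet> W\<close>, where \<open>e\<close> has block \<open>a\<close> at position \<open>k + 1\<close> and
  zeros elsewhere. Under the law of \<open>W\<close> it becomes \<open>Q e \<bullet> g\<close>, and the covariance of two of them is
  \<open>Q e \<bullet> Q e' = e \<bullet> \<Sigma>\<^sup>w e'\<close>.
\<close>

lemma
  assumes k: "k < t"
  shows noise_mean: "has_bochner_integral M (\<lambda>\<omega>. a \<bullet> w k \<omega>) 0"
    and noise_covariance: "l < t \<Longrightarrow> has_bochner_integral M (\<lambda>\<omega>. (a \<bullet> w k \<omega>) * (b \<bullet> w l \<omega>))
      (if k = l then a \<bullet> (Sw_mat D *v b) else 0)"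
proof -
  let ?Q = "psd_sqrt (Sw_stack D pos)"
  define e where "e k a = stack_vec pos (\<lambda>i. if i = Suc k then a else 0)" for k and a :: "real^('n + 'n)"
  have ran: "range pos = {..t}"
    using pos by (simp add: bij_betw_def)
  have pick: "e k a \<bullet> x = a \<bullet> block x (inv pos (Suc k))" if "k < t" for k a x
  proof -
    have "pos l = Suc k \<longleftrightarrow> l = inv pos (Suc k)" for l
      using inj_pos ran that by (metis atMost_iff Suc_leI f_inv_into_f inv_f_f)
    then have "e k a \<bullet> x = (\<Sum>l\<in>UNIV. (if l = inv pos (Suc k) then a else 0) \<bullet> block x l)"
      by (simp add: e_def inner_block)
    also have "\<dots> = (\<Sum>l\<in>UNIV. if l = inv pos (Suc k) then a \<bullet> block x l else 0)"
      by (intro sum.cong) auto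
    finally show ?thesis by simp
  qed
  have pos_inv: "pos (inv pos (Suc k)) = Suc k" if "k < t" for k
    using ran that by (intro f_inv_into_f) auto
  have wW: "a \<bullet> w k \<omega> = e k a \<bullet> W \<omega>" if "k < t" for k a \<omega>
    by (simp add: pick[OF that] noise_stack_def pos_inv[OF that])
  have G: "e k a \<bullet> (mw_vec D pos + ?Q *v g) = (?Q *v e k a) \<bullet> g" if "k < t" for k a g
  proof -
    have "e k a \<bullet> mw_vec D pos = 0"
      by (simp add: pick[OF that] mw_vec_def pos_inv[OF that])
    then show ?thesis
      using inner_matrix_vector[of "e k a" ?Q g] by (simp add: inner_add_right transpose_sqrt_Sw_stack)
  qed
  show "has_bochner_integral M (\<lambda>\<omega>. a \<bullet> w k \<omega>) 0"
    unfolding wW[OF k]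
    by (subst has_bochner_integral_W_iff)
       (auto simp: G[OF k] has_bochner_integral_iff integrable_std_gauss_inner integral_std_gauss_inner)
  assume l: "l < t"
  have "(?Q *v e k a) \<bullet> (?Q *v e l b) = e k a \<bullet> (Sw_stack D pos *v e l b)"
    using inner_matrix_vector[of "e k a" ?Q "?Q *v e l b"]
    by (simp add: transpose_sqrt_Sw_stack matrix_vector_mul_assoc psd_sqrt_square[OF psd_Sw_stack'])
  also have "\<dots> = (if k = l then a \<bullet> (Sw_mat D *v b) else 0)"
    unfolding pick[OF k] Sw_stack_eq block_diagonal_stack_vector[OF inj_pos]
    by (simp add: e_def pos_inv[OF k] Sw_mat_def)
  finally have cov: "(?Q *v e k a) \<bullet> (?Q *v e l b) = (if k = l then a \<bullet> (Sw_mat D *v b) else 0)" .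
  show "has_bochner_integral M (\<lambda>\<omega>. (a \<bullet> w k \<omega>) * (b \<bullet> w l \<omega>)) (if k = l then a \<bullet> (Sw_mat D *v b) else 0)"
    unfolding wW[OF k] wW[OF l]
    by (subst has_bochner_integral_W_iff)
       (auto simp: G[OF k] G[OF l] has_bochner_integral_iff integrable_std_gauss_inner_mult
         integral_std_gauss_inner_mult cov)
qed

abbreviation (input) x where "x k \<omega> \<equiv> x_opt D Z Y k \<omega>"

lemma inner_x_Suc:
  assumes "k < t"
  shows "a \<bullet> x (Suc k) \<omega> = (K_mat D k *v a) \<bullet> x k \<omega> - a \<bullet> (H_inv D k *v s_vec D (Suc k)) + a \<bullet> w k \<omega>"
  unfolding x_opt_Suc[OF assms] inner_add_right inner_diff_right inner_matrix_vector[of a "transpose _"] transpose_transpose ..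

lemma has_bochner_integral_const_prob: "has_bochner_integral M (\<lambda>_. c) (c :: real)"
  by (simp add: has_bochner_integral_iff prob_space)

text \<open>
  By induction along the state recursion, which adds to \<open>x\<^sub>j\<^sub>+\<^sub>1\<close> only the noise \<open>w\<^sub>j\<close> with \<open>j < k\<close>.
\<close>

lemma state_noise_uncorrelated:
  assumes k: "k < t"
  shows "j \<le> k \<Longrightarrow> has_bochner_integral M (\<lambda>\<omega>. (a \<bullet> x j \<omega>) * (b \<bullet> w k \<omega>)) 0"
proof (induction j arbitrary: a)
  case 0
  have "has_bochner_integral M (\<lambda>\<omega>. (a \<bullet> x_init D) * (b \<bullet> w k \<omega>)) ((a \<bullet> x_init D) * 0)"
    by (intro has_bochner_integral_mult_right noise_mean k)
  then show ?case by simp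
next
  case (Suc j)
  have j: "j < t" "j \<noteq> k"
    using Suc.prems k by auto
  have "has_bochner_integral M (\<lambda>\<omega>. ((K_mat D j *v a) \<bullet> x j \<omega>) * (b \<bullet> w k \<omega>)
      - (a \<bullet> (H_inv D j *v s_vec D (Suc j))) * (b \<bullet> w k \<omega>) + (a \<bullet> w j \<omega>) * (b \<bullet> w k \<omega>))
      (0 - (a \<bullet> (H_inv D j *v s_vec D (Suc j))) * 0 + (if j = k then a \<bullet> (Sw_mat D *v b) else 0))"
    using Suc.prems
    by (intro has_bochner_integral_add has_bochner_integral_diff has_bochner_integral_mult_right
        Suc.IH noise_mean noise_covariance k j) auto
  then show ?case
    using j(2) unfolding inner_x_Suc[OF j(1)] by (simp add: algebra_simps)
qed

abbreviation (input) second_moment where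
  "second_moment k \<equiv> cov_seq D k + outer (mean_seq D k) (mean_seq D k)"

text \<open>
  The recursion for \<open>\<Sigma>\<^sub>k\<close> subtracts \<open>m\<^sub>k m\<^sub>k\<^sup>T\<close> at every step, so it is the recursion of the second moment
  matrix \<open>\<Sigma>\<^sub>k + m\<^sub>k m\<^sub>k\<^sup>T\<close>, obtained by multiplying out the state equation. The mixed terms of state and
  noise have mean zero.
\<close>

lemma state_moments:
  "k \<le> t \<Longrightarrow> (\<forall>a. has_bochner_integral M (\<lambda>\<omega>. a \<bullet> x k \<omega>) (a \<bullet> mean_seq D k)) \<and>
    (\<forall>a b. has_bochner_integral M (\<lambda>\<omega>. (a \<bullet> x k \<omega>) * (b \<bullet> x k \<omega>)) (a \<bullet> (second_moment k *v b)))"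
proof (induction k)
  case 0
  show ?case
    using has_bochner_integral_const_prob by (simp add: outer_vector inner_commute mult.commute)
next
  case (Suc k)
  have k: "k < t" "k \<le> t"
    using Suc.prems by auto
  define K h m where "K = K_mat D k" and "h = H_inv D k *v s_vec D (Suc k)" and "m = mean_seq D k"
  have IH1: "has_bochner_integral M (\<lambda>\<omega>. a \<bullet> x k \<omega>) (a \<bullet> m)"
    and IH2: "has_bochner_integral M (\<lambda>\<omega>. (a \<bullet> x k \<omega>) * (b \<bullet> x k \<omega>)) (a \<bullet> (second_moment k *v b))" for a b
    using Suc.IH[OF k(2)] by (auto simp: m_def)
  have step: "a \<bullet> x (Suc k) \<omega> = (K *v a) \<bullet> x k \<omega> - a \<bullet> h + a \<bullet> w k \<omega>" for a \<omega>
    unfolding K_def h_def by (rule inner_x_Suc[OF k(1)])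
  have mean: "has_bochner_integral M (\<lambda>\<omega>. a \<bullet> x (Suc k) \<omega>) (a \<bullet> mean_seq D (Suc k))" for a
  proof -
    have "has_bochner_integral M (\<lambda>\<omega>. (K *v a) \<bullet> x k \<omega> - a \<bullet> h + a \<bullet> w k \<omega>) ((K *v a) \<bullet> m - a \<bullet> h + 0)"
      by (intro has_bochner_integral_add has_bochner_integral_diff IH1 has_bochner_integral_const_prob noise_mean k)
    moreover have "(K *v a) \<bullet> m - a \<bullet> h + 0 = a \<bullet> mean_seq D (Suc k)"
      using inner_matrix_vector[of a "transpose K" m]
      by (simp add: inner_diff_right K_def h_def m_def)
    ultimately show ?thesis
      unfolding step by simp
  qed
  have "has_bochner_integral M (\<lambda>\<omega>. (a \<bullet> x (Suc k) \<omega>) * (b \<bullet> x (Suc k) \<omega>)) (a \<bullet> (second_moment (Suc k) *v b))" for a b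
  proof -
    let ?X = "\<lambda>\<omega>. (K *v a) \<bullet> x k \<omega>" and ?X' = "\<lambda>\<omega>. (K *v b) \<bullet> x k \<omega>"
    let ?w = "\<lambda>\<omega>. a \<bullet> w k \<omega>" and ?w' = "\<lambda>\<omega>. b \<bullet> w k \<omega>"
    have H: "has_bochner_integral M (\<lambda>\<omega>. ?X \<omega> * ?X' \<omega> - (b \<bullet> h) * ?X \<omega> - (a \<bullet> h) * ?X' \<omega> + (a \<bullet> h) * (b \<bullet> h)
        + ?X \<omega> * ?w' \<omega> - (a \<bullet> h) * ?w' \<omega> + ?X' \<omega> * ?w \<omega> - (b \<bullet> h) * ?w \<omega> + ?w \<omega> * ?w' \<omega>)
        ((K *v a) \<bullet> (second_moment k *v (K *v b)) - (b \<bullet> h) * ((K *v a) \<bullet> m) - (a \<bullet> h) * ((K *v b) \<bullet> m)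
        + (a \<bullet> h) * (b \<bullet> h) + 0 - (a \<bullet> h) * 0 + 0 - (b \<bullet> h) * 0 + (if k = k then a \<bullet> (Sw_mat D *v b) else 0))"
      by (intro has_bochner_integral_add has_bochner_integral_diff has_bochner_integral_mult_right
          IH1 IH2 has_bochner_integral_const_prob noise_mean noise_covariance state_noise_uncorrelated k) auto
    have E: "(K *v a) \<bullet> (second_moment k *v (K *v b)) - (b \<bullet> h) * ((K *v a) \<bullet> m) - (a \<bullet> h) * ((K *v b) \<bullet> m)
        + (a \<bullet> h) * (b \<bullet> h) + 0 - (a \<bullet> h) * 0 + 0 - (b \<bullet> h) * 0 + (if k = k then a \<bullet> (Sw_mat D *v b) else 0)
      = a \<bullet> (second_moment (Suc k) *v b)"
    proof -
      have tK: "a \<bullet> (transpose K *v y) = (K *v a) \<bullet> y" for a y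
        using inner_matrix_vector[of a "transpose K" y] by (simp only: transpose_transpose)
      have tH: "s_vec D (Suc k) \<bullet> (H_inv D k *v y) = h \<bullet> y" for y
        unfolding h_def inner_matrix_vector[of "s_vec D (Suc k)"] transpose_H_inv ..
      have "second_moment (Suc k) = transpose K ** second_moment k ** K
          - transpose K ** outer m (s_vec D (Suc k)) ** H_inv D k - H_inv D k ** outer (s_vec D (Suc k)) m ** K
          + H_inv D k ** outer (s_vec D (Suc k)) (s_vec D (Suc k)) ** H_inv D k + Sw_mat D"
        by (simp add: K_def m_def)
      then have "a \<bullet> (second_moment (Suc k) *v b) = (K *v a) \<bullet> (second_moment k *v (K *v b))
          - (h \<bullet> b) * ((K *v a) \<bullet> m) - (m \<bullet> (K *v b)) * (a \<bullet> h) + (h \<bullet> b) * (a \<bullet> h) + a \<bullet> (Sw_mat D *v b)"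
        by (simp only: matrix_vector_mult_add_rdistrib matrix_vector_mult_diff_rdistrib
            matrix_vector_mul_assoc[symmetric] outer_vector matrix_vector_mult_scaleR inner_add_right inner_diff_right
            inner_scaleR_right tK tH h_def[symmetric])
      then show ?thesis
        by (simp add: inner_commute algebra_simps)
    qed
    from H[unfolded E] show ?thesis
      unfolding step by (rule has_bochner_integral_rewrite) (simp_all add: algebra_simps)
  qed
  with mean show ?case by blast
qed

theorem log_L_mean:
  "has_bochner_integral M (log_L D Z Y t)
    (- (1/2) * (\<Sum>k<t.
      2 * (s_vec D (Suc k) \<bullet> ((H_inv D k ** E2_mat ** Sy2_inv D ** transpose (F_mat D k)) *v mean_seq D k))
      + trace ((F_mat D k ** Sy2_inv D ** transpose (F_mat D k)
                + 2 *\<^sub>R (G_mat D k ** H_inv D k ** E2_mat ** Sy2_inv D ** transpose (F_mat D k)))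
               ** (cov_seq D k + outer (mean_seq D k) (mean_seq D k)))))"
proof -
  have inc: "has_bochner_integral M (\<lambda>\<omega>. increment k (x k \<omega>) (w k \<omega>))
      (0 - s_vec D (Suc k) \<bullet> ((H_inv D k ** gain k) *v mean_seq D k) - (1/2) * trace (S_mat D k ** second_moment k))"
    if k: "k < t" for k
  proof -
    have mom: "has_bochner_integral M (\<lambda>\<omega>. a \<bullet> x k \<omega>) (a \<bullet> mean_seq D k)"
      "has_bochner_integral M (\<lambda>\<omega>. (a \<bullet> x k \<omega>) * (b \<bullet> x k \<omega>)) (a \<bullet> (second_moment k *v b))" for a b
      using state_moments[of k] k by auto
    have "has_bochner_integral M (\<lambda>\<omega>. x k \<omega> \<bullet> (transpose (gain k) *v w k \<omega>)) (trace (transpose (transpose (gain k)) ** 0))"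
      by (rule has_bochner_integral_bilinear) (simp add: state_noise_uncorrelated[OF k])
    then have 1: "has_bochner_integral M (\<lambda>\<omega>. w k \<omega> \<bullet> (gain k *v x k \<omega>)) 0"
      by (rule has_bochner_integral_rewrite)
         (simp_all add: inner_matrix_vector[of _ "transpose (gain k)"] inner_commute trace_def)
    have 2: "has_bochner_integral M (\<lambda>\<omega>. s_vec D (Suc k) \<bullet> ((H_inv D k ** gain k) *v x k \<omega>))
        (s_vec D (Suc k) \<bullet> ((H_inv D k ** gain k) *v mean_seq D k))"
      unfolding inner_matrix_vector[of "s_vec D (Suc k)"] by (rule mom(1))
    (* The transposed matrix defines the same form and yields the trace in the intended order. *)
    have "has_bochner_integral M (\<lambda>\<omega>. x k \<omega> \<bullet> (transpose (S_mat D k) *v x k \<omega>))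
        (trace (transpose (transpose (S_mat D k)) ** second_moment k))"
      by (rule has_bochner_integral_bilinear) (rule mom(2))
    then have 3: "has_bochner_integral M (\<lambda>\<omega>. x k \<omega> \<bullet> (S_mat D k *v x k \<omega>)) (trace (S_mat D k ** second_moment k))"
      by (rule has_bochner_integral_rewrite)
         (simp_all add: inner_matrix_vector[of _ "transpose (S_mat D k)"] inner_commute)
    show ?thesis
      unfolding increment_def
      by (intro has_bochner_integral_diff has_bochner_integral_mult_right 1 2 3)
  qed
  have "has_bochner_integral M (\<lambda>\<omega>. \<Sum>k<t. increment k (x k \<omega>) (w k \<omega>))
      (\<Sum>k<t. 0 - s_vec D (Suc k) \<bullet> ((H_inv D k ** gain k) *v mean_seq D k) - (1/2) * trace (S_mat D k ** second_moment k))"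
    by (rule has_bochner_integral_sum, rule inc) simp
  then show ?thesis
    by (rule has_bochner_integral_rewrite)
       (simp_all add: log_L_increments S_mat_def gain_def matrix_mul_assoc sum_distrib_left algebra_simps)
qed

section \<open>The tail bound\<close>

lemma log_L_symmetric_form:
  obtains c where
    "\<And>\<omega>. log_L D Z Y t \<omega> = c + W \<omega> \<bullet> L1_vec D pos t + W \<omega> \<bullet> (L2s_mat D pos t *v W \<omega>)"
proof (rule log_L_stacked[OF pos])
  fix c assume c: "\<And>(Z :: nat \<Rightarrow> 'a \<Rightarrow> real^'n) Y \<omega>. log_L D Z Y t \<omega> = c + noise_stack pos (x_init D) Z Y \<omega> \<bullet> L1_vec D pos t
    + noise_stack pos (x_init D) Z Y \<omega> \<bullet> (L2_mat D pos t *v noise_stack pos (x_init D) Z Y \<omega>)"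
  show thesis
    by (rule that[of c]) (simp only: c sym_part_form)
qed

text \<open>
  In terms of \<open>g\<close> the statistic is \<open>\<mu> + l \<bullet> g + g \<bullet> A g\<close> with mean \<open>\<mu> + tr A\<close>, so the threshold \<open>u\<close> exceeds
  its mean by \<open>\<epsilon>1 + \<epsilon>2\<close> and at least one of the centred parts has to account for its share.
\<close>

theorem log_L_tail:
  assumes \<epsilon>: "0 < \<epsilon>1" "0 < \<epsilon>2" "\<epsilon>1 + \<epsilon>2 = u - integral\<^sup>L M (log_L D Z Y t)"
  shows "measure M {\<omega> \<in> space M. log_L D Z Y t \<omega> \<ge> u}
    \<le> exp_neg (ereal (\<epsilon>1\<^sup>2) / ereal (2 * (norm (psd_sqrt (Sw_stack D pos) *v
        (L1_vec D pos t + 2 *\<^sub>R (L2s_mat D pos t *v mw_vec D pos))))\<^sup>2))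
      + exp_neg (ereal (1/8) * min
        (ereal (\<epsilon>2\<^sup>2) / ereal ((frobenius_norm (psd_sqrt (Sw_stack D pos) ** L2s_mat D pos t ** psd_sqrt (Sw_stack D pos)))\<^sup>2))
        (ereal \<epsilon>2 / ereal (spectral_norm (psd_sqrt (Sw_stack D pos) ** L2s_mat D pos t ** psd_sqrt (Sw_stack D pos)))))"
proof -
  define Q where "Q = psd_sqrt (Sw_stack D pos)"
  define L where "L = L2s_mat D pos t"
  define m where "m = mw_vec D pos"
  define l where "l = Q *v (L1_vec D pos t + 2 *\<^sub>R (L *v m))"
  define A where "A = Q ** L ** Q"
  obtain c where c: "\<And>\<omega>. log_L D Z Y t \<omega> = c + W \<omega> \<bullet> L1_vec D pos t + W \<omega> \<bullet> (L *v W \<omega>)"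
    using log_L_symmetric_form unfolding L_def by metis
  have sym_L: "transpose L = L"
    by (simp add: L_def sym_part_def transpose_scalar transpose_add add.commute)
  have sym_Q: "transpose Q = Q"
    unfolding Q_def by (rule transpose_sqrt_Sw_stack)
  have sym_A: "transpose A = A"
    by (simp add: A_def matrix_transpose_mul sym_Q sym_L matrix_mul_assoc)
  define \<mu> where "\<mu> = c + m \<bullet> L1_vec D pos t + m \<bullet> (L *v m)"
  define f where "f y = c + y \<bullet> L1_vec D pos t + y \<bullet> (L *v y)" for y
  have [measurable]: "(*v) L \<in> borel_measurable borel" "(*v) A \<in> borel_measurable borel"
    by (rule borel_measurable_matrix_vector)+
  have f_meas: "f \<in> borel_measurable borel"
    unfolding f_def by measurable
  have f: "f (m + Q *v g) = \<mu> + l \<bullet> g + g \<bullet> (A *v g)" for g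
  proof -
    have Q: "y \<bullet> (Q *v g) = (Q *v y) \<bullet> g" "(Q *v g) \<bullet> y = (Q *v y) \<bullet> g" for y
      using inner_matrix_vector[of y Q g] by (simp_all add: sym_Q inner_commute)
    have L: "m \<bullet> (L *v (Q *v g)) = (Q *v (L *v m)) \<bullet> g"
      using inner_matrix_vector[of m L "Q *v g"] Q(1)[of "L *v m"] by (simp add: sym_L)
    have "g \<bullet> (A *v g) = (Q *v g) \<bullet> (L *v (Q *v g))"
      unfolding A_def matrix_vector_mul_assoc[symmetric] inner_matrix_vector[of g Q] sym_Q ..
    then show ?thesis
      by (simp add: f_def \<mu>_def l_def inner_add_left inner_add_right matrix_vector_right_distrib L Q
          matrix_vector_mult_scaleR)
  qed
  have mean: "integral\<^sup>L M (log_L D Z Y t) = \<mu> + trace A"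
  proof -
    have "has_bochner_integral std_gauss (\<lambda>g. g \<bullet> (A *v g)) (trace (transpose A ** mat 1))"
      by (rule has_bochner_integral_bilinear)
         (simp add: has_bochner_integral_iff integrable_std_gauss_inner_mult integral_std_gauss_inner_mult)
    then have "has_bochner_integral std_gauss (\<lambda>g. \<mu> + l \<bullet> g + g \<bullet> (A *v g)) (\<mu> + 0 + trace A)"
      by (intro has_bochner_integral_add)
         (use std_gauss.prob_space in \<open>auto simp: has_bochner_integral_iff integrable_std_gauss_inner
           integral_std_gauss_inner sym_A\<close>)
    then have "has_bochner_integral M (\<lambda>\<omega>. f (W \<omega>)) (\<mu> + 0 + trace A)"
      unfolding has_bochner_integral_W_iff[OF f_meas] f[unfolded m_def Q_def] .
    moreover have "log_L D Z Y t = (\<lambda>\<omega>. f (W \<omega>))"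
      by (rule ext) (simp add: c f_def)
    ultimately show ?thesis
      by (simp add: has_bochner_integral_iff)
  qed
  have affine: "(\<lambda>g. m + Q *v g) \<in> measurable std_gauss borel"
    using borel_measurable_matrix_vector by measurable
  have law: "distr M borel W = distr std_gauss borel (\<lambda>g. m + Q *v g)"
    unfolding m_def Q_def by (rule W_law(2))
  have upset: "{y. u \<le> f y} \<in> sets borel"
    using f_meas by measurable
  have "measure M {\<omega> \<in> space M. log_L D Z Y t \<omega> \<ge> u} = measure (distr M borel W) {y. u \<le> f y}"
    by (subst measure_distr[OF W_law(1) upset]) (auto simp: c f_def intro!: arg_cong[where f = "measure M"])
  also have "\<dots> = measure std_gauss {g. u \<le> f (m + Q *v g)}"
    unfolding law
    by (subst measure_distr[OF affine upset]) (auto intro!: arg_cong[where f = "measure std_gauss"])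
  also have "\<dots> \<le> measure std_gauss ({g. \<epsilon>1 \<le> l \<bullet> g} \<union> {g. \<epsilon>2 \<le> g \<bullet> (A *v g) - trace A})"
    using \<epsilon>(3) by (intro std_gauss.finite_measure_mono) (auto simp: f mean)
  also have "\<dots> \<le> measure std_gauss {g. \<epsilon>1 \<le> l \<bullet> g} + measure std_gauss {g. \<epsilon>2 \<le> g \<bullet> (A *v g) - trace A}"
    by (rule measure_Un_le) (simp_all only: sets_std_gauss, measurable)
  also have "\<dots> \<le> exp_neg (ereal (\<epsilon>1\<^sup>2) / ereal (2 * (norm l)\<^sup>2))
      + exp_neg (ereal (1 / 8) * min (ereal (\<epsilon>2\<^sup>2) / ereal ((frobenius_norm A)\<^sup>2)) (ereal \<epsilon>2 / ereal (spectral_norm A)))"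
    by (intro add_mono std_gauss_linear_tail std_gauss_quadratic_tail sym_A \<epsilon>)
  finally show ?thesis
    unfolding l_def A_def L_def Q_def m_def .
qed

end

theorem theorem2:
  fixes D :: "'n::finite control_problem"
    and M :: "'a measure"
    and Z Y :: "nat \<Rightarrow> 'a \<Rightarrow> real^'n"
    and a b U :: real
    and t :: nat
    and pos :: "'k::finite \<Rightarrow> nat"
  assumes "spd (Sz2 D)" "spd (Sy2 D)" "spd (R_alpha D)" "spd (R_beta D)" "spd (R_v D)" "spd (T_v D)"
    and "0 \<le> lam D"
    and "psd (mat 1 - lam D *\<^sub>R
           (matrix_inv (psd_sqrt (Sy2 D)) ** matrix_inv (R_beta D) ** matrix_inv (psd_sqrt (Sy2 D))))"
    and "prob_space M"
    and "\<And>k. k < horizon D \<Longrightarrow> distributed M lborel (Z k) (mvnormal_density 0 (Sz2 D))"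
    and "\<And>k. k < horizon D \<Longrightarrow> distributed M lborel (Y k) (mvnormal_density 0 (Sy2 D))"
    and "prob_space.indep_vars M (\<lambda>_. borel) (case_sum Z Y) ({..<horizon D} <+> {..<horizon D})"
    and "a \<in> {0<..<1/2}" "b \<in> {0<..<1/2}" "U = (1 - b) / a"
    and "\<And>k. k < horizon D \<Longrightarrow> fd D k = 0"
    and "t \<le> horizon D"
    and "bij_betw pos UNIV {..t}"
  shows "integrable M (log_L D Z Y t)
    \<and> integral\<^sup>L M (log_L D Z Y t) =
        - (1/2) * (\<Sum>k<t.
            2 * (s_vec D (Suc k) \<bullet>
              ((H_inv D k ** E2_mat ** Sy2_inv D ** transpose (F_mat D k)) *v mean_seq D k))
            + trace ((F_mat D k ** Sy2_inv D ** transpose (F_mat D k)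
                      + 2 *\<^sub>R (G_mat D k ** H_inv D k ** E2_mat ** Sy2_inv D ** transpose (F_mat D k)))
                     ** (cov_seq D k + outer (mean_seq D k) (mean_seq D k))))
    \<and> (\<forall>\<epsilon>\<^sub>1 > 0. \<forall>\<epsilon>\<^sub>2 > 0. \<epsilon>\<^sub>1 + \<epsilon>\<^sub>2 = ln U - integral\<^sup>L M (log_L D Z Y t) \<longrightarrow>
         measure M {\<omega> \<in> space M. log_L D Z Y t \<omega> \<ge> ln U}
         \<le> exp_neg (ereal (\<epsilon>\<^sub>1\<^sup>2) /
              ereal (2 * (norm (psd_sqrt (Sw_stack D pos) *v
                (L1_vec D pos t + 2 *\<^sub>R (L2s_mat D pos t *v mw_vec D pos))))\<^sup>2))
           + exp_neg (ereal (1/8) * min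
              (ereal (\<epsilon>\<^sub>2\<^sup>2) / ereal ((frobenius_norm
                (psd_sqrt (Sw_stack D pos) ** L2s_mat D pos t ** psd_sqrt (Sw_stack D pos)))\<^sup>2))
              (ereal \<epsilon>\<^sub>2 / ereal (spectral_norm
                (psd_sqrt (Sw_stack D pos) ** L2s_mat D pos t ** psd_sqrt (Sw_stack D pos))))))"
proof -
  have "{..<t} <+> {..<t} \<subseteq> {..<horizon D} <+> {..<horizon D}"
    using assms(17) by auto
  then interpret noisy_control D t M Z Y pos
    using assms prob_space.indep_vars_subset[OF assms(9,12)]
    by (intro noisy_control.intro quadratic_statistic.intro deceptive_control.intro
        quadratic_statistic_axioms.intro noisy_control_axioms.intro) auto
  show ?thesis
    using log_L_mean log_L_tail by (auto simp only: has_bochner_integral_iff)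
qed

end
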